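(* For every integer $k\ge 1$, the defective chromatic number and the defective choice number of the class of graphs $G$ with $\mu(G)\le k$ are both equal to $k$. In particular, every graph $G$ with $\mu(G)\le k$ is $(k,d_k)$-choosable for some $d_k=2^{O(k\log\log k)}$.
   Context: $\mu(G)$ is the Colin de Verdière parameter: for $G$ with vertex set $\{1,\dots,n\}$, $\mu(G)$ is the largest corank of a real symmetric $n\times n$ matrix $M$ such that $M_{ij}<0$ if $ij\in E(G)$, $M_{ij}=0$ if $i\ne j$ and $ij\notin E(G)$, $M$ has exactly one negative eigenvalue (of multiplicity one), and there is no nonzero real symmetric matrix $X$ with $MX=0$ and $X_{ij}=0$ whenever $i=j$ or $ij\in E(G)$. $G$ is $(k,d)$-colourable if each vertex can be given one of $k$ colours so that each vertex has at most $d$ neighbours of its own colour; $(k,d)$-choosable if this holds with colours chosen from arbitrary lists of exactly $k$ colours per vertex. The defective chromatic (resp. choice) number of a class is the minimum $k$ such that for some $d$ every graph in the class is $(k,d)$-colourable (resp. choosable). *)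

theory Defs
  imports
    "HOL-Library.Extended_Nat"
    "HOL-Library.Landau_Symbols"
    "Graph_Theory.Pair_Digraph"
    "Jordan_Normal_Form.Matrix_Kernel"
    "Jordan_Normal_Form.Char_Poly"
begin

text \<open>
  A finite simple graph is a digraph satisfying \<^locale>\<open>pair_graph\<close>: its vertex set is finite and
  its arc set is symmetric and loopless, so that an edge \<open>uv\<close> is the pair of arcs
  \<open>(u, v)\<close>, \<open>(v, u)\<close>.
\<close>

text \<open>
  The bijection \<open>f\<close> numbers the vertices: row and column \<open>i\<close> of a matrix belong to the
  vertex \<open>f i\<close>.
\<close>

definition strong_arnold_property :: "'a pair_pre_digraph \<Rightarrow> nat \<Rightarrow> (nat \<Rightarrow> 'a) \<Rightarrow> real mat \<Rightarrow> bool"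
  where "strong_arnold_property G n f M \<longleftrightarrow>
    \<not> (\<exists>X. X \<in> carrier_mat n n \<and> X\<^sup>T = X \<and> X \<noteq> 0\<^sub>m n n \<and> M * X = 0\<^sub>m n n \<and>
          (\<forall>i<n. \<forall>j<n. i = j \<or> (f i, f j) \<in> parcs G \<longrightarrow> X $$ (i, j) = 0))"

definition colin_de_verdiere_matrix :: "'a pair_pre_digraph \<Rightarrow> nat \<Rightarrow> (nat \<Rightarrow> 'a) \<Rightarrow> real mat \<Rightarrow> bool"
  where "colin_de_verdiere_matrix G n f M \<longleftrightarrow>
    M \<in> carrier_mat n n \<and> M\<^sup>T = M \<and>
    (\<forall>i<n. \<forall>j<n. (f i, f j) \<in> parcs G \<longrightarrow> M $$ (i, j) < 0) \<and>
    (\<forall>i<n. \<forall>j<n. i \<noteq> j \<and> (f i, f j) \<notin> parcs G \<longrightarrow> M $$ (i, j) = 0) \<and>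
    (\<exists>!l. l < 0 \<and> eigenvalue M l) \<and>
    (\<forall>l. l < 0 \<and> eigenvalue M l \<longrightarrow> Polynomial.order l (char_poly M) = 1) \<and>
    strong_arnold_property G n f M"

definition colin_de_verdiere_coranks :: "'a pair_pre_digraph \<Rightarrow> nat set"
  where "colin_de_verdiere_coranks G =
    {kernel_dim M | M f. bij_betw f {..<card (pverts G)} (pverts G) \<and>
                         colin_de_verdiere_matrix G (card (pverts G)) f M}"

lemma colin_de_verdiere_coranks_le:
  assumes "c \<in> colin_de_verdiere_coranks G"
  shows "c \<le> card (pverts G)"
  using assms
  by (auto simp: colin_de_verdiere_coranks_def colin_de_verdiere_matrix_def kernel_dim_code)

lemma finite_colin_de_verdiere_coranks: "finite (colin_de_verdiere_coranks G)"
  by (rule finite_subset[of _ "{..card (pverts G)}"]) (auto dest: colin_de_verdiere_coranks_le)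

text \<open>
  On \<^typ>\<open>nat\<close>, the supremum of a nonempty finite set is its maximum and the supremum of
  the empty set is 0. The latter only serves to give the graph without vertices, which has no
  matrix with a negative eigenvalue, the conventional value 0.
\<close>

definition colin_de_verdiere :: "'a pair_pre_digraph \<Rightarrow> nat"
  where "colin_de_verdiere G = Sup (colin_de_verdiere_coranks G)"

definition has_defect :: "'a pair_pre_digraph \<Rightarrow> ('a \<Rightarrow> nat) \<Rightarrow> nat \<Rightarrow> bool"
  where "has_defect G c d \<longleftrightarrow>
    (\<forall>v\<in>pverts G. card {w. (v, w) \<in> parcs G \<and> c w = c v} \<le> d)"

definition defective_colourable :: "'a pair_pre_digraph \<Rightarrow> nat \<Rightarrow> nat \<Rightarrow> bool"
  where "defective_colourable G k d \<longleftrightarrow>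
    (\<exists>c. (\<forall>v\<in>pverts G. c v \<in> {..<k}) \<and> has_defect G c d)"

definition defective_choosable :: "'a pair_pre_digraph \<Rightarrow> nat \<Rightarrow> nat \<Rightarrow> bool"
  where "defective_choosable G k d \<longleftrightarrow>
    (\<forall>L. (\<forall>v\<in>pverts G. finite (L v) \<and> card (L v) = k) \<longrightarrow>
         (\<exists>c. (\<forall>v\<in>pverts G. c v \<in> L v) \<and> has_defect G c d))"

text \<open>The minimum is \<open>\<infinity>\<close> if no \<open>k\<close> works for the class.\<close>

definition defective_chromatic_number :: "'a pair_pre_digraph set \<Rightarrow> enat"
  where "defective_chromatic_number C =
    Inf (enat ` {k. \<exists>d. \<forall>G\<in>C. defective_colourable G k d})"

definition defective_choice_number :: "'a pair_pre_digraph set \<Rightarrow> enat"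
  where "defective_choice_number C =
    Inf (enat ` {k. \<exists>d. \<forall>G\<in>C. defective_choosable G k d})"

text \<open>
  Every finite graph is isomorphic to one whose vertices are natural numbers.
\<close>

definition colin_de_verdiere_class :: "nat \<Rightarrow> nat pair_pre_digraph set"
  where "colin_de_verdiere_class k = {G. pair_graph G \<and> colin_de_verdiere G \<le> k}"

end

theory Submission
  imports Defs "HOL-Library.Nat_Bijection" "HOL-Library.Sublist"
    "Jordan_Normal_Form.Jordan_Normal_Form_Uniqueness" "HOL-Real_Asymp.Real_Asymp"
begin

text \<open>
  Upper bound. Let \<open>H\<close> be the join of \<open>K\<^sub>k\<close> with three isolated vertices; it is contained in
  \<open>K\<^bsub>k + 3\<^esub>\<close>. If \<open>H\<close> is a minor of \<open>G\<close> then \<open>\<mu>(G) > k\<close>: put a Laplacian with weights of order 1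
  inside the branch sets and small weights elsewhere. The Schur complement onto one vertex of
  each branch set is then a small perturbation of a matrix with the pattern of \<open>H\<close>, and a
  contraction argument adjusts the small weights so that it becomes a multiple of
  \<open>(- \<beta> a - \<beta> b)\<close>, a matrix of rank 2 and corank \<open>k + 1\<close>; the strong Arnold property
  follows by compactness from that of the limit. Hence a graph with \<open>\<mu> \<le> k\<close> has no minor \<open>H\<close>, and
  all its minors have a vertex of degree \<open>O(k log k)\<close> by Mader's theorem. As in the work of
  Ossona de Mendez, Oum and Wood, a graph without minor \<open>H\<close> and of minimum degree at least \<open>k\<close> has
  an edge both of whose ends have bounded degree, and deleting such edges one after the other
  yields a colouring from lists of size \<open>k\<close> with bounded defect.

  Lower bound. The closure of the complete \<open>(d + 1)\<close>-ary tree with \<open>k\<close> levels is not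
  \<open>(k - 1, d)\<close>-colourable. Its parameter is at most \<open>k\<close>: otherwise some nonzero kernel
  vector vanishes on any given \<open>k\<close> vertices, and going down the tree one either
  exhausts the levels or finds four subtrees carrying kernel vectors of the corresponding principal submatrices,
  which combine to two kernel vectors with non-adjacent disjoint supports, contrary to the strong
  Arnold property.
\<close>

section \<open>Linear algebra of real symmetric matrices\<close>

text \<open>The matrix of large corank is built for \<open>G\<close> itself, so edges that the model
  of \<open>H\<close> does not use also need negative entries. Between the branch sets of the three
  independent vertices of \<open>H\<close> (the leaves) such edges, present or not, fix three
  entries of the reduced matrix. This is why there are three leaves: three pairwise sums determine
  \<beta> there, while all other entries, the diagonal included, are tuned by weights. A large
  constant \<beta> on the \<open>k\<close> core vertices keeps the tuned off-diagonal entries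
  negative. The form of (- \<beta> a - \<beta> b) vanishes on vectors of coordinate sum 0, which
  leaves room for one negative eigenvalue only. In the tree, four subtrees give two pairs, hence two
  kernel vectors x, y, and x y^T + y x^T violates the Arnold property. With at most three, zeros at
  one vertex in each of two of them can be afforded, because the zero at the root comes for free;
  the kernel vector is then confined to a single subtree, which is impossible. The exponent comes
  from counting \<open>k\<close>-cliques in \<open>D\<close>-degenerate graphs: there are at most
  \<open>D choose (k - 1)\<close> per vertex, and for D = O(k log k) this is (O(log k))^k.\<close>

lemma homogeneous_system:
  fixes a :: "'z \<Rightarrow> 'i \<Rightarrow> real"
  assumes "finite Z" "finite I" "card Z < card I"
  shows "\<exists>x. (\<exists>i\<in>I. x i \<noteq> 0) \<and> (\<forall>i. i \<notin> I \<longrightarrow> x i = 0) \<and> (\<forall>z\<in>Z. (\<Sum>i\<in>I. a z i * x i) = 0)"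
  using assms
proof (induction Z arbitrary: I a rule: finite_induct)
  case empty
  then have "I \<noteq> {}" by auto
  then show ?case by (intro exI[of _ "\<lambda>i. if i \<in> I then 1 else 0"]) auto
next
  case (insert z Z)
  show ?case
  proof (cases "\<forall>i\<in>I. a z i = 0")
    case True
    have "card Z < card I" using insert by simp
    from insert.IH[OF insert.prems(1) this, of a] obtain x where
      "\<exists>i\<in>I. x i \<noteq> 0" "\<forall>i. i \<notin> I \<longrightarrow> x i = 0" "\<forall>z\<in>Z. (\<Sum>i\<in>I. a z i * x i) = 0" by blast
    then show ?thesis using True by (intro exI[of _ x]) auto
  next
    case False
    then obtain p where p: "p \<in> I" "a z p \<noteq> 0" by auto
    define J where "J = I - {p}"
    \<comment> \<open>Gaussian elimination: row \<open>z\<close> is solved for the pivot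
      \<open>p\<close>, and \<open>b\<close> is the system that remains in the other
      unknowns.\<close>
    define b where "b = (\<lambda>w i. a w i - a w p * a z i / a z p)"
    have I: "I = insert p J" "p \<notin> J" "finite J" using p insert.prems unfolding J_def by auto
    have "card Z < card J" using insert I by simp
    from insert.IH[OF I(3) this, of b] obtain x where
      x: "\<exists>i\<in>J. x i \<noteq> 0" "\<forall>i. i \<notin> J \<longrightarrow> x i = 0" "\<forall>w\<in>Z. (\<Sum>i\<in>J. b w i * x i) = 0" by blast
    define y where "y = x(p := - (\<Sum>i\<in>J. a z i * x i) / a z p)"
    have yJ: "(\<Sum>i\<in>J. c i * y i) = (\<Sum>i\<in>J. c i * x i)" for c
      using I(2) unfolding y_def by (intro sum.cong) auto
    have eq: "(\<Sum>i\<in>I. a w i * y i) = (\<Sum>i\<in>J. b w i * x i)" for w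
      unfolding I(1) sum.insert[OF I(3,2)] yJ
      by (simp add: b_def y_def algebra_simps sum_subtractf sum_distrib_left sum_divide_distrib)
    have "(\<Sum>i\<in>J. b z i * x i) = 0" using p by (simp add: b_def)
    then have "\<forall>w\<in>insert z Z. (\<Sum>i\<in>I. a w i * y i) = 0" using x(3) by (auto simp: eq)
    moreover have "\<exists>i\<in>I. y i \<noteq> 0" using x(1) I unfolding y_def by auto
    moreover have "\<forall>i. i \<notin> I \<longrightarrow> y i = 0" using x(2) I unfolding y_def by auto
    ultimately show ?thesis by blast
  qed
qed

lemma bounded_real_seq_convergent_subseq:
  fixes x :: "nat \<Rightarrow> real"
  assumes "\<And>m. \<bar>x m\<bar> \<le> K"
  shows "\<exists>r l. strict_mono (r :: nat \<Rightarrow> nat) \<and> (\<lambda>m. x (r m)) \<longlonglongrightarrow> l"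
proof -
  obtain r where r: "strict_mono r" "monoseq (\<lambda>m. x (r m))" using seq_monosub by blast
  have "Bseq (\<lambda>m. x (r m))" by (rule BseqI'[of _ K]) (simp add: assms)
  then have "convergent (\<lambda>m. x (r m))" using r(2) by (rule Bseq_monoseq_convergent)
  then show ?thesis using r(1) by (auto simp: convergent_def)
qed

text \<open>Bolzano-Weierstrass in finitely many coordinates, by refining the subsequence once per
  coordinate; it supplies the compactness for the spectral theorem and for the perturbation
  argument.\<close>

lemma bounded_family_convergent_subseq:
  fixes x :: "nat \<Rightarrow> 'i \<Rightarrow> real"
  assumes "finite I" "\<And>m i. i \<in> I \<Longrightarrow> \<bar>x m i\<bar> \<le> K"
  shows "\<exists>r l. strict_mono (r :: nat \<Rightarrow> nat) \<and> (\<forall>i\<in>I. (\<lambda>m. x (r m) i) \<longlonglongrightarrow> l i)"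
  using assms
proof (induction I rule: finite_induct)
  case empty
  show ?case by (intro exI[of _ id]) (auto simp: strict_mono_def)
next
  case (insert j I)
  then obtain r l where r: "strict_mono (r :: nat \<Rightarrow> nat)" "\<forall>i\<in>I. (\<lambda>m. x (r m) i) \<longlonglongrightarrow> l i" by auto
  obtain q k where q: "strict_mono (q :: nat \<Rightarrow> nat)" "(\<lambda>m. x (r (q m)) j) \<longlonglongrightarrow> k"
    using bounded_real_seq_convergent_subseq[of "\<lambda>m. x (r m) j" K] insert.prems by auto
  have "(\<lambda>m. x (r (q m)) i) \<longlonglongrightarrow> (l(j := k)) i" if "i \<in> insert j I" for i
  proof (cases "i = j")
    case False
    then have "(\<lambda>m. x (r m) i) \<longlonglongrightarrow> l i" using that r by auto
    from LIMSEQ_subseq_LIMSEQ[OF this q(1)] show ?thesis using False by (simp add: o_def)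
  qed (use q in simp)
  then show ?case using strict_mono_o[OF r(1) q(1)]
    by (intro exI[of _ "r \<circ> q"] exI[of _ "l(j := k)"]) (auto simp: o_def simp del: fun_upd_apply)
qed

section \<open>The spectral theorem for real symmetric matrices\<close>

definition dotp :: "nat \<Rightarrow> (nat \<Rightarrow> real) \<Rightarrow> (nat \<Rightarrow> real) \<Rightarrow> real"
  where "dotp n x y = (\<Sum>i<n. x i * y i)"

definition app :: "nat \<Rightarrow> (nat \<Rightarrow> nat \<Rightarrow> real) \<Rightarrow> (nat \<Rightarrow> real) \<Rightarrow> nat \<Rightarrow> real"
  where "app n M x i = (\<Sum>j<n. M i j * x j)"

definition symf :: "nat \<Rightarrow> (nat \<Rightarrow> nat \<Rightarrow> real) \<Rightarrow> bool"
  where "symf n M \<longleftrightarrow> (\<forall>i<n. \<forall>j<n. M i j = M j i)"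

lemma dotp_commute: "dotp n x y = dotp n y x"
  by (simp add: dotp_def mult.commute)

lemma dotp_add_left: "dotp n (\<lambda>i. x i + y i) z = dotp n x z + dotp n y z"
  by (simp add: dotp_def algebra_simps sum.distrib)

lemma dotp_add_right: "dotp n z (\<lambda>i. x i + y i) = dotp n z x + dotp n z y"
  by (simp add: dotp_def algebra_simps sum.distrib)

lemma dotp_scale_left: "dotp n (\<lambda>i. c * x i) z = c * dotp n x z"
  by (simp add: dotp_def algebra_simps sum_distrib_left)

lemma dotp_scale_right: "dotp n z (\<lambda>i. c * x i) = c * dotp n z x"
  by (simp add: dotp_def algebra_simps sum_distrib_left)

lemma dotp_cong: "(\<And>i. i < n \<Longrightarrow> x i = x' i) \<Longrightarrow> (\<And>i. i < n \<Longrightarrow> y i = y' i) \<Longrightarrow> dotp n x y = dotp n x' y'"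
  by (simp add: dotp_def)

lemma app_cong: "(\<And>i. i < n \<Longrightarrow> x i = x' i) \<Longrightarrow> app n M x j = app n M x' j"
  by (simp add: app_def)

lemma app_add: "app n M (\<lambda>i. x i + y i) = (\<lambda>i. app n M x i + app n M y i)"
  by (simp add: app_def algebra_simps sum.distrib fun_eq_iff)

lemma app_scale: "app n M (\<lambda>i. c * x i) = (\<lambda>i. c * app n M x i)"
  by (simp add: app_def algebra_simps sum_distrib_left fun_eq_iff)

lemma dotp_self_nonneg: "dotp n x x \<ge> 0"
  by (simp add: dotp_def sum_nonneg)

lemma dotp_self_eq_0: "dotp n x x = 0 \<longleftrightarrow> (\<forall>i<n. x i = 0)"
  by (auto simp: dotp_def sum_nonneg_eq_0_iff)

lemma dotp_app_commute:
  assumes "symf n M" shows "dotp n (app n M x) y = dotp n x (app n M y)"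
proof -
  have "dotp n (app n M x) y = (\<Sum>i<n. \<Sum>j<n. M i j * x j * y i)"
    by (simp add: dotp_def app_def sum_distrib_right)
  also have "\<dots> = (\<Sum>j<n. \<Sum>i<n. M i j * x j * y i)" by (rule sum.swap)
  also have "\<dots> = (\<Sum>j<n. \<Sum>i<n. x j * (M j i * y i))"
    using assms by (intro sum.cong) (auto simp: symf_def)
  finally show ?thesis by (simp add: dotp_def app_def sum_distrib_left)
qed

text \<open>A quadratic that is 0 at 0 and nowhere negative has derivative 0 there. This turns
  minimality or semidefiniteness into an equation.\<close>

lemma quadratic_nonneg_linear_coeff_0:
  fixes b c :: real
  assumes "\<And>t. 2 * t * b + t^2 * c \<ge> 0"
  shows "b = 0"
proof (rule ccontr)
  assume b: "b \<noteq> 0"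
  \<comment> \<open>At t = -b/K the value is b^2 (c - 2K)/K^2, which is negative because
    \<open>K\<close> exceeds both c and 0.\<close>
  define K where "K = \<bar>c\<bar> + 1"
  have K0: "K > 0" by (simp add: K_def)
  have "2 * (- b / K) * b + (- b / K)^2 * c \<ge> 0" by (rule assms)
  then have "(2 * (- b / K) * b + (- b / K)^2 * c) * K^2 \<ge> 0" by simp
  moreover have "(2 * (- b / K) * b + (- b / K)^2 * c) * K^2 = b^2 * (c - 2 * K)"
    using K0 by (simp add: field_simps power2_eq_square)
  moreover have "b^2 * (c - 2 * K) < 0" using b by (intro mult_pos_neg) (auto simp: K_def)
  ultimately show False by linarith
qed

text \<open>The form attains a minimum \<mu> on the unit vectors orthogonal to the eigenvectors
  found so far, by compactness; the first-order condition at the minimiser makes it an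
  eigenvector.\<close>

lemma exists_next_eigenvector:
  assumes M: "symf n M" and m: "m < n"
    and orth: "\<And>k l. k < m \<Longrightarrow> l < m \<Longrightarrow> dotp n (q k) (q l) = (if k = l then 1 else 0)"
    and eig: "\<And>k i. k < m \<Longrightarrow> i < n \<Longrightarrow> app n M (q k) i = d k * q k i"
  shows "\<exists>x e. (\<forall>k<m. dotp n (q k) x = 0) \<and> dotp n x x = 1 \<and> (\<forall>i<n. app n M x i = e * x i)"
proof -
  define F where "F x = dotp n x (app n M x)" for x
  define P where "P x \<longleftrightarrow> (\<forall>k<m. dotp n (q k) x = 0)" for x
  define S where "S = {x. P x \<and> dotp n x x = 1}"
  obtain x0 where x0: "\<exists>i<n. x0 i \<noteq> 0" "P x0"
    using homogeneous_system[of "{..<m}" "{..<n}" q] m by (auto simp: P_def dotp_def)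
  have normalise: "(\<lambda>i. inverse (sqrt (dotp n x x)) * x i) \<in> S" if "P x" "dotp n x x \<noteq> 0" for x
  proof -
    have "dotp n x x > 0" using that dotp_self_nonneg[of n x] by linarith
    then show ?thesis using that
      unfolding S_def P_def mem_Collect_eq dotp_scale_left dotp_scale_right
      by (auto simp: field_simps)
  qed
  have "S \<noteq> {}" using normalise[of x0] x0 dotp_self_eq_0[of n x0] by auto
  have coord: "\<bar>x i\<bar> \<le> 1" if "x \<in> S" "i < n" for x i
  proof -
    have "(x i)^2 \<le> dotp n x x" unfolding dotp_def power2_eq_square
      by (rule member_le_sum) (use that in auto)
    then show ?thesis using that by (simp add: S_def abs_square_le_1)
  qed
  define K where "K = (\<Sum>i<n. \<Sum>j<n. \<bar>M i j\<bar>)"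
  have bound: "F x \<ge> - K" if "x \<in> S" for x
  proof -
    have "\<bar>F x\<bar> \<le> (\<Sum>i<n. \<bar>\<Sum>j<n. x i * (M i j * x j)\<bar>)"
      unfolding F_def dotp_def app_def sum_distrib_left by (rule sum_abs)
    also have "\<dots> \<le> (\<Sum>i<n. \<Sum>j<n. \<bar>x i * (M i j * x j)\<bar>)" by (intro sum_mono sum_abs)
    also have "\<dots> \<le> K" unfolding K_def
    proof (intro sum_mono)
      fix i j assume "i \<in> {..<n}" "j \<in> {..<n}"
      then have "\<bar>x i\<bar> * \<bar>x j\<bar> \<le> 1 * 1" using coord[OF that] by (intro mult_mono) auto
      then have "\<bar>M i j\<bar> * (\<bar>x i\<bar> * \<bar>x j\<bar>) \<le> \<bar>M i j\<bar> * 1" by (intro mult_left_mono) auto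
      then show "\<bar>x i * (M i j * x j)\<bar> \<le> \<bar>M i j\<bar>" by (simp add: abs_mult mult_ac)
    qed
    finally show ?thesis by linarith
  qed
  define \<mu> where "\<mu> = Inf (F ` S)"
  have bdd: "bdd_below (F ` S)" using bound by (intro bdd_belowI2[of _ "- K"]) auto
  have lower: "\<mu> \<le> F x" if "x \<in> S" for x unfolding \<mu>_def using bdd that by (auto intro: cInf_lower)
  have "\<exists>x\<in>S. F x < \<mu> + 1 / real (Suc t)" for t
  proof -
    have "Inf (F ` S) < \<mu> + 1 / real (Suc t)" by (simp add: \<mu>_def)
    from cInf_lessD[OF _ this] show ?thesis using \<open>S \<noteq> {}\<close> by auto
  qed
  then obtain xs where xs: "\<And>t. xs t \<in> S" "\<And>t. F (xs t) < \<mu> + 1 / real (Suc t)" by metis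
  obtain r x where r: "strict_mono (r :: nat \<Rightarrow> nat)" "\<forall>i\<in>{..<n}. (\<lambda>t. xs (r t) i) \<longlonglongrightarrow> x i"
    using bounded_family_convergent_subseq[of "{..<n}" xs 1] coord[OF xs(1)] by auto
  have lim: "(\<lambda>t. dotp n c (xs (r t))) \<longlonglongrightarrow> dotp n c x" for c
    unfolding dotp_def by (intro tendsto_intros) (use r in auto)
  have "P x" unfolding P_def
  proof (intro allI impI)
    fix k assume "k < m"
    then have "(\<lambda>t. dotp n (q k) (xs (r t))) = (\<lambda>_. 0)" using xs(1) by (auto simp: S_def P_def)
    then show "dotp n (q k) x = 0" using lim[of "q k"] LIMSEQ_unique[OF _ tendsto_const] by metis
  qed
  have "(\<lambda>t. dotp n (xs (r t)) (xs (r t))) \<longlonglongrightarrow> dotp n x x"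
    unfolding dotp_def by (intro tendsto_intros) (use r in auto)
  moreover have "(\<lambda>t. dotp n (xs (r t)) (xs (r t))) = (\<lambda>_. 1)" using xs(1) by (auto simp: S_def)
  ultimately have x1: "dotp n x x = 1" using LIMSEQ_unique[OF _ tendsto_const] by metis
  have "(\<lambda>t. F (xs (r t))) \<longlonglongrightarrow> F x"
    unfolding dotp_def app_def F_def by (intro tendsto_intros) (use r in auto)
  moreover have "(\<lambda>t. \<mu> + 1 / real (Suc (r t))) \<longlonglongrightarrow> \<mu> + 0"
    by (intro tendsto_add tendsto_const LIMSEQ_subseq_LIMSEQ[OF LIMSEQ_inverse_real_of_nat r(1), unfolded o_def inverse_eq_divide])
  ultimately have "F x \<le> \<mu> + 0"
    using xs(2) by (intro LIMSEQ_le[where X = "\<lambda>t. F (xs (r t))"]) (auto intro: less_imp_le)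
  then have Fx: "F x \<le> \<mu>" by simp
  have min: "F y \<ge> \<mu> * dotp n y y" if "P y" for y
  proof (cases "dotp n y y = 0")
    case True
    then have "F y = 0" unfolding F_def using dotp_self_eq_0[of n y] by (simp add: dotp_def)
    then show ?thesis using True by simp
  next
    case False
    define c where "c = inverse (sqrt (dotp n y y))"
    have pos: "dotp n y y > 0" using False dotp_self_nonneg[of n y] by linarith
    have "\<mu> \<le> F (\<lambda>i. c * y i)" unfolding c_def by (intro lower normalise that False)
    also have "\<dots> = c^2 * F y"
      by (simp add: F_def app_scale dotp_scale_left dotp_scale_right power2_eq_square)
    also have "c^2 = 1 / dotp n y y" using pos by (simp add: c_def field_simps power_inverse)
    finally show ?thesis using pos by (simp add: field_simps)
  qed
  have first_order: "dotp n y (app n M x) = \<mu> * dotp n y x" if "P y" for y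
  proof -
    have "dotp n y (app n M x) - \<mu> * dotp n y x = 0"
    proof (rule quadratic_nonneg_linear_coeff_0)
      fix t :: real
      have "P (\<lambda>i. x i + t * y i)" using \<open>P x\<close> that
        by (auto simp: P_def dotp_add_right dotp_scale_right)
      from min[OF this] have *: "\<mu> * dotp n (\<lambda>i. x i + t * y i) (\<lambda>i. x i + t * y i) \<le> F (\<lambda>i. x i + t * y i)" .
      have "dotp n (\<lambda>i. x i + t * y i) (\<lambda>i. x i + t * y i) = dotp n x x + 2 * t * dotp n y x + t^2 * dotp n y y"
        unfolding dotp_add_left dotp_add_right dotp_scale_left dotp_scale_right dotp_commute[of n x y]
        by (simp add: power2_eq_square algebra_simps)
      moreover have "F (\<lambda>i. x i + t * y i) = F x + 2 * t * dotp n y (app n M x) + t^2 * F y"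
      proof -
        have "dotp n x (app n M y) = dotp n y (app n M x)"
          using dotp_app_commute[OF M, of x y] by (simp add: dotp_commute)
        then show ?thesis
          unfolding F_def app_add app_scale dotp_add_left dotp_add_right dotp_scale_left dotp_scale_right
          by (simp add: power2_eq_square algebra_simps)
      qed
      ultimately have "\<mu> * (dotp n x x + 2 * t * dotp n y x + t^2 * dotp n y y) \<le>
         F x + 2 * t * dotp n y (app n M x) + t^2 * F y" using * by simp
      then have "\<mu> + 2 * t * (\<mu> * dotp n y x) + t^2 * (\<mu> * dotp n y y) \<le>
         \<mu> + 2 * t * dotp n y (app n M x) + t^2 * F y"
        using Fx x1 by (simp add: algebra_simps)
      then show "2 * t * (dotp n y (app n M x) - \<mu> * dotp n y x) + t^2 * (F y - \<mu> * dotp n y y) \<ge> 0"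
        by (simp add: algebra_simps)
    qed
    then show ?thesis by simp
  qed
  \<comment> \<open>The residual \<open>w\<close> is itself orthogonal to all \<open>q k\<close>, by
    symmetry of \<open>M\<close>, so the first-order condition can be tested on \<open>w\<close> and
    gives |w|^2 = 0.\<close>
  define w where "w = (\<lambda>i. app n M x i + (- \<mu>) * x i)"
  have "dotp n (q k) w = 0" if "k < m" for k
  proof -
    have "dotp n (q k) (app n M x) = dotp n (app n M (q k)) x" using dotp_app_commute[OF M] by simp
    also have "\<dots> = dotp n (\<lambda>i. d k * q k i) x" by (intro dotp_cong) (use eig that in auto)
    also have "\<dots> = 0" using \<open>P x\<close> that by (simp add: dotp_scale_left P_def)
    finally show ?thesis using \<open>P x\<close> that unfolding w_def dotp_add_right dotp_scale_right by (simp add: P_def)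
  qed
  then have "P w" by (simp add: P_def)
  have "dotp n w w = dotp n w (app n M x) + (- \<mu>) * dotp n w x"
    by (subst (2) w_def) (simp only: dotp_add_right dotp_scale_right)
  with first_order[OF \<open>P w\<close>] have "dotp n w w = 0" by simp
  then have "\<forall>i<n. app n M x i = \<mu> * x i" by (simp add: dotp_self_eq_0 w_def)
  then show ?thesis using \<open>P x\<close> x1 by (auto simp: P_def)
qed

theorem spectral_decomposition:
  assumes M: "symf n M"
  shows "\<exists>q d. (\<forall>k<n. \<forall>l<n. dotp n (q k) (q l) = (if k = l then 1 else 0)) \<and>
               (\<forall>k<n. \<forall>i<n. app n M (q k) i = d k * q k i)"
proof -
  have "m \<le> n \<Longrightarrow> \<exists>q d. (\<forall>k<m. \<forall>l<m. dotp n (q k) (q l) = (if k = l then 1 else 0)) \<and>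
               (\<forall>k<m. \<forall>i<n. app n M (q k) i = d k * q k i)" for m
  proof (induction m)
    case (Suc m)
    then have "m \<le> n" by simp
    from Suc.IH[OF this] obtain q d where
      qd: "\<And>k l. k < m \<Longrightarrow> l < m \<Longrightarrow> dotp n (q k) (q l) = (if k = l then 1 else 0)"
      "\<And>k i. k < m \<Longrightarrow> i < n \<Longrightarrow> app n M (q k) i = d k * q k i" by blast
    obtain x e where x: "\<And>k. k < m \<Longrightarrow> dotp n (q k) x = 0" "dotp n x x = 1" "\<forall>i<n. app n M x i = e * x i"
      using exists_next_eigenvector[OF M _ qd, of m] Suc.prems by auto
    have x': "dotp n x (q k) = 0" if "k < m" for k using x(1)[OF that] by (simp add: dotp_commute)
    show ?case
      by (rule exI[of _ "q(m := x)"], rule exI[of _ "d(m := e)"])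
        (use x x' qd in \<open>auto simp: less_Suc_eq\<close>)
  qed simp
  from this[of n] show ?thesis by simp
qed

section \<open>Spectral invariants read off from an orthonormal eigenbasis\<close>

definition bilin :: "nat \<Rightarrow> (nat \<Rightarrow> nat \<Rightarrow> real) \<Rightarrow> (nat \<Rightarrow> real) \<Rightarrow> (nat \<Rightarrow> real) \<Rightarrow> real"
  where "bilin n M x y = dotp n x (app n M y)"

definition entries :: "real mat \<Rightarrow> nat \<Rightarrow> nat \<Rightarrow> real"
  where "entries M i j = M $$ (i, j)"

definition orthonormal_eigenbasis :: "nat \<Rightarrow> (nat \<Rightarrow> nat \<Rightarrow> real) \<Rightarrow> (nat \<Rightarrow> nat \<Rightarrow> real) \<Rightarrow> (nat \<Rightarrow> real) \<Rightarrow> bool"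
  where "orthonormal_eigenbasis n M q d \<longleftrightarrow>
    (\<forall>k<n. \<forall>l<n. dotp n (q k) (q l) = (if k = l then 1 else 0)) \<and>
    (\<forall>k<n. \<forall>i<n. app n M (q k) i = d k * q k i)"

lemma jordan_matrix_diagonal:
  "jordan_matrix (map (\<lambda>a. (1, a)) as) =
    mat (length as) (length as) (\<lambda>(i, j). if i = j then as ! i else (0 :: real))"
proof (induction as)
  case Nil
  show ?case by (intro eq_matI) (auto simp: jordan_matrix_def)
next
  case (Cons a as)
  define J where "J = jordan_matrix (map (\<lambda>a. (1, a :: real)) as)"
  have "dim_row J = length as" "dim_col J = length as" unfolding J_def Cons.IH by auto
  then have "jordan_matrix (map (\<lambda>a. (1, a)) (a # as)) = four_block_mat (jordan_block 1 a)
     (0\<^sub>m 1 (length as)) (0\<^sub>m (length as) 1) J"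
    by (simp add: jordan_matrix_def Let_def J_def)
  then show ?case unfolding J_def Cons.IH by (intro eq_matI) (auto simp: jordan_block_def nth_Cons')
qed

lemma eigenbasis_similar:
  assumes M: "M \<in> carrier_mat n n" and qd: "orthonormal_eigenbasis n (entries M) q d"
  defines "P \<equiv> mat n n (\<lambda>(i, k). q k i)"
    and "D \<equiv> mat n n (\<lambda>(i, j). if i = j then d i else 0)"
  shows "P\<^sup>T * P = 1\<^sub>m n" "P * P\<^sup>T = 1\<^sub>m n" "M = P * D * P\<^sup>T"
proof -
  have P: "P \<in> carrier_mat n n" and D: "D \<in> carrier_mat n n" by (auto simp: P_def D_def)
  show 1: "P\<^sup>T * P = 1\<^sub>m n"
    using qd by (intro eq_matI)
      (auto simp: P_def scalar_prod_def orthonormal_eigenbasis_def dotp_def lessThan_atLeast0)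
  show 2: "P * P\<^sup>T = 1\<^sub>m n" by (rule mat_mult_left_right_inverse[OF _ _ 1]) (use P in auto)
  have "M * P = P * D"
  proof (rule eq_matI)
    fix i j assume "i < dim_row (P * D)" "j < dim_col (P * D)"
    then have ij: "i < n" "j < n" using P D by auto
    have "(M * P) $$ (i, j) = app n (entries M) (q j) i"
      using ij M by (simp add: P_def scalar_prod_def app_def entries_def lessThan_atLeast0)
    also have "\<dots> = q j i * d j" using qd ij by (simp add: orthonormal_eigenbasis_def)
    also have "\<dots> = (\<Sum>k = 0..<n. if k = j then q j i * d j else 0)" using ij by simp
    also have "\<dots> = (P * D) $$ (i, j)"
      using ij by (simp add: P_def D_def scalar_prod_def if_distrib cong: if_cong)
    finally show "(M * P) $$ (i, j) = (P * D) $$ (i, j)" .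
  qed (use M P D in auto)
  then have "(M * P) * P\<^sup>T = P * D * P\<^sup>T" by simp
  then show "M = P * D * P\<^sup>T" using M P 2 by (simp add: assoc_mult_mat[of _ n n _ n _ n])
qed

text \<open>An orthogonal diagonalisation is a Jordan form with blocks of size 1. Algebraic
  multiplicities and the kernel dimension thereby become counts of indices \<open>k\<close> with a
  given \<open>d k\<close>.\<close>

lemma eigenbasis_jordan_nf:
  assumes M: "M \<in> carrier_mat n n" and qd: "orthonormal_eigenbasis n (entries M) q d"
  shows "jordan_nf M (map (\<lambda>k. (1, d k)) [0..<n])"
proof -
  have "jordan_matrix (map (\<lambda>a. (1, a)) (map d [0..<n])) =
     mat n n (\<lambda>(i, j). if i = j then d i else 0)"
    unfolding jordan_matrix_diagonal by (intro eq_matI) auto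
  then have J: "jordan_matrix (map (\<lambda>k. (1, d k)) [0..<n]) = mat n n (\<lambda>(i, j). if i = j then d i else 0)"
    by (simp add: o_def)
  note s = eigenbasis_similar[OF M qd]
  show ?thesis unfolding jordan_nf_def J similar_mat_def similar_mat_wit_def Let_def
    using M s by (intro conjI exI[of _ "mat n n (\<lambda>(i, k). q k i)"]
        exI[of _ "(mat n n (\<lambda>(i, k). q k i))\<^sup>T"]) auto
qed

lemma sum_list_filter_card:
  "(\<Sum>x\<leftarrow>filter P xs. Suc 0) = length (filter P xs)"
  by (induction xs) auto

lemma length_filter_upt: "length (filter P [0..<n]) = card {k. k < n \<and> P k}"
proof -
  have "length (filter P [0..<n]) = card (set (filter P [0..<n]))"
    by (rule distinct_card[symmetric]) simp
  then show ?thesis by (simp add: conj_commute)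
qed

lemma eigenbasis_order:
  assumes "M \<in> carrier_mat n n" "orthonormal_eigenbasis n (entries M) q d"
  shows "Polynomial.order l (char_poly M) = card {k. k < n \<and> d k = l}"
proof -
  have "Polynomial.order l (char_poly M) =
    sum_list (map fst (filter (\<lambda>na. snd na = l) (map (\<lambda>k. (1, d k)) [0..<n])))"
    by (rule jordan_nf_order[OF eigenbasis_jordan_nf[OF assms]])
  also have "\<dots> = length (filter (\<lambda>k. d k = l) [0..<n])"
    by (simp add: filter_map o_def sum_list_filter_card)
  finally show ?thesis unfolding length_filter_upt .
qed

lemma eigenbasis_eigenvalue:
  assumes M: "M \<in> carrier_mat n n" and qd: "orthonormal_eigenbasis n (entries M) q d"
  shows "eigenvalue M l \<longleftrightarrow> (\<exists>k<n. d k = l)"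
proof -
  have "char_poly M \<noteq> 0" using degree_monic_char_poly[OF M] by auto
  then have "eigenvalue M l \<longleftrightarrow> Polynomial.order l (char_poly M) \<noteq> 0"
    unfolding eigenvalue_root_char_poly[OF M] by (simp add: order_root)
  also have "\<dots> \<longleftrightarrow> (\<exists>k<n. d k = l)"
    unfolding eigenbasis_order[OF assms] by (auto simp: card_eq_0_iff)
  finally show ?thesis .
qed

lemma eigenbasis_kernel_dim:
  assumes M: "M \<in> carrier_mat n n" and qd: "orthonormal_eigenbasis n (entries M) q d"
  shows "kernel_dim M = card {k. k < n \<and> d k = 0}"
proof -
  have "char_matrix M 0 = M" using M by (intro eq_matI) (auto simp: char_matrix_def)
  then have "kernel_dim M = dim_gen_eigenspace M 0 1"
    using M by (simp add: dim_gen_eigenspace_def)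
  also have "\<dots> = dim_gen_eigenspace (jordan_matrix (map (\<lambda>k. (1, d k)) [0..<n])) 0 1"
    using eigenbasis_jordan_nf[OF assms] dim_gen_eigenspace_similar
    unfolding jordan_nf_def by metis
  also have "\<dots> = length (filter (\<lambda>k. d k = 0) [0..<n])"
    unfolding dim_gen_eigenspace_jordan_matrix
    by (simp add: filter_map o_def sum_list_filter_card)
  finally show ?thesis unfolding length_filter_upt .
qed

lemma symf_entries: "M \<in> carrier_mat n n \<Longrightarrow> M\<^sup>T = M \<Longrightarrow> symf n (entries M)"
  unfolding symf_def entries_def by (metis carrier_matD index_transpose_mat(1))

lemma eigenbasis_exists:
  assumes "M \<in> carrier_mat n n" "M\<^sup>T = M"
  shows "\<exists>q d. orthonormal_eigenbasis n (entries M) q d"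
  using spectral_decomposition[OF symf_entries[OF assms]] by (simp add: orthonormal_eigenbasis_def)

lemma eigenbasis_expansion:
  assumes M: "M \<in> carrier_mat n n" and qd: "orthonormal_eigenbasis n (entries M) q d" and i: "i < n"
  shows "x i = (\<Sum>k<n. dotp n (q k) x * q k i)"
proof -
  have "(\<Sum>k<n. q k i * q k j) = (if i = j then 1 else 0)" if j: "j < n" for j
  proof -
    define P where "P = mat n n (\<lambda>(i, k). q k i)"
    have "(P * P\<^sup>T) $$ (i, j) = (\<Sum>k<n. q k i * q k j)"
      using i j by (simp add: P_def scalar_prod_def lessThan_atLeast0)
    then show ?thesis using eigenbasis_similar(2)[OF M qd] i j by (simp add: P_def)
  qed
  note * = this
  have "(\<Sum>k<n. dotp n (q k) x * q k i) = (\<Sum>k<n. \<Sum>j<n. q k j * x j * q k i)"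
    by (simp add: dotp_def sum_distrib_right)
  also have "\<dots> = (\<Sum>j<n. \<Sum>k<n. q k j * x j * q k i)" by (rule sum.swap)
  also have "\<dots> = (\<Sum>j<n. x j * (\<Sum>k<n. q k i * q k j))" by (simp add: sum_distrib_left mult_ac)
  also have "\<dots> = (\<Sum>j<n. if i = j then x i else 0)" by (intro sum.cong) (auto simp: *)
  finally show ?thesis using i by simp
qed

lemma eigenbasis_app:
  assumes M: "M \<in> carrier_mat n n" and qd: "orthonormal_eigenbasis n (entries M) q d" and i: "i < n"
  shows "app n (entries M) x i = (\<Sum>k<n. d k * dotp n (q k) x * q k i)"
proof -
  have "app n (entries M) x i = (\<Sum>j<n. entries M i j * (\<Sum>k<n. dotp n (q k) x * q k j))"
    unfolding app_def by (intro sum.cong) (auto simp: eigenbasis_expansion[OF M qd, of _ x])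
  also have "\<dots> = (\<Sum>j<n. \<Sum>k<n. dotp n (q k) x * (entries M i j * q k j))"
    by (simp add: sum_distrib_left mult_ac)
  also have "\<dots> = (\<Sum>k<n. \<Sum>j<n. dotp n (q k) x * (entries M i j * q k j))" by (rule sum.swap)
  also have "\<dots> = (\<Sum>k<n. dotp n (q k) x * app n (entries M) (q k) i)"
    by (simp add: app_def sum_distrib_left)
  finally show ?thesis using qd i by (simp add: orthonormal_eigenbasis_def mult_ac)
qed

lemma eigenbasis_bilin:
  assumes M: "M \<in> carrier_mat n n" and qd: "orthonormal_eigenbasis n (entries M) q d"
  shows "bilin n (entries M) x y = (\<Sum>k<n. d k * dotp n (q k) x * dotp n (q k) y)"
proof -
  have "bilin n (entries M) x y = (\<Sum>i<n. x i * (\<Sum>k<n. d k * dotp n (q k) y * q k i))"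
    unfolding bilin_def dotp_def by (intro sum.cong) (auto simp: eigenbasis_app[OF M qd] dotp_def)
  also have "\<dots> = (\<Sum>i<n. \<Sum>k<n. d k * dotp n (q k) y * (q k i * x i))"
    by (simp add: sum_distrib_left mult_ac)
  also have "\<dots> = (\<Sum>k<n. \<Sum>i<n. d k * dotp n (q k) y * (q k i * x i))" by (rule sum.swap)
  also have "\<dots> = (\<Sum>k<n. d k * dotp n (q k) y * dotp n (q k) x)"
    by (simp add: dotp_def sum_distrib_left)
  finally show ?thesis by (simp add: mult_ac)
qed

lemma eigenbasis_combination:
  assumes qd: "orthonormal_eigenbasis n M q d" and k: "k < n" and J: "J \<subseteq> {..<n}"
  shows "dotp n (q k) (\<lambda>i. \<Sum>l\<in>J. c l * q l i) = (if k \<in> J then c k else 0)"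
proof -
  have "dotp n (q k) (\<lambda>i. \<Sum>l\<in>J. c l * q l i) = (\<Sum>i<n. \<Sum>l\<in>J. c l * (q k i * q l i))"
    by (simp add: dotp_def sum_distrib_left mult_ac)
  also have "\<dots> = (\<Sum>l\<in>J. \<Sum>i<n. c l * (q k i * q l i))" by (rule sum.swap)
  also have "\<dots> = (\<Sum>l\<in>J. c l * dotp n (q k) (q l))" by (simp add: dotp_def sum_distrib_left)
  also have "\<dots> = (\<Sum>l\<in>J. if k = l then c k else 0)"
    using qd k J by (intro sum.cong) (auto simp: orthonormal_eigenbasis_def)
  also have "\<dots> = (if k \<in> J then c k else 0)" using finite_subset[OF J] by simp
  finally show ?thesis .
qed

text \<open>The vanishing conditions are \<open>card Z\<close> linear equations for the coefficients
  of a kernel vector in the eigenvectors for 0. A large corank is exploited only in this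
  form.\<close>

lemma kernel_vector_vanishing_on:
  assumes M: "M \<in> carrier_mat n n" "M\<^sup>T = M" and Z: "finite Z" "card Z < kernel_dim M"
  shows "\<exists>x. (\<exists>i<n. x i \<noteq> 0) \<and> (\<forall>i<n. app n (entries M) x i = 0) \<and> (\<forall>z\<in>Z. x z = 0)"
proof -
  obtain q d where qd: "orthonormal_eigenbasis n (entries M) q d" using eigenbasis_exists[OF M] by blast
  define J where "J = {k. k < n \<and> d k = 0}"
  have J: "J \<subseteq> {..<n}" "finite J" "card Z < card J"
    using Z eigenbasis_kernel_dim[OF M(1) qd] by (auto simp: J_def)
  obtain c where c: "\<exists>k\<in>J. c k \<noteq> 0" "\<forall>z\<in>Z. (\<Sum>k\<in>J. q k z * c k) = 0"
    using homogeneous_system[OF Z(1) J(2,3), of "\<lambda>z k. q k z"] by blast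
  define x where "x = (\<lambda>i. \<Sum>l\<in>J. c l * q l i)"
  have co: "dotp n (q k) x = (if k \<in> J then c k else 0)" if "k < n" for k
    unfolding x_def by (rule eigenbasis_combination[OF qd that J(1)])
  have "\<exists>i<n. x i \<noteq> 0"
  proof (rule ccontr)
    assume "\<not> (\<exists>i<n. x i \<noteq> 0)"
    then have "dotp n (q k) x = 0" for k by (simp add: dotp_def)
    then show False using c(1) co J(1) by (metis lessThan_iff subsetD)
  qed
  moreover have "app n (entries M) x i = 0" if "i < n" for i
    unfolding eigenbasis_app[OF M(1) qd that] by (intro sum.neutral) (auto simp: co J_def)
  moreover have "x z = 0" if "z \<in> Z" for z using c(2) that by (simp add: x_def mult.commute)
  ultimately show ?thesis by blast
qed

text \<open>Were the dimension at most \<open>k\<close>, the eigenvectors for 0 could be taken as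
  the functionals \<open>c\<close>, and a kernel vector orthogonal to all of them is 0. With
  arbitrary functionals no basis of the kernel has to be exhibited.\<close>

lemma kernel_dim_greater:
  assumes M: "M \<in> carrier_mat n n" "M\<^sup>T = M"
    and ker: "\<And>Z (c :: nat \<Rightarrow> nat \<Rightarrow> real). finite Z \<Longrightarrow> card Z \<le> k \<Longrightarrow>
      \<exists>x. (\<exists>i<n. x i \<noteq> 0) \<and> (\<forall>i<n. app n (entries M) x i = 0) \<and> (\<forall>z\<in>Z. dotp n (c z) x = 0)"
  shows "kernel_dim M > k"
proof (rule ccontr)
  assume "\<not> kernel_dim M > k"
  obtain q d where qd: "orthonormal_eigenbasis n (entries M) q d" using eigenbasis_exists[OF M] by blast
  define J where "J = {k. k < n \<and> d k = 0}"
  have "finite J" "card J \<le> k"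
    using eigenbasis_kernel_dim[OF M(1) qd] \<open>\<not> _\<close> by (auto simp: J_def)
  from ker[OF this, of q] obtain x where x: "\<exists>i<n. x i \<noteq> 0" "\<And>i. i < n \<Longrightarrow> app n (entries M) x i = 0"
    "\<And>z. z \<in> J \<Longrightarrow> dotp n (q z) x = 0" by blast
  have "dotp n (q k) x = 0" if k: "k < n" for k
  proof (cases "k \<in> J")
    case False
    have "dotp n (q k) (app n (entries M) x) = d k * dotp n (q k) x"
    proof -
      have "dotp n (q k) (app n (entries M) x) = dotp n (app n (entries M) (q k)) x"
        using dotp_app_commute[OF symf_entries[OF M]] by simp
      also have "\<dots> = dotp n (\<lambda>i. d k * q k i) x"
        using qd k by (intro dotp_cong) (auto simp: orthonormal_eigenbasis_def)
      finally show ?thesis by (simp add: dotp_scale_left)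
    qed
    moreover have "dotp n (q k) (app n (entries M) x) = 0" using x(2) by (simp add: dotp_def)
    ultimately show ?thesis using False k by (simp add: J_def)
  qed (use x in simp)
  then have "x i = 0" if "i < n" for i using eigenbasis_expansion[OF M(1) qd that, of x] by simp
  then show False using x(1) by blast
qed

section \<open>Forms with exactly one negative eigenvalue\<close>

lemma bilin_add_left: "bilin n M (\<lambda>i. x i + y i) z = bilin n M x z + bilin n M y z"
  by (simp add: bilin_def dotp_add_left)

lemma bilin_add_right: "bilin n M z (\<lambda>i. x i + y i) = bilin n M z x + bilin n M z y"
  by (simp add: bilin_def app_add dotp_add_right)

lemma bilin_scale_left: "bilin n M (\<lambda>i. c * x i) z = c * bilin n M x z"
  by (simp add: bilin_def dotp_scale_left)

lemma bilin_scale_right: "bilin n M z (\<lambda>i. c * x i) = c * bilin n M z x"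
  by (simp add: bilin_def app_scale dotp_scale_right)

lemma bilin_commute: "symf n M \<Longrightarrow> bilin n M x y = bilin n M y x"
  unfolding bilin_def by (metis dotp_app_commute dotp_commute)

definition one_negative_eigenvalue :: "real mat \<Rightarrow> bool"
  where "one_negative_eigenvalue M \<longleftrightarrow> (\<exists>!l. l < 0 \<and> eigenvalue M l) \<and>
    (\<forall>l. l < 0 \<and> eigenvalue M l \<longrightarrow> Polynomial.order l (char_poly M) = 1)"

lemma one_negative_eigenvalue_iff:
  assumes M: "M \<in> carrier_mat n n" and qd: "orthonormal_eigenbasis n (entries M) q d"
  shows "one_negative_eigenvalue M \<longleftrightarrow> (\<exists>!k. k < n \<and> d k < 0)"
proof
  assume L: "one_negative_eigenvalue M"
  then obtain l where l: "l < 0" "eigenvalue M l" and uniq: "\<And>l'. l' < 0 \<Longrightarrow> eigenvalue M l' \<Longrightarrow> l' = l"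
    unfolding one_negative_eigenvalue_def by blast
  have "Polynomial.order l (char_poly M) = 1" using L l unfolding one_negative_eigenvalue_def by blast
  then have "card {k. k < n \<and> d k = l} = 1" unfolding eigenbasis_order[OF assms] .
  then obtain k where k: "{k. k < n \<and> d k = l} = {k}" by (rule card_1_singletonE)
  show "\<exists>!k. k < n \<and> d k < 0"
  proof (rule ex1I)
    have "k \<in> {k. k < n \<and> d k = l}" unfolding k by simp
    then show "k < n \<and> d k < 0" using l(1) by simp
    fix j assume j: "j < n \<and> d j < 0"
    then have "eigenvalue M (d j)" unfolding eigenbasis_eigenvalue[OF assms] by blast
    then have "d j = l" using uniq[of "d j"] j by simp
    then have "j \<in> {k. k < n \<and> d k = l}" using j by simp
    then show "j = k" unfolding k by simp
  qed
next
  assume "\<exists>!k. k < n \<and> d k < 0"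
  then obtain k where k: "k < n" "d k < 0" and uniq: "\<And>j. j < n \<Longrightarrow> d j < 0 \<Longrightarrow> j = k" by blast
  have "{j. j < n \<and> d j = d k} = {k}"
  proof (intro equalityI subsetI)
    fix j assume "j \<in> {j. j < n \<and> d j = d k}"
    then have "j < n" "d j < 0" using k(2) by auto
    from uniq[OF this] show "j \<in> {k}" by simp
  qed (use k in simp)
  then have order: "Polynomial.order (d k) (char_poly M) = 1" unfolding eigenbasis_order[OF assms] by simp
  have only: "l = d k" if "l < 0 \<and> eigenvalue M l" for l
  proof -
    from that obtain j where "j < n" "d j = l" unfolding eigenbasis_eigenvalue[OF assms] by blast
    then show ?thesis using uniq[of j] that by simp
  qed
  have ev: "d k < 0 \<and> eigenvalue M (d k)" unfolding eigenbasis_eigenvalue[OF assms] using k by (intro conjI exI[of _ k]) simp_all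
  show "one_negative_eigenvalue M"
    unfolding one_negative_eigenvalue_def
  proof (intro conjI allI impI)
    show "\<exists>!l. l < 0 \<and> eigenvalue M l" by (rule ex1I[of _ "d k"]) (rule ev, rule only)
    show "Polynomial.order l (char_poly M) = 1" if "l < 0 \<and> eigenvalue M l" for l
      using only[OF that] order by simp
  qed
qed

text \<open>Two negative eigenvectors would span a plane on which the form is negative definite, but
  every plane meets the hyperplane orthogonal to \<open>u\<close> in a nonzero vector.\<close>

lemma one_negative_eigenvalueI:
  assumes M: "M \<in> carrier_mat n n" "M\<^sup>T = M"
    and v: "bilin n (entries M) v v < 0"
    and u: "\<And>x. dotp n u x = 0 \<Longrightarrow> bilin n (entries M) x x \<ge> 0"
  shows "one_negative_eigenvalue M"
proof -
  obtain q d where qd: "orthonormal_eigenbasis n (entries M) q d" using eigenbasis_exists[OF M] by blast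
  note bil = eigenbasis_bilin[OF M(1) qd]
  have "\<exists>k<n. d k < 0"
  proof (rule ccontr)
    assume "\<not> (\<exists>k<n. d k < 0)"
    then have nonneg: "d k \<ge> 0" if "k < n" for k using that not_less by blast
    have "d k * (dotp n (q k) v * dotp n (q k) v) \<ge> 0" if "k < n" for k
      by (rule mult_nonneg_nonneg[OF _ zero_le_square]) (use that nonneg in simp)
    then have "bilin n (entries M) v v \<ge> 0" unfolding bil by (intro sum_nonneg) (auto simp: mult_ac)
    then show False using v by simp
  qed
  moreover have "k = l" if kl: "k < n" "d k < 0" "l < n" "d l < 0" for k l
  proof (rule ccontr)
    assume "k \<noteq> l"
    have J: "{k, l} \<subseteq> {..<n}" using kl by auto
    obtain c where c: "\<exists>j\<in>{k, l}. c j \<noteq> 0" "(\<Sum>j\<in>{k, l}. dotp n u (q j) * c j) = 0"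
      using homogeneous_system[of "{()}" "{k, l}" "\<lambda>_ j. dotp n u (q j)"] \<open>k \<noteq> l\<close> by auto
    define x where "x = (\<lambda>i. \<Sum>j\<in>{k, l}. c j * q j i)"
    have "dotp n u x = (\<Sum>j\<in>{k, l}. dotp n u (q j) * c j)"
      using \<open>k \<noteq> l\<close> unfolding x_def by (simp add: dotp_add_right dotp_scale_right)
    then have "bilin n (entries M) x x \<ge> 0" using u c(2) by simp
    moreover have co: "dotp n (q j) x = (if j \<in> {k, l} then c j else 0)" if "j < n" for j
      unfolding x_def by (rule eigenbasis_combination[OF qd that J])
    have "bilin n (entries M) x x = (\<Sum>j<n. if j \<in> {k, l} then d j * (c j)^2 else 0)"
      unfolding bil by (intro sum.cong) (auto simp: co power2_eq_square)
    also have "\<dots> = (\<Sum>j\<in>{k, l}. d j * (c j)^2)"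
      by (rule sum.mono_neutral_cong_right) (use J in auto)
    also have "\<dots> = d k * (c k)^2 + d l * (c l)^2" using \<open>k \<noteq> l\<close> by simp
    also have "\<dots> < 0"
    proof (cases "c k = 0")
      case True
      then show ?thesis using c(1) kl by (auto simp: mult_less_0_iff)
    next
      case False
      then have "d k * (c k)^2 < 0" "d l * (c l)^2 \<le> 0" using kl by (auto simp: mult_less_0_iff mult_le_0_iff)
      then show ?thesis by linarith
    qed
    ultimately show False by linarith
  qed
  ultimately show ?thesis unfolding one_negative_eigenvalue_iff[OF M(1) qd] by metis
qed

text \<open>Some combination a x - b y with a nonzero is orthogonal to the negative eigenvector, so
  its value a^2 (x, x) + b^2 (y, y) is nonnegative although (y, y) is negative.\<close>

lemma one_negative_orthogonal_nonneg:
  assumes M: "M \<in> carrier_mat n n" "M\<^sup>T = M" and one: "one_negative_eigenvalue M"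
    and y: "bilin n (entries M) y y < 0" and xy: "bilin n (entries M) x y = 0"
  shows "bilin n (entries M) x x \<ge> 0"
proof -
  obtain q d where qd: "orthonormal_eigenbasis n (entries M) q d" using eigenbasis_exists[OF M] by blast
  note bil = eigenbasis_bilin[OF M(1) qd]
  obtain k where k: "k < n" "d k < 0" and uniq: "\<And>j. j < n \<Longrightarrow> d j < 0 \<Longrightarrow> j = k"
    using one unfolding one_negative_eigenvalue_iff[OF M(1) qd] by blast
  have pos: "bilin n (entries M) z z \<ge> 0" if "dotp n (q k) z = 0" for z
    unfolding bil
  proof (rule sum_nonneg)
    fix j assume "j \<in> {..<n}"
    show "d j * dotp n (q j) z * dotp n (q j) z \<ge> 0"
    proof (cases "d j < 0")
      case True
      then have "j = k" using uniq \<open>j \<in> {..<n}\<close> by blast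
      then show ?thesis using that by simp
    qed (simp add: mult.assoc)
  qed
  define a where "a = dotp n (q k) y"
  define b where "b = dotp n (q k) x"
  have a: "a \<noteq> 0" using pos[of y] y by (auto simp: a_def)
  define z where "z = (\<lambda>i. a * x i + (- b) * y i)"
  have "dotp n (q k) z = 0"
    unfolding z_def dotp_add_right dotp_scale_right by (simp add: a_def b_def)
  then have "bilin n (entries M) z z \<ge> 0" by (rule pos)
  moreover have "bilin n (entries M) y x = 0" using xy bilin_commute[OF symf_entries[OF M]] by simp
  ultimately have "a^2 * bilin n (entries M) x x + b^2 * bilin n (entries M) y y \<ge> 0"
    using xy unfolding z_def bilin_add_left bilin_add_right bilin_scale_left bilin_scale_right
    by (simp add: power2_eq_square algebra_simps)
  moreover have "b^2 * bilin n (entries M) y y \<le> 0" using y by (simp add: mult_le_0_iff)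
  ultimately have "a^2 * bilin n (entries M) x x \<ge> 0" by linarith
  then show ?thesis using a by (simp add: zero_le_mult_iff)
qed

text \<open>The form is positive semidefinite on the orthogonal complement of a negative vector,
  so isotropic vectors there lie in its radical.\<close>

lemma one_negative_isotropic_kernel:
  assumes M: "M \<in> carrier_mat n n" "M\<^sup>T = M" and one: "one_negative_eigenvalue M"
    and y: "bilin n (entries M) y y < 0" and xy: "bilin n (entries M) x y = 0"
    and x: "bilin n (entries M) x x = 0" and i: "i < n"
  shows "app n (entries M) x i = 0"
proof -
  note sym = bilin_commute[OF symf_entries[OF M]]
  define B where "B = bilin n (entries M)"
  have rad: "B z x = 0" if "B z y = 0" for z
  proof (rule quadratic_nonneg_linear_coeff_0)
    fix t
    have "B (\<lambda>i. x i + t * z i) y = 0"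
      using xy that unfolding B_def bilin_add_left bilin_scale_left by simp
    then have "B (\<lambda>i. x i + t * z i) (\<lambda>i. x i + t * z i) \<ge> 0"
      unfolding B_def by (rule one_negative_orthogonal_nonneg[OF M one y])
    then show "2 * t * B z x + t^2 * B z z \<ge> 0"
      using x sym[of x z] unfolding B_def bilin_add_left bilin_add_right bilin_scale_left bilin_scale_right
      by (simp add: power2_eq_square algebra_simps)
  qed
  define w where "w = app n (entries M) x"
  define z where "z = (\<lambda>i. w i + (- (B w y / B y y)) * y i)"
  have "B z y = 0" using y unfolding z_def B_def bilin_add_left bilin_scale_left by simp
  from rad[OF this] have "B w x + (- (B w y / B y y)) * B y x = 0"
    unfolding z_def B_def bilin_add_left bilin_scale_left .
  moreover have "B y x = 0" using xy sym[of x y] by (simp add: B_def)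
  ultimately have "dotp n w w = 0" by (simp add: B_def bilin_def w_def)
  then show ?thesis using i by (simp add: dotp_self_eq_0 w_def)
qed

section \<open>Connected sets, minors and dense graphs\<close>

text \<open>Connectivity through cuts: proofs take for \<open>X\<close> the part reached so far and
  use the arc that leaves it, so no paths have to be handled.\<close>

definition conn :: "('a \<times> 'a) set \<Rightarrow> 'a set \<Rightarrow> bool"
  where "conn E S \<longleftrightarrow> S \<noteq> {} \<and> (\<forall>X. X \<subset> S \<longrightarrow> X \<noteq> {} \<longrightarrow> (\<exists>x\<in>X. \<exists>y\<in>S - X. (x, y) \<in> E))"

definition branch_sets :: "'a set \<Rightarrow> ('a \<times> 'a) set \<Rightarrow> 'i set \<Rightarrow> ('i \<times> 'i) set \<Rightarrow> ('i \<Rightarrow> 'a set) \<Rightarrow> bool"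
  where "branch_sets V E I F B \<longleftrightarrow>
    (\<forall>i\<in>I. B i \<subseteq> V \<and> conn E (B i)) \<and>
    (\<forall>i\<in>I. \<forall>j\<in>I. i \<noteq> j \<longrightarrow> B i \<inter> B j = {}) \<and>
    (\<forall>i\<in>I. \<forall>j\<in>I. i \<noteq> j \<longrightarrow> (i, j) \<in> F \<longrightarrow> (\<exists>x\<in>B i. \<exists>y\<in>B j. (x, y) \<in> E))"

definition has_minor :: "'a set \<Rightarrow> ('a \<times> 'a) set \<Rightarrow> 'i set \<Rightarrow> ('i \<times> 'i) set \<Rightarrow> bool"
  where "has_minor V E I F \<longleftrightarrow> (\<exists>B. branch_sets V E I F B)"

definition nbrs :: "'a set \<Rightarrow> ('a \<times> 'a) set \<Rightarrow> 'a \<Rightarrow> 'a set"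
  where "nbrs V E v = {w \<in> V. (v, w) \<in> E}"

lemma conn_nonempty: "conn E S \<Longrightarrow> S \<noteq> {}"
  by (simp add: conn_def)

lemma connE:
  assumes "conn E S" "X \<subseteq> S" "X \<noteq> {}" "X \<noteq> S"
  obtains x y where "x \<in> X" "y \<in> S" "y \<notin> X" "(x, y) \<in> E"
  using assms unfolding conn_def by (metis DiffE psubsetI)

lemma conn_singleton: "conn E {x}"
  unfolding conn_def by auto

lemma conn_mono: "conn E S \<Longrightarrow> E \<subseteq> F \<Longrightarrow> conn F S"
  unfolding conn_def by blast

lemma conn_insert:
  assumes S: "conn E S" and E: "sym E" "y \<in> S" "(x, y) \<in> E"
  shows "conn E (insert x S)"
  unfolding conn_def
proof (intro conjI allI impI)
  fix X assume X: "X \<subset> insert x S" "X \<noteq> {}"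
  have yx: "(y, x) \<in> E" using E by (auto dest: symD)
  consider "X \<inter> S = {}" | "S \<subseteq> X" | "X \<inter> S \<noteq> {}" "\<not> S \<subseteq> X" by blast
  then show "\<exists>x'\<in>X. \<exists>y'\<in>insert x S - X. (x', y') \<in> E"
  proof cases
    case 1
    then have "x \<in> X" "y \<notin> X" using X E by auto
    then show ?thesis using E by blast
  next
    case 2
    then have "x \<notin> X" "y \<in> X" using X E by auto
    then show ?thesis using yx by blast
  next
    case 3
    then obtain a b where "a \<in> X \<inter> S" "b \<in> S" "b \<notin> X \<inter> S" "(a, b) \<in> E"
      using connE[OF S, of "X \<inter> S"] by (metis Int_lower2 inf.absorb_iff2 inf_commute)
    then show ?thesis by blast
  qed
qed auto

text \<open>A cut of the union either splits some \<open>B i\<close>, or is a union of sets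
  \<open>B i\<close> and so induces a cut of \<open>C\<close>.\<close>

lemma conn_UN:
  assumes C: "conn F C" and B: "\<And>i. i \<in> C \<Longrightarrow> conn E (B i)"
    and adj: "\<And>i j. i \<in> C \<Longrightarrow> j \<in> C \<Longrightarrow> i \<noteq> j \<Longrightarrow> (i, j) \<in> F \<Longrightarrow> \<exists>x\<in>B i. \<exists>y\<in>B j. (x, y) \<in> E"
  shows "conn E (\<Union>i\<in>C. B i)"
  unfolding conn_def
proof (intro conjI allI impI)
  show "(\<Union>i\<in>C. B i) \<noteq> {}" using conn_nonempty[OF C] B conn_nonempty by fastforce
  fix X assume X: "X \<subset> (\<Union>i\<in>C. B i)" "X \<noteq> {}"
  show "\<exists>x\<in>X. \<exists>y\<in>(\<Union>i\<in>C. B i) - X. (x, y) \<in> E"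
  proof (cases "\<exists>i\<in>C. B i \<inter> X \<noteq> {} \<and> \<not> B i \<subseteq> X")
    case True
    then obtain i where i: "i \<in> C" "B i \<inter> X \<noteq> {}" "\<not> B i \<subseteq> X" by blast
    obtain x y where "x \<in> B i \<inter> X" "y \<in> B i" "y \<notin> B i \<inter> X" "(x, y) \<in> E"
      by (rule connE[OF B[OF i(1)], of "B i \<inter> X"]) (use i in auto)
    then show ?thesis using i by blast
  next
    case False
    define Y where "Y = {i \<in> C. B i \<subseteq> X}"
    have split: "B i \<subseteq> X \<or> B i \<inter> X = {}" if "i \<in> C" for i using False that by blast
    have "Y \<noteq> {}"
    proof -
      from X obtain x i where "x \<in> X" "i \<in> C" "x \<in> B i" by blast
      then have "i \<in> Y" using split[of i] unfolding Y_def by blast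
      then show ?thesis by blast
    qed
    moreover have "Y \<noteq> C"
    proof
      assume "Y = C"
      then have "(\<Union>i\<in>C. B i) \<subseteq> X" unfolding Y_def by blast
      then show False using X by blast
    qed
    ultimately obtain i j where ij: "i \<in> Y" "j \<in> C" "j \<notin> Y" "(i, j) \<in> F"
      using connE[OF C, of Y] unfolding Y_def by blast
    then have "i \<in> C" "i \<noteq> j" unfolding Y_def by auto
    then obtain x y where xy: "x \<in> B i" "y \<in> B j" "(x, y) \<in> E" using adj ij by blast
    have "x \<in> X" using ij(1) xy(1) unfolding Y_def by blast
    moreover have "y \<notin> X" using split[OF ij(2)] ij(2,3) xy(2) unfolding Y_def by blast
    ultimately show ?thesis using xy ij(2) by blast
  qed
qed

lemma has_minor_trans:
  assumes "has_minor V E I F" "has_minor I F J H"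
  shows "has_minor V E J H"
proof -
  obtain B C where B: "branch_sets V E I F B" and C: "branch_sets I F J H C"
    using assms unfolding has_minor_def by blast
  have CI: "C j \<subseteq> I" "conn F (C j)" if "j \<in> J" for j using C that unfolding branch_sets_def by auto
  have BV: "B i \<subseteq> V" "conn E (B i)" if "i \<in> I" for i using B that unfolding branch_sets_def by auto
  have Bdisj: "B i \<inter> B i' = {}" if "i \<in> I" "i' \<in> I" "i \<noteq> i'" for i i'
    using B that unfolding branch_sets_def by auto
  have Badj: "\<exists>x\<in>B i. \<exists>y\<in>B i'. (x, y) \<in> E" if "i \<in> I" "i' \<in> I" "i \<noteq> i'" "(i, i') \<in> F" for i i'
    using B that unfolding branch_sets_def by blast
  have "branch_sets V E J H (\<lambda>j. \<Union>i\<in>C j. B i)"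
    unfolding branch_sets_def
  proof (intro conjI ballI impI)
    fix j assume j: "j \<in> J"
    show "(\<Union>i\<in>C j. B i) \<subseteq> V" using CI[OF j] BV by blast
    show "conn E (\<Union>i\<in>C j. B i)"
      by (rule conn_UN[OF CI(2)[OF j]]) (use CI(1)[OF j] BV Badj in blast)+
  next
    fix j l assume jl: "j \<in> J" "l \<in> J" "j \<noteq> l"
    have disj: "C j \<inter> C l = {}" using C jl unfolding branch_sets_def by auto
    have "B i \<inter> B i' = {}" if "i \<in> C j" "i' \<in> C l" for i i'
      using Bdisj[of i i'] that disj CI[OF jl(1)] CI[OF jl(2)] by blast
    then show "(\<Union>i\<in>C j. B i) \<inter> (\<Union>i\<in>C l. B i) = {}" by blast
    assume "(j, l) \<in> H"
    then obtain i i' where i: "i \<in> C j" "i' \<in> C l" "(i, i') \<in> F"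
      using C jl unfolding branch_sets_def by blast
    then have "i \<noteq> i'" "i \<in> I" "i' \<in> I" using disj CI[OF jl(1)] CI[OF jl(2)] by auto
    from Badj[OF this(2,3,1) i(3)] show "\<exists>x\<in>\<Union>i\<in>C j. B i. \<exists>y\<in>\<Union>i\<in>C l. B i. (x, y) \<in> E"
      using i by blast
  qed
  then show ?thesis unfolding has_minor_def by blast
qed

lemma has_minor_mono:
  assumes "has_minor V E I F" "V \<subseteq> V'" "E \<subseteq> E'" "I' \<subseteq> I" "F' \<subseteq> F"
  shows "has_minor V' E' I' F'"
proof -
  obtain B where B: "branch_sets V E I F B" using assms(1) unfolding has_minor_def by blast
  have "branch_sets V' E' I' F' B"
    unfolding branch_sets_def
  proof (intro conjI ballI impI)
    fix i assume "i \<in> I'"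
    then have "B i \<subseteq> V" "conn E (B i)" using B assms(4) unfolding branch_sets_def by auto
    then show "B i \<subseteq> V'" "conn E' (B i)" using assms(2,3) conn_mono by auto
  next
    fix i j assume ij: "i \<in> I'" "j \<in> I'" "i \<noteq> j"
    then have I: "i \<in> I" "j \<in> I" using assms(4) by auto
    then show "B i \<inter> B j = {}" using B ij(3) unfolding branch_sets_def by blast
    assume "(i, j) \<in> F'"
    then have "(i, j) \<in> F" using assms(5) by blast
    then have "\<exists>x\<in>B i. \<exists>y\<in>B j. (x, y) \<in> E" using B I ij(3) unfolding branch_sets_def by blast
    then show "\<exists>x\<in>B i. \<exists>y\<in>B j. (x, y) \<in> E'" using assms(3) by blast
  qed
  then show ?thesis unfolding has_minor_def by blast
qed

lemma has_minor_self: "has_minor V E V E"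
  unfolding has_minor_def branch_sets_def
  by (rule exI[of _ "\<lambda>x. {x}"]) (auto simp: conn_singleton)

section \<open>Complete minors in graphs of large minimum degree\<close>

lemma nbrs_subset: "nbrs V E v \<subseteq> V"
  by (auto simp: nbrs_def)

lemma card_arcs_eq_sum_degrees:
  assumes "finite V" "E \<subseteq> V \<times> V"
  shows "card E = (\<Sum>v\<in>V. card (nbrs V E v))"
proof -
  have "Sigma V (nbrs V E) = E" using assms(2) by (auto simp: nbrs_def)
  moreover have "card (Sigma V (nbrs V E)) = (\<Sum>v\<in>V. card (nbrs V E v))"
    by (rule card_SigmaI) (use assms(1) in \<open>auto simp: nbrs_def\<close>)
  ultimately show ?thesis by simp
qed

text \<open>A smallest nonempty subset of \<open>R\<close> that is closed under adjacency: a cut of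
  it without outgoing arcs would be a smaller such set.\<close>

lemma connected_component_exists:
  assumes "finite R" "R \<noteq> {}"
  obtains C where "C \<subseteq> R" "conn E C" "\<And>x y. x \<in> C \<Longrightarrow> y \<in> R \<Longrightarrow> (x, y) \<in> E \<Longrightarrow> y \<in> C"
proof -
  define P where "P C \<longleftrightarrow> C \<subseteq> R \<and> C \<noteq> {} \<and> (\<forall>x\<in>C. \<forall>y\<in>R. (x, y) \<in> E \<longrightarrow> y \<in> C)" for C
  have "P R" using assms by (simp add: P_def)
  from ex_has_least_nat[where P = P and m = card, OF this] obtain C where
    C: "P C" "\<And>X. P X \<Longrightarrow> card C \<le> card X" by blast
  have "finite C" using C(1) assms finite_subset unfolding P_def by blast
  have "conn E C" unfolding conn_def
  proof (intro conjI allI impI, goal_cases)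
    case 1
    then show ?case using C by (simp add: P_def)
  next
    case (2 X)
    show ?case
    proof (rule ccontr)
      assume no: "\<not> ?case"
      have closed: "\<And>x y. x \<in> C \<Longrightarrow> y \<in> R \<Longrightarrow> (x, y) \<in> E \<Longrightarrow> y \<in> C" using C(1) by (simp add: P_def)
      have "y \<in> X" if xy: "x \<in> X" "y \<in> R" "(x, y) \<in> E" for x y
      proof -
        have "x \<in> C" using xy(1) 2(1) by auto
        then have "y \<in> C" using closed xy by simp
        then show ?thesis using no xy by auto
      qed
      moreover have "X \<subseteq> R" "X \<noteq> {}" using 2 C(1) unfolding P_def by auto
      ultimately have "P X" by (simp add: P_def)
      from C(2)[OF this] psubset_card_mono[OF \<open>finite C\<close> 2(1)] show False by simp
    qed
  qed
  then show ?thesis using that C(1) unfolding P_def by blast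
qed

text \<open>The contraction loses the edge itself and one edge per common neighbour, in total at
  most \<open>d\<close> edges. Every edge counts as two arcs in \<open>card E\<close>, hence the
  loss of 2d.\<close>

lemma contract_edge:
  assumes V: "finite V" and E: "E \<subseteq> V \<times> V" "sym E" "irrefl E"
    and xy: "(x, y) \<in> E" and common: "card (nbrs V E x \<inter> nbrs V E y) < d"
  obtains E' where "E' \<subseteq> (V - {y}) \<times> (V - {y})" "sym E'" "irrefl E'"
    "has_minor V E (V - {y}) E'" "card E \<le> card E' + 2 * d"
proof -
  define V' where "V' = V - {y}"
  define E' where "E' = {(a, b) \<in> V' \<times> V'. a \<noteq> b \<and>
     ((a, b) \<in> E \<or> (a = x \<and> (y, b) \<in> E) \<or> (b = x \<and> (a, y) \<in> E))}"
  have x: "x \<in> V'" "x \<noteq> y" "y \<in> V" using E xy by (auto simp: V'_def irrefl_def)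
  have symE: "(b, a) \<in> E" if "(a, b) \<in> E" for a b using E(2) that by (auto dest: symD)
  have E'V: "E' \<subseteq> V' \<times> V'" by (auto simp: E'_def)
  moreover have "sym E'" unfolding E'_def sym_def using symE by auto
  moreover have "irrefl E'" by (auto simp: E'_def irrefl_def)
  moreover have "has_minor V E V' E'"
  proof -
    define B where "B a = (if a = x then {x, y} else {a})" for a
    have "conn E {x, y}" using conn_insert[OF conn_singleton E(2), of y "y" x] xy by auto
    then have "branch_sets V E V' E' B"
      unfolding branch_sets_def
    proof (intro conjI ballI impI, goal_cases)
      case (1 i)
      then show ?case using x by (auto simp: B_def V'_def)
    next
      case (2 i)
      then show ?case by (auto simp: B_def conn_singleton)
    next
      case (3 i j)
      then show ?case by (auto simp: B_def V'_def)
    next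
      case (4 i j)
      then have "(i, j) \<in> E \<or> i = x \<and> (y, j) \<in> E \<or> j = x \<and> (i, y) \<in> E" by (auto simp: E'_def)
      then show ?case using 4 by (auto simp: B_def)
    qed
    then show ?thesis unfolding has_minor_def by blast
  qed
  moreover have "card E \<le> card E' + 2 * d"
  proof -
    define N where "N = nbrs V E y"
    \<comment> \<open>The neighbours of \<open>y\<close> that become new neighbours of
      \<open>x\<close>.\<close>
    define R where "R = N - nbrs V E x - {x}"
    define E0 where "E0 = E \<inter> V' \<times> V'"
    have finE: "finite E" using E V finite_subset by blast
    have finE': "finite E'" using E'V V finite_subset[of E' "V' \<times> V'"] by (simp add: V'_def)
    have finN: "finite N" using V by (simp add: N_def nbrs_def)
    have "y \<notin> N" using E(3) by (simp add: N_def nbrs_def irrefl_def)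
    have fin0: "finite E0" using finE by (simp add: E0_def)
    have "E \<subseteq> E0 \<union> ({y} \<times> N \<union> N \<times> {y})"
      using E symE unfolding E0_def V'_def N_def nbrs_def by auto
    then have "card E \<le> card (E0 \<union> ({y} \<times> N \<union> N \<times> {y}))" using fin0 finN by (intro card_mono) auto
    also have "\<dots> \<le> card E0 + card ({y} \<times> N \<union> N \<times> {y})" by (rule card_Un_le)
    also have "card ({y} \<times> N \<union> N \<times> {y}) \<le> card ({y} \<times> N) + card (N \<times> {y})" by (rule card_Un_le)
    finally have c1: "card E \<le> card E0 + 2 * card N" by (simp add: card_cartesian_product)
    have RV: "R \<subseteq> V'" "x \<notin> R" using \<open>y \<notin> N\<close> by (auto simp: R_def N_def nbrs_def V'_def)
    have "E0 \<union> ({x} \<times> R \<union> R \<times> {x}) \<subseteq> E'"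
    proof -
      have "({x} \<times> R \<union> R \<times> {x}) \<subseteq> E'"
        using RV x(1) symE by (auto simp: E'_def R_def N_def nbrs_def)
      moreover have "E0 \<subseteq> E'" using E(3) by (auto simp: E0_def E'_def irrefl_def)
      ultimately show ?thesis by blast
    qed
    then have "card (E0 \<union> ({x} \<times> R \<union> R \<times> {x})) \<le> card E'" using finE' by (rule card_mono[rotated])
    moreover have "card (E0 \<union> ({x} \<times> R \<union> R \<times> {x})) = card E0 + (card R + card R)"
    proof -
      have finR: "finite R" using finN by (simp add: R_def)
      have "({x} \<times> R) \<inter> (R \<times> {x}) = {}" using RV by auto
      then have "card ({x} \<times> R \<union> R \<times> {x}) = card R + card R"
        using finR by (simp add: card_Un_disjoint card_cartesian_product)
      moreover have "E0 \<inter> ({x} \<times> R \<union> R \<times> {x}) = {}"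
        using symE by (auto simp: E0_def R_def N_def nbrs_def)
      ultimately show ?thesis using fin0 finR by (simp add: card_Un_disjoint)
    qed
    moreover have "card N \<le> card R + d"
    proof -
      have "N \<subseteq> R \<union> insert x (nbrs V E x \<inter> nbrs V E y)" by (auto simp: R_def N_def)
      then have "card N \<le> card (R \<union> insert x (nbrs V E x \<inter> nbrs V E y))"
        using finN V by (intro card_mono) (auto simp: R_def nbrs_def)
      also have "\<dots> \<le> card R + card (insert x (nbrs V E x \<inter> nbrs V E y))" by (rule card_Un_le)
      also have "card (insert x (nbrs V E x \<inter> nbrs V E y)) \<le> Suc (card (nbrs V E x \<inter> nbrs V E y))"
        by (rule card_insert_le_m1) auto
      finally show ?thesis using common by linarith
    qed
    ultimately show ?thesis using c1 by linarith
  qed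
  ultimately show ?thesis using that unfolding V'_def by blast
qed

text \<open>Contract edges with few common neighbours as long as possible; the
  neighbourhood of a vertex of minimum degree is then dense.\<close>

lemma dense_minor:
  fixes V :: "'a set"
  assumes "finite V" "E \<subseteq> V \<times> V" "sym E" "irrefl E" "V \<noteq> {}" "d \<ge> 1" "2 * d * card V \<le> card E"
  shows "\<exists>(W :: 'a set) F. has_minor V E W F \<and> finite W \<and> W \<noteq> {} \<and> sym F \<and> irrefl F \<and>
    card W \<le> 2 * d \<and> (\<forall>w\<in>W. d \<le> card (nbrs W F w))"
  using assms
proof (induction "card V" arbitrary: V E rule: less_induct)
  case less
  note V = less.prems(1) and V0 = less.prems(5) and d = less.prems(6)
  \<comment> \<open>An arc count of 2d|V| means average degree 2d. Minimality of \<open>F\<close>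
    implies that it exceeds this count by less than one edge, that is, by less than two
    arcs.\<close>
  define P where "P F \<longleftrightarrow> F \<subseteq> E \<and> sym F \<and> 2 * d * card V \<le> card F" for F
  have "P E" using less.prems by (simp add: P_def)
  from ex_has_least_nat[where P = P and m = card, OF this] obtain F where
    F: "P F" "\<And>F'. P F' \<Longrightarrow> card F \<le> card F'" by blast
  have E: "F \<subseteq> V \<times> V" "sym F" "irrefl F" and big: "2 * d * card V \<le> card F"
    using F(1) less.prems by (auto simp: P_def irrefl_def)
  have EF: "has_minor V E V F" by (rule has_minor_mono[OF has_minor_self]) (use F(1) in \<open>auto simp: P_def\<close>)
  have finE: "finite F" using E V finite_subset by blast
  have symE: "(b, a) \<in> F" if "(a, b) \<in> F" for a b using E(2) that by (auto dest: symD)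
  have "card V > 0" using V V0 by (simp add: card_gt_0_iff)
  then have "2 * d * card V \<ge> 1" using d by simp
  then have "F \<noteq> {}" using big by auto
  then obtain x0 y0 where xy0: "(x0, y0) \<in> F" by auto
  have "x0 \<noteq> y0" using xy0 E(3) by (auto simp: irrefl_def)
  then have card2: "card V \<ge> 2" using xy0 E(1) V card_mono[of V "{x0, y0}"] by auto
  have step: ?case if "has_minor V F V' E'" "card V' < card V" "finite V'"
    "E' \<subseteq> V' \<times> V'" "sym E'" "irrefl E'" "V' \<noteq> {}" "2 * d * card V' \<le> card E'" for V' :: "'a set" and E'
    using less.hyps[OF that(2-7) d that(8)] has_minor_trans[OF has_minor_trans[OF EF that(1)]] by blast
  have small: "card F < 2 * d * card V + 2"
  proof (rule ccontr)
    assume "\<not> ?thesis"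
    moreover define E' where "E' = F - {(x0, y0), (y0, x0)}"
    moreover have "card E' = card F - 2"
      using xy0 symE[OF xy0] finE \<open>x0 \<noteq> y0\<close> by (simp add: E'_def card_Diff_subset)
    ultimately have "P E'" "card E' < card F"
      using F(1) E(2) by (auto simp: P_def sym_def)
    then show False using F(2) by fastforce
  qed
  show ?case
  proof (cases "\<exists>(x, y)\<in>F. card (nbrs V F x \<inter> nbrs V F y) < d")
    case True
    then obtain x y where xy: "(x, y) \<in> F" "card (nbrs V F x \<inter> nbrs V F y) < d" by blast
    obtain E' where E': "E' \<subseteq> (V - {y}) \<times> (V - {y})" "sym E'" "irrefl E'"
      "has_minor V F (V - {y}) E'" "card F \<le> card E' + 2 * d"
      by (rule contract_edge[OF V E xy])
    have y: "y \<in> V" using xy E by auto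
    then have cV: "card V = Suc (card (V - {y}))" by (rule card.remove[OF V])
    have "x \<in> V - {y}" using xy E by (auto simp: irrefl_def)
    then have "V - {y} \<noteq> {}" by blast
    moreover have "2 * d * card (V - {y}) \<le> card E'" using big E'(5) unfolding cV by simp
    ultimately show ?thesis using E' V cV by (intro step[OF E'(4)]) auto
  next
    case dense: False
    obtain v where v: "v \<in> V" "\<And>w. w \<in> V \<Longrightarrow> card (nbrs V F v) \<le> card (nbrs V F w)"
      using ex_has_least_nat[of "\<lambda>v. v \<in> V" _ "\<lambda>v. card (nbrs V F v)"] V0 by blast
    \<comment> \<open>As there are at least two vertices, a minimum degree above 2d would give 2d|V|
      + 2 arcs.\<close>
    have "card (nbrs V F v) \<le> 2 * d"
    proof (rule ccontr)
      assume "\<not> card (nbrs V F v) \<le> 2 * d"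
      then have "2 * d + 1 \<le> card (nbrs V F w)" if "w \<in> V" for w using v(2)[OF that] by simp
      then have "(\<Sum>w\<in>V. 2 * d + 1) \<le> card F"
        unfolding card_arcs_eq_sum_degrees[OF V E(1)] by (intro sum_mono) auto
      then have "card V * (2 * d + 1) \<le> card F" by simp
      then show False using small card2 by (simp add: algebra_simps)
    qed
    show ?thesis
    proof (cases "nbrs V F v = {}")
      case True
      define V' where "V' = V - {v}"
      have cV: "card V = Suc (card V')" unfolding V'_def by (rule card.remove[OF V v(1)])
      have "F \<subseteq> V' \<times> V'" using E(1) symE True by (auto simp: V'_def nbrs_def)
      moreover have "has_minor V F V' F" by (rule has_minor_mono[OF has_minor_self]) (auto simp: V'_def)
      moreover have "V' \<noteq> {}" using card2 cV by auto
      ultimately show ?thesis using V E big cV by (intro step[of V' F]) (auto simp: V'_def)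
    next
      case False
      define W where "W = nbrs V F v"
      have "has_minor V F W F"
        by (rule has_minor_mono[OF has_minor_self]) (auto simp: W_def nbrs_def)
      moreover have "d \<le> card (nbrs W F w)" if "w \<in> W" for w
      proof -
        have "(v, w) \<in> F" using that by (simp add: W_def nbrs_def)
        then have "d \<le> card (nbrs V F v \<inter> nbrs V F w)" using dense by auto
        also have "nbrs V F v \<inter> nbrs V F w = nbrs W F w" by (auto simp: W_def nbrs_def)
        finally show ?thesis .
      qed
      moreover have "finite W" using V by (simp add: W_def nbrs_def)
      ultimately show ?thesis using E(2,3) False \<open>card (nbrs V F v) \<le> 2 * d\<close>
        using has_minor_trans[OF EF] unfolding W_def by blast
    qed
  qed
qed

text \<open>Double counting: at least |U| d/2 adjacent pairs between \<open>C\<close> and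
  \<open>U\<close> are shared among at most 2d vertices of \<open>C\<close>.\<close>

lemma vertex_with_many_neighbours:
  assumes C: "finite C" "card C \<le> 2 * d" "\<And>x. x \<in> C \<Longrightarrow> d \<le> 2 * card (nbrs C E x)"
    and U: "U \<subseteq> C" "U \<noteq> {}" and E: "sym E"
  shows "\<exists>x\<in>C. card U \<le> 4 * card (U \<inter> nbrs C E x)"
proof (rule ccontr)
  assume "\<not> ?thesis"
  then have less: "4 * card (U \<inter> nbrs C E x) < card U" if "x \<in> C" for x using that by (auto simp: not_le)
  have finU: "finite U" using C U finite_subset by blast
  have "C \<noteq> {}" using U by auto
  have "(\<Sum>x\<in>C. card (U \<inter> nbrs C E x)) = (\<Sum>x\<in>C. \<Sum>u\<in>U. if (x, u) \<in> E then 1 else 0)"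
  proof (rule sum.cong[OF refl])
    fix x assume "x \<in> C"
    have "U \<inter> nbrs C E x = {u \<in> U. (x, u) \<in> E}" using U by (auto simp: nbrs_def)
    then show "card (U \<inter> nbrs C E x) = (\<Sum>u\<in>U. if (x, u) \<in> E then 1 else 0)"
      using finU by (simp add: sum.If_cases Int_def)
  qed
  also have "\<dots> = (\<Sum>u\<in>U. \<Sum>x\<in>C. if (x, u) \<in> E then 1 else 0)" by (rule sum.swap)
  also have "\<dots> = (\<Sum>u\<in>U. card (nbrs C E u))"
  proof (rule sum.cong[OF refl])
    fix u assume "u \<in> U"
    have "nbrs C E u = {x \<in> C. (x, u) \<in> E}" using E by (auto simp: nbrs_def dest: symD)
    then show "(\<Sum>x\<in>C. if (x, u) \<in> E then 1 else 0) = card (nbrs C E u)"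
      using C(1) by (simp add: sum.If_cases Int_def)
  qed
  finally have eq: "(\<Sum>x\<in>C. card (U \<inter> nbrs C E x)) = (\<Sum>u\<in>U. card (nbrs C E u))" .
  have "(\<Sum>x\<in>C. 4 * card (U \<inter> nbrs C E x)) < (\<Sum>x\<in>C. card U)"
    by (rule sum_strict_mono) (use C \<open>C \<noteq> {}\<close> less in auto)
  also have "\<dots> \<le> 2 * d * card U" using C(2) by simp
  also have "2 * d * card U = 2 * (\<Sum>u\<in>U. d)" by simp
  also have "\<dots> \<le> 2 * (\<Sum>u\<in>U. 2 * card (nbrs C E u))"
    by (intro mult_left_mono sum_mono) (use C(3) U in auto)
  also have "\<dots> = (\<Sum>x\<in>C. 4 * card (U \<inter> nbrs C E x))"
    by (simp add: sum_distrib_left[symmetric] eq)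
  finally show False by simp
qed

text \<open>Greedy choice: each new vertex covers at least a quarter of what is uncovered. After 3(L
  + 1) choices at most (27/64)^(L + 1) |C| vertices are left, and |C| is at most 2^L, so there are
  none.\<close>

lemma small_dominating_set:
  assumes C: "finite C" "C \<noteq> {}" "card C \<le> 2 * d" "\<And>x. x \<in> C \<Longrightarrow> d \<le> 2 * card (nbrs C E x)"
    and E: "sym E" and L: "2 * d \<le> 2 ^ L"
  obtains D where "D \<subseteq> C" "card D \<le> 3 * (L + 1)" "\<And>u. u \<in> C \<Longrightarrow> \<exists>x\<in>D. (x, u) \<in> E"
proof -
  define un where "un D = {u \<in> C. \<forall>x\<in>D. (x, u) \<notin> E}" for D
  have iter: "\<exists>D\<subseteq>C. card D \<le> g \<and> 4 ^ g * card (un D) \<le> 3 ^ g * card C" for g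
  proof (induction g)
    case 0
    show ?case by (intro exI[of _ "{}"]) (auto simp: un_def)
  next
    case (Suc g)
    then obtain D where D: "D \<subseteq> C" "card D \<le> g" "4 ^ g * card (un D) \<le> 3 ^ g * card C" by blast
    show ?case
    proof (cases "un D = {}")
      case True
      then show ?thesis using D by (intro exI[of _ D]) auto
    next
      case False
      obtain x where x: "x \<in> C" "card (un D) \<le> 4 * card (un D \<inter> nbrs C E x)"
        using vertex_with_many_neighbours[OF C(1,3,4) _ False E] by (auto simp: un_def)
      have "finite (un D)" using C(1) by (simp add: un_def)
      have "un (insert x D) = un D - nbrs C E x" by (auto simp: un_def nbrs_def)
      then have "card (un (insert x D)) = card (un D) - card (un D \<inter> nbrs C E x)"
        using \<open>finite (un D)\<close> by (metis card_Diff_subset_Int finite_Int)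
      then have "4 * card (un (insert x D)) \<le> 3 * card (un D)" using x(2) by simp
      then have "4 ^ g * (4 * card (un (insert x D))) \<le> 4 ^ g * (3 * card (un D))" by (intro mult_left_mono) auto
      also have "\<dots> = 3 * (4 ^ g * card (un D))" by simp
      also have "\<dots> \<le> 3 * (3 ^ g * card C)" using D(3) by (intro mult_left_mono) auto
      finally have "4 ^ Suc g * card (un (insert x D)) \<le> 3 ^ Suc g * card C" by simp
      moreover have "card (insert x D) \<le> Suc g"
        using D(2) card_insert_le_m1[of "Suc g" D x] by simp
      ultimately show ?thesis using D(1) x(1) by (intro exI[of _ "insert x D"]) auto
    qed
  qed
  obtain D where D: "D \<subseteq> C" "card D \<le> 3 * (L + 1)" "4 ^ (3 * (L + 1)) * card (un D) \<le> 3 ^ (3 * (L + 1)) * card C"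
    using iter[of "3 * (L + 1)"] by blast
  have "un D = {}"
  proof (rule ccontr)
    assume "un D \<noteq> {}"
    moreover have "finite (un D)" using C(1) by (simp add: un_def)
    ultimately have "card (un D) \<ge> 1" by (simp add: Suc_le_eq card_gt_0_iff)
    have "(64 :: nat) ^ (L + 1) * 1 \<le> 64 ^ (L + 1) * card (un D)"
      using \<open>card (un D) \<ge> 1\<close> by (intro mult_left_mono) auto
    also have "\<dots> \<le> 27 ^ (L + 1) * card C" using D(3) unfolding power_mult by simp
    also have "\<dots> \<le> 27 ^ (L + 1) * 2 ^ L" using C(3) L by (intro mult_left_mono) auto
    also have "\<dots> < 27 ^ (L + 1) * 2 ^ (L + 1)" by simp
    also have "\<dots> = 54 ^ (L + 1)" by (simp only: power_mult_distrib[symmetric]) simp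
    also have "\<dots> \<le> 64 ^ (L + 1)" by (rule power_mono) auto
    finally show False by simp
  qed
  then show ?thesis using that D(1,2) unfolding un_def by blast
qed

text \<open>Take a connected \<open>S\<close> that spends at most three vertices per vertex of
  \<open>D\<close> in it and contains as much of \<open>D\<close> as possible. If part of
  \<open>D\<close> is missing, then domination puts some missing \<open>y\<close> within distance 3
  of \<open>S\<close>, so \<open>y\<close> is added together with at most two further
  vertices.\<close>

lemma connected_dominating_set:
  assumes C: "finite C" "conn E C" and E: "sym E"
    and D: "D \<subseteq> C" "\<And>u. u \<in> C \<Longrightarrow> \<exists>x\<in>D. (x, u) \<in> E"
  obtains S where "D \<subseteq> S" "S \<subseteq> C" "conn E S" "card S \<le> 3 * card D"
proof -
  have finD: "finite D" using C D finite_subset by blast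
  define P where "P S \<longleftrightarrow> S \<subseteq> C \<and> conn E S \<and> S \<inter> D \<noteq> {} \<and> card S \<le> 3 * card (S \<inter> D)" for S
  obtain x0 where "x0 \<in> D" using D(2) conn_nonempty[OF C(2)] by blast
  then have "P {x0}" using D(1) by (auto simp: P_def conn_singleton)
  moreover have "\<forall>S. P S \<longrightarrow> card (S \<inter> D) < Suc (card D)"
    using finD by (auto simp: less_Suc_eq_le intro: card_mono)
  ultimately have "\<exists>S. P S \<and> (\<forall>S'. P S' \<longrightarrow> card (S' \<inter> D) \<le> card (S \<inter> D))"
    by (rule ex_has_greatest_nat)
  then obtain S where S: "P S" and max: "\<And>S'. P S' \<Longrightarrow> card (S' \<inter> D) \<le> card (S \<inter> D)" by blast
  have SC: "S \<subseteq> C" "conn E S" "S \<inter> D \<noteq> {}" "card S \<le> 3 * card (S \<inter> D)" using S by (auto simp: P_def)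
  have finS: "finite S" using C SC finite_subset by blast
  have "D \<subseteq> S"
  proof (rule ccontr)
    assume "\<not> D \<subseteq> S"
    then obtain y0 where y0: "y0 \<in> D" "y0 \<notin> S" by blast
    define A where "A = S \<union> {u \<in> C. \<exists>x\<in>S. (u, x) \<in> E}"
    have "\<exists>y a b. y \<in> D \<and> y \<notin> S \<and> a \<in> C \<and> b \<in> C \<and> (a \<in> S \<or> (\<exists>x\<in>S. (a, x) \<in> E)) \<and>
      (b = a \<or> (b, a) \<in> E) \<and> (y = b \<or> (y, b) \<in> E)"
    proof (cases "A = C")
      case True
      then have "y0 \<in> A" using y0 D(1) by auto
      then show ?thesis using y0 D(1) unfolding A_def by blast
    next
      case False
      obtain a b where ab: "a \<in> A" "b \<in> C" "b \<notin> A" "(a, b) \<in> E"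
        by (rule connE[OF C(2), of A]) (use False SC conn_nonempty[OF SC(2)] in \<open>auto simp: A_def\<close>)
      obtain y where y: "y \<in> D" "(y, b) \<in> E" using D(2) ab by blast
      have "y \<notin> S" using y ab E unfolding A_def by (auto dest: symD)
      moreover have "a \<in> C" "(b, a) \<in> E" using ab SC E unfolding A_def by (auto dest: symD)
      moreover have "a \<in> S \<or> (\<exists>x\<in>S. (a, x) \<in> E)" using ab(1) unfolding A_def by blast
      ultimately show ?thesis using y ab(2) by blast
    qed
    then obtain y a b where y: "y \<in> D" "y \<notin> S" and ab: "a \<in> C" "b \<in> C"
      and a: "a \<in> S \<or> (\<exists>x\<in>S. (a, x) \<in> E)" and b: "b = a \<or> (b, a) \<in> E" and yb: "y = b \<or> (y, b) \<in> E" by blast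
    have "conn E (insert a S)"
      using a conn_insert[OF SC(2) E, of _ a] SC(2) by (cases "a \<in> S") (auto simp: insert_absorb)
    then have "conn E (insert b (insert a S))"
      using b conn_insert[OF _ E, of "insert a S" a b] by (cases "b = a") auto
    then have "conn E (insert y (insert b (insert a S)))"
      using yb conn_insert[OF _ E, of "insert b (insert a S)" b y] by (cases "y = b") auto
    moreover define S' where "S' = insert y (insert b (insert a S))"
    moreover have "card (S \<inter> D) < card (S' \<inter> D)"
      by (rule psubset_card_mono) (use y finD in \<open>auto simp: S'_def\<close>)
    moreover have "card S' \<le> card S + 3"
      using finS by (simp add: S'_def card_insert_if)
    ultimately have "P S'" using SC y ab D(1) unfolding P_def by auto
    then show False using max \<open>card (S \<inter> D) < card (S' \<inter> D)\<close> by fastforce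
  qed
  then show ?thesis using that SC by (simp add: Int_absorb1)
qed

text \<open>Each branch set is a connected dominating set of one component. Its removal costs every
  vertex at most 9(L + 1) neighbours, which the surplus in the degree hypothesis pays for; all later
  branch sets lie in the same component and are therefore adjacent to it.\<close>

lemma complete_minor_of_dense_graph:
  assumes "finite R" "R \<noteq> {}" "card R \<le> 2 * d" "sym E" "2 * d \<le> 2 ^ L"
    and "\<And>v. v \<in> R \<Longrightarrow> d + 2 * (t * (9 * (L + 1))) \<le> 2 * card (nbrs R E v)"
  shows "has_minor R E {..<t :: nat} UNIV"
  using assms
proof (induction t arbitrary: R)
  case 0
  show ?case by (auto simp: has_minor_def branch_sets_def)
next
  case (Suc t)
  define q where "q = 9 * (L + 1)"
  note R = Suc.prems(1-3) and E = Suc.prems(4) and L = Suc.prems(5)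
  have deg: "d + 2 * (Suc t * q) \<le> 2 * card (nbrs R E v)" if "v \<in> R" for v
    using Suc.prems(6)[OF that] by (simp add: q_def)
  obtain C where C: "C \<subseteq> R" "conn E C" "\<And>x y. x \<in> C \<Longrightarrow> y \<in> R \<Longrightarrow> (x, y) \<in> E \<Longrightarrow> y \<in> C"
    using connected_component_exists[OF R(1,2)] by blast
  have finC: "finite C" and C0: "C \<noteq> {}"
    using finite_subset[OF C(1) R(1)] conn_nonempty[OF C(2)] by auto
  have nbrsC: "nbrs C E v = nbrs R E v" if "v \<in> C" for v using C that by (auto simp: nbrs_def)
  have degC: "d + 2 * (Suc t * q) \<le> 2 * card (nbrs C E v)" if "v \<in> C" for v
    using deg[of v] nbrsC[OF that] that C(1) by auto
  have cardC: "card C \<le> 2 * d" using card_mono[OF R(1) C(1)] R(3) by simp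
  have "d \<le> 2 * card (nbrs C E x)" if "x \<in> C" for x using degC[OF that] by simp
  from small_dominating_set[OF finC C0 cardC this E L] obtain D where
    D: "D \<subseteq> C" "card D \<le> 3 * (L + 1)" "\<And>u. u \<in> C \<Longrightarrow> \<exists>x\<in>D. (x, u) \<in> E" by blast
  obtain S where S: "D \<subseteq> S" "S \<subseteq> C" "conn E S" "card S \<le> 3 * card D"
    by (rule connected_dominating_set[OF finC C(2) E D(1,3)])
  have cardS: "card S \<le> q" using S(4) D(2) by (simp add: q_def)
  have finS: "finite S" using S finC finite_subset by blast
  show ?case
  \<comment> \<open>For the last branch set it does not matter whether anything remains of
    \<open>C\<close>.\<close>
  proof (cases "t = 0")
    case True
    have "branch_sets R E {..<Suc t} UNIV (\<lambda>_. S)"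
      using S C(1) True by (auto simp: branch_sets_def)
    then show ?thesis unfolding has_minor_def by blast
  next
    case False
    define R' where "R' = C - S"
    obtain v where v: "v \<in> C" using C0 by blast
    have "1 \<le> q" by (simp add: q_def)
    have "2 * (2 * q) \<le> 2 * (Suc t * q)" using False by simp
    then have "2 * q \<le> card (nbrs C E v)" using degC[OF v] by linarith
    also have "\<dots> \<le> card C" using finC by (intro card_mono nbrs_subset) auto
    finally have "card S < card C" using cardS \<open>1 \<le> q\<close> by linarith
    then have "R' \<noteq> {}" using S(2) unfolding R'_def by auto
    moreover have "d + 2 * (t * (9 * (L + 1))) \<le> 2 * card (nbrs R' E u)" if "u \<in> R'" for u
    proof -
      have u: "u \<in> C" using that by (simp add: R'_def)
      have "nbrs C E u \<subseteq> nbrs R' E u \<union> S" by (auto simp: nbrs_def R'_def)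
      then have "card (nbrs C E u) \<le> card (nbrs R' E u \<union> S)"
        using finC finS by (intro card_mono) (auto simp: nbrs_def R'_def)
      also have "\<dots> \<le> card (nbrs R' E u) + card S" by (rule card_Un_le)
      finally show ?thesis using degC[OF u] cardS unfolding q_def[symmetric] by simp
    qed
    moreover have "card R' \<le> 2 * d" using cardC card_mono[of C R'] finC by (simp add: R'_def)
    ultimately have "has_minor R' E {..<t} UNIV"
      using Suc.IH[of R'] finC E L by (simp add: R'_def)
    then obtain B where B: "branch_sets R' E {..<t} UNIV B" unfolding has_minor_def by blast
    have Bi: "B i \<subseteq> C - S" "conn E (B i)" if "i < t" for i
      using B that unfolding branch_sets_def R'_def by auto
    have adj: "\<exists>x\<in>S. \<exists>u\<in>B i. (x, u) \<in> E \<and> (u, x) \<in> E" if i: "i < t" for i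
    proof -
      obtain u where u: "u \<in> B i" using conn_nonempty[OF Bi(2)[OF i]] by blast
      then have "u \<in> C" using Bi(1)[OF i] by blast
      then show ?thesis using D(3) S(1) u E by (meson subsetD symD)
    qed
    have "branch_sets R E {..<Suc t} UNIV (B(t := S))"
      unfolding branch_sets_def
    proof (intro conjI ballI impI)
      fix i assume "i \<in> {..<Suc t}"
      then consider "i = t" | "i < t" by fastforce
      then show "(B(t := S)) i \<subseteq> R" "conn E ((B(t := S)) i)"
        using S C(1) Bi by (cases; fastforce)+
    next
      fix i j assume ij: "i \<in> {..<Suc t}" "j \<in> {..<Suc t}" "i \<noteq> j"
      then consider "i = t" "j < t" | "i < t" "j = t" | "i < t" "j < t" by fastforce
      note cs = this
      show "(B(t := S)) i \<inter> (B(t := S)) j = {}"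
        using cs
      proof cases
        case 3
        then show ?thesis using B ij(3) unfolding branch_sets_def by auto
      qed (use Bi in fastforce)+
      show "\<exists>x\<in>(B(t := S)) i. \<exists>y\<in>(B(t := S)) j. (x, y) \<in> E"
        using cs
      proof cases
        case 3
        then show ?thesis using B ij(3) unfolding branch_sets_def by auto
      qed (use adj in fastforce)+
    qed
    then show ?thesis unfolding has_minor_def by blast
  qed
qed

text \<open>The dense minor has at most 2d vertices and minimum degree at least \<open>d\<close>.
  The bound on \<open>p\<close> says that half of this degree survives the removal of
  \<open>p\<close> sets of size 9(L + 1).\<close>

theorem complete_minor_of_min_degree:
  fixes V :: "'a set"
  assumes V: "finite V" "V \<noteq> {}" and E: "sym E" "irrefl E"
    and deg: "\<And>v. v \<in> V \<Longrightarrow> 2 * d \<le> card (nbrs V E v)"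
    and d: "18 * p * (L + 1) \<le> d" "1 \<le> d" "2 * d \<le> 2 ^ L"
  shows "has_minor V E {..<p} UNIV"
proof -
  define E' where "E' = E \<inter> V \<times> V"
  have E': "E' \<subseteq> V \<times> V" "sym E'" "irrefl E'" using E by (auto simp: E'_def sym_def irrefl_def)
  have "nbrs V E' v = nbrs V E v" if "v \<in> V" for v using that by (auto simp: nbrs_def E'_def)
  then have "(\<Sum>v\<in>V. 2 * d) \<le> card E'"
    unfolding card_arcs_eq_sum_degrees[OF V(1) E'(1)] using deg by (intro sum_mono) auto
  then have "2 * d * card V \<le> card E'" by (simp add: mult.commute)
  from dense_minor[OF V(1) E' V(2) d(2) this] obtain W :: "'a set" and F where
    W: "has_minor V E' W F" "finite W" "W \<noteq> {}" "sym F" "irrefl F" "card W \<le> 2 * d"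
      "\<And>w. w \<in> W \<Longrightarrow> d \<le> card (nbrs W F w)" by auto
  have "d + 2 * (p * (9 * (L + 1))) \<le> 2 * card (nbrs W F w)" if "w \<in> W" for w
    using W(7)[OF that] d(1) by (simp add: algebra_simps)
  from complete_minor_of_dense_graph[OF W(2,3,6,4) d(3) this] have "has_minor W F {..<p} UNIV" .
  then have "has_minor V E' {..<p} UNIV" by (rule has_minor_trans[OF W(1)])
  then show ?thesis by (rule has_minor_mono) (auto simp: E'_def)
qed

section \<open>Defective list colouring\<close>

definition degenerate :: "'a set \<Rightarrow> ('a \<times> 'a) set \<Rightarrow> nat \<Rightarrow> bool"
  where "degenerate V E D \<longleftrightarrow> (\<forall>X. X \<subseteq> V \<longrightarrow> X \<noteq> {} \<longrightarrow> (\<exists>v\<in>X. card (nbrs X E v) \<le> D))"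

lemma degenerate_subset: "degenerate V E D \<Longrightarrow> X \<subseteq> V \<Longrightarrow> degenerate X E D"
  unfolding degenerate_def by blast

lemma degenerate_card_arcs:
  assumes "finite V" "sym E" "irrefl E" "degenerate V E D"
  shows "card (E \<inter> V \<times> V) \<le> 2 * D * card V"
  using assms
proof (induction "card V" arbitrary: V)
  case (Suc n)
  then have "V \<noteq> {}" by auto
  then obtain v where v: "v \<in> V" "card (nbrs V E v) \<le> D"
    using Suc.prems(4) unfolding degenerate_def by blast
  define V' where "V' = V - {v}"
  define N where "N = nbrs V E v"
  have cV: "card V = Suc (card V')" unfolding V'_def by (rule card.remove[OF Suc.prems(1) v(1)])
  have finN: "finite N" using Suc.prems(1) by (simp add: N_def nbrs_def)
  have IH: "card (E \<inter> V' \<times> V') \<le> 2 * D * card V'"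
    using Suc.hyps(1)[of V'] Suc.hyps(2) Suc.prems cV degenerate_subset[of V E D V']
    by (auto simp: V'_def)
  have "E \<inter> V \<times> V \<subseteq> (E \<inter> V' \<times> V') \<union> ({v} \<times> N \<union> N \<times> {v})"
    using Suc.prems(2) by (auto simp: V'_def N_def nbrs_def dest: symD)
  then have "card (E \<inter> V \<times> V) \<le> card ((E \<inter> V' \<times> V') \<union> ({v} \<times> N \<union> N \<times> {v}))"
    using Suc.prems(1) finN by (intro card_mono) (auto simp: V'_def)
  also have "\<dots> \<le> card (E \<inter> V' \<times> V') + card ({v} \<times> N \<union> N \<times> {v})" by (rule card_Un_le)
  also have "card ({v} \<times> N \<union> N \<times> {v}) \<le> card ({v} \<times> N) + card (N \<times> {v})" by (rule card_Un_le)
  also have "\<dots> \<le> 2 * D" using v(2) by (simp add: card_cartesian_product N_def)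
  finally show ?case using IH cV by (simp add: algebra_simps)
qed simp

definition cliques :: "'a set \<Rightarrow> ('a \<times> 'a) set \<Rightarrow> nat \<Rightarrow> 'a set set"
  where "cliques V E k = {Q. Q \<subseteq> V \<and> card Q = k \<and> (\<forall>x\<in>Q. \<forall>y\<in>Q. x \<noteq> y \<longrightarrow> (x, y) \<in> E)}"

text \<open>Removing a vertex \<open>v\<close> of degree at most \<open>D\<close> destroys only the
  cliques that consist of \<open>v\<close> and k - 1 of its neighbours.\<close>

lemma degenerate_card_cliques:
  assumes "finite V" "degenerate V E D" "k \<ge> 1"
  shows "card (cliques V E k) \<le> (D choose (k - 1)) * card V"
  using assms
proof (induction "card V" arbitrary: V)
  case 0
  then have "cliques V E k = {}" by (auto simp: cliques_def)
  then show ?case by simp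
next
  case (Suc n)
  then have "V \<noteq> {}" by auto
  then obtain v where v: "v \<in> V" "card (nbrs V E v) \<le> D"
    using Suc.prems(2) unfolding degenerate_def by blast
  define V' where "V' = V - {v}"
  define N where "N = nbrs V E v"
  have cV: "card V = Suc (card V')" unfolding V'_def by (rule card.remove[OF Suc.prems(1) v(1)])
  have finN: "finite N" using Suc.prems(1) by (simp add: N_def nbrs_def)
  have IH: "card (cliques V' E k) \<le> (D choose (k - 1)) * card V'"
    using Suc.hyps(1)[of V'] Suc.hyps(2) Suc.prems cV degenerate_subset[of V E D V']
    by (auto simp: V'_def)
  define T where "T = {Q. Q \<subseteq> N \<and> card Q = k - 1}"
  have sub: "cliques V E k \<subseteq> cliques V' E k \<union> insert v ` T"
  proof
    fix Q assume Q: "Q \<in> cliques V E k"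
    show "Q \<in> cliques V' E k \<union> insert v ` T"
    proof (cases "v \<in> Q")
      case True
      have finQ: "finite Q" using Q Suc.prems(1) finite_subset by (auto simp: cliques_def)
      have "Q - {v} \<in> T" using Q True finQ by (auto simp: T_def cliques_def N_def nbrs_def)
      moreover have "Q = insert v (Q - {v})" using True by blast
      ultimately show ?thesis by blast
    qed (use Q in \<open>auto simp: cliques_def V'_def\<close>)
  qed
  have "finite (cliques V' E k)" using Suc.prems(1)
    by (auto simp: cliques_def V'_def intro: finite_subset[of _ "Pow V"])
  moreover have finT: "finite T" unfolding T_def using finN by simp
  ultimately have "card (cliques V E k) \<le> card (cliques V' E k \<union> insert v ` T)"
    by (intro card_mono sub) auto
  also have "\<dots> \<le> card (cliques V' E k) + card (insert v ` T)" by (rule card_Un_le)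
  also have "card (insert v ` T) \<le> card T" using finT by (rule card_image_le)
  also have "card T = (card N choose (k - 1))" unfolding T_def by (rule n_subsets[OF finN])
  also have "\<dots> \<le> (D choose (k - 1))" using v(2) unfolding N_def by (rule binomial_right_mono)
  finally show ?case using IH cV by (simp add: algebra_simps)
qed

text \<open>To be used with the vertex set \<open>{..<k + 3}\<close>; loops are irrelevant for minors.\<close>

definition K_join_3K1 :: "nat \<Rightarrow> (nat \<times> nat) set"
  where "K_join_3K1 k = {(i, j). i < k \<or> j < k}"

lemma card_ge_3_obtain:
  assumes "card S \<ge> 3"
  obtains a b c where "a \<in> S" "b \<in> S" "c \<in> S" "a \<noteq> b" "a \<noteq> c" "b \<noteq> c"
proof -
  obtain T where T: "T \<subseteq> S" "card T = 3" by (rule obtain_subset_with_card_n[OF assms])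
  then obtain a b c where "T = {a, b, c}" "a \<noteq> b" "b \<noteq> c" "a \<noteq> c"
    using card_3_iff[of T] by metis
  then show ?thesis using T(1) by (intro that[of a b c]) simp_all
qed

text \<open>An independent set of vertices whose neighbourhoods lie in \<open>W\<close>: as many as possible of
  them are used to subdivide new edges inside \<open>W\<close>, so that the neighbourhoods of the others
  become cliques. These cliques are few, hence many of the others share one.\<close>

lemma independent_set_bound:
  assumes W: "finite W" and A: "finite A" "A \<inter> W = {}" and E: "sym E" "irrefl E"
    and k: "k \<ge> 1" and degA: "\<And>a. a \<in> A \<Longrightarrow> k \<le> card (nbrs W E a)"
    and no_minor: "\<not> has_minor (W \<union> A) E {..<k + 3} (K_join_3K1 k)"
    and degen: "\<And>F. sym F \<Longrightarrow> irrefl F \<Longrightarrow> has_minor (W \<union> A) E W F \<Longrightarrow> degenerate W F D"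
  shows "card A \<le> (2 * D + 2 * (D choose (k - 1))) * card W"
proof -
  have symE: "(b, a) \<in> E" if "(a, b) \<in> E" for a b using E(1) that by (auto dest: symD)
  \<comment> \<open>\<open>\<phi> a\<close> is the pair of neighbours that \<open>a\<close> is used
    to join. Pairs are ordered and the bound below counts arcs, so it is harmless that a pair and
    its reversal may both occur.\<close>
  define P where "P = (\<lambda>(A1, \<phi>). A1 \<subseteq> A \<and> inj_on \<phi> A1 \<and>
    (\<forall>a\<in>A1. fst (\<phi> a) \<noteq> snd (\<phi> a) \<and> fst (\<phi> a) \<in> nbrs W E a \<and> snd (\<phi> a) \<in> nbrs W E a))"
  have "P ({}, undefined)" by (simp add: P_def)
  moreover have "\<forall>x. P x \<longrightarrow> card (fst x) < Suc (card A)"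
    using A(1) by (auto simp: P_def less_Suc_eq_le intro: card_mono)
  ultimately have "\<exists>x. P x \<and> (\<forall>y. P y \<longrightarrow> card (fst y) \<le> card (fst x))"
    by (rule ex_has_greatest_nat)
  then obtain A1 \<phi> where P: "P (A1, \<phi>)" and max: "\<And>A' \<psi>. P (A', \<psi>) \<Longrightarrow> card A' \<le> card A1" by force
  have A1: "A1 \<subseteq> A" "inj_on \<phi> A1" using P by (auto simp: P_def)
  have \<phi>: "fst (\<phi> a) \<noteq> snd (\<phi> a)" "fst (\<phi> a) \<in> W" "snd (\<phi> a) \<in> W" "(a, fst (\<phi> a)) \<in> E" "(a, snd (\<phi> a)) \<in> E"
    if "a \<in> A1" for a using P that by (auto simp: P_def nbrs_def)
  have finA1: "finite A1" using A1 A finite_subset by blast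
  define F where "F = (E \<inter> W \<times> W) \<union> (\<phi> ` A1 \<union> (\<phi> ` A1)\<inverse>)"
  have symF: "sym F" using E by (auto simp: F_def sym_def)
  have "\<phi> a \<noteq> (x, x)" if "a \<in> A1" for a x using \<phi>(1)[OF that] by auto
  moreover have "(x, x) \<notin> E" for x using E(2) by (simp add: irrefl_def)
  ultimately have irrF: "irrefl F" unfolding F_def irrefl_def by (auto dest: sym)
  \<comment> \<open>Every used \<open>a\<close> is contracted into the first of its two neighbours,
    which realises the new edge.\<close>
  define B where "B b = insert b {a \<in> A1. fst (\<phi> a) = b}" for b
  have B_conn: "conn E (B b)" if "b \<in> W" for b
  proof -
    have "finite X \<Longrightarrow> X \<subseteq> {a \<in> A1. fst (\<phi> a) = b} \<Longrightarrow> conn E (insert b X)" for X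
    proof (induction X rule: finite_induct)
      case (insert a X)
      then have ab: "(a, b) \<in> E" using \<phi>(4) by blast
      have "conn E (insert b X)" using insert by simp
      then have "conn E (insert a (insert b X))" by (rule conn_insert[OF _ E(1) insertI1 ab])
      then show ?case by (simp add: insert_commute)
    qed (simp add: conn_singleton)
    from this[of "{a \<in> A1. fst (\<phi> a) = b}"] finA1 show ?thesis by (simp add: B_def)
  qed
  have B_sub: "B b \<subseteq> W \<union> A1" if "b \<in> W" for b using that by (auto simp: B_def)
  have B_disj: "B b \<inter> B b' = {}" if "b \<in> W" "b' \<in> W" "b \<noteq> b'" for b b'
    using that A A1 by (auto simp: B_def)
  have B_adj: "\<exists>x\<in>B b. \<exists>y\<in>B b'. (x, y) \<in> E" if "b \<in> W" "b' \<in> W" "(b, b') \<in> F" for b b'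
  proof -
    have "(b, b') \<in> E \<or> (\<exists>a\<in>A1. \<phi> a = (b, b')) \<or> (\<exists>a\<in>A1. \<phi> a = (b', b))"
      using that(3) by (auto simp: F_def image_iff)
    then consider "(b, b') \<in> E" | a where "a \<in> A1" "\<phi> a = (b, b')" | a where "a \<in> A1" "\<phi> a = (b', b)"
      by metis
    then show ?thesis
    proof cases
      case 1
      then show ?thesis by (auto simp: B_def)
    next
      case 2
      then have "a \<in> B b" "(a, b') \<in> E" using \<phi>(5)[of a] by (auto simp: B_def)
      then show ?thesis by (auto simp: B_def)
    next
      case 3
      then have "a \<in> B b'" "(b, a) \<in> E" using \<phi>(5)[of a] symE by (auto simp: B_def)
      then show ?thesis by (auto simp: B_def)
    qed
  qed
  have "branch_sets (W \<union> A) E W F B"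
    unfolding branch_sets_def using B_sub B_conn B_disj B_adj A1(1) by blast
  then have deg: "degenerate W F D" using degen[OF symF irrF] unfolding has_minor_def by blast
  have "card A1 = card (\<phi> ` A1)" using A1(2) by (simp add: card_image)
  also have "\<dots> \<le> card (F \<inter> W \<times> W)"
  proof (rule card_mono)
    show "\<phi> ` A1 \<subseteq> F \<inter> W \<times> W" using \<phi>(2,3) by (intro image_subsetI) (simp add: F_def mem_Times_iff)
  qed (use W in simp)
  also have "\<dots> \<le> 2 * D * card W" by (rule degenerate_card_arcs[OF W symF irrF deg])
  finally have cA1: "card A1 \<le> 2 * D * card W" .
  \<comment> \<open>Otherwise \<open>a\<close> could be used for the missing edge between
    \<open>u\<close> and \<open>w\<close>, against the maximality of \<open>A1\<close>.\<close>
  have clique: "(u, w) \<in> F" if a: "a \<in> A - A1" and uw: "u \<in> nbrs W E a" "w \<in> nbrs W E a" "u \<noteq> w" for a u w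
  proof (rule ccontr)
    assume nF: "(u, w) \<notin> F"
    define \<psi> where "\<psi> = \<phi>(a := (u, w))"
    have "P (insert a A1, \<psi>)"
    proof -
      have new: "(u, w) \<notin> \<phi> ` A1" using nF by (simp add: F_def)
      have \<psi>a: "\<psi> a = (u, w)" by (simp add: \<psi>_def)
      have same: "\<psi> x = \<phi> x" if "x \<in> A1" for x using a that by (auto simp: \<psi>_def)
      have "inj_on \<psi> A1" using A1(2) same by (simp cong: inj_on_cong)
      moreover have "\<psi> ` (A1 - {a}) = \<phi> ` A1" using a same by (intro image_cong) auto
      ultimately have "inj_on \<psi> (insert a A1)"
        unfolding inj_on_insert using new \<psi>a by simp
      moreover have "fst (\<psi> x) \<noteq> snd (\<psi> x) \<and>
        fst (\<psi> x) \<in> nbrs W E x \<and> snd (\<psi> x) \<in> nbrs W E x"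
        if "x \<in> insert a A1" for x
      proof (cases "x = a")
        case False
        then have "x \<in> A1" using that by simp
        then show ?thesis using P by (simp only: same) (simp add: P_def)
      qed (use uw in \<open>simp add: \<psi>_def\<close>)
      moreover have "insert a A1 \<subseteq> A" using A1(1) a by blast
      ultimately show ?thesis unfolding P_def prod.case by blast
    qed
    from max[OF this] show False using a finA1 by simp
  qed
  define Q where "Q a = (SOME S. S \<subseteq> nbrs W E a \<and> card S = k)" for a
  have Q: "Q a \<subseteq> nbrs W E a" "card (Q a) = k" if "a \<in> A" for a
  proof -
    have "\<exists>S. S \<subseteq> nbrs W E a \<and> card S = k"
      by (rule obtain_subset_with_card_n[OF degA[OF that]]) auto
    from someI_ex[OF this] show "Q a \<subseteq> nbrs W E a" "card (Q a) = k" by (auto simp: Q_def)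
  qed
  have "card (A - A1) \<le> 2 * card (cliques W F k)"
  proof (rule ccontr)
    assume many: "\<not> ?thesis"
    have Qc: "Q a \<in> cliques W F k" if "a \<in> A - A1" for a
      using Q[of a] clique[OF that] that nbrs_subset[of W E a] unfolding cliques_def by blast
    have fin: "finite (cliques W F k)" using W
      by (auto simp: cliques_def intro: finite_subset[of _ "Pow W"])
    have "\<exists>S\<in>cliques W F k. 3 \<le> card {a \<in> A - A1. Q a = S}"
    proof (rule ccontr)
      assume "\<not> ?thesis"
      then have le: "card {a \<in> A - A1. Q a = S} \<le> 2" if "S \<in> cliques W F k" for S using that by force
      have "A - A1 = (\<Union>S\<in>cliques W F k. {a \<in> A - A1. Q a = S})" using Qc by blast
      then have "card (A - A1) \<le> (\<Sum>S\<in>cliques W F k. card {a \<in> A - A1. Q a = S})"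
        using card_UN_le[OF fin] by metis
      also have "\<dots> \<le> (\<Sum>S\<in>cliques W F k. 2)" using le by (intro sum_mono) auto
      finally show False using many by simp
    qed
    then obtain S where S: "S \<in> cliques W F k" "3 \<le> card {a \<in> A - A1. Q a = S}" by blast
    obtain a0 a1 a2 where "a0 \<in> {a \<in> A - A1. Q a = S}" "a1 \<in> {a \<in> A - A1. Q a = S}" "a2 \<in> {a \<in> A - A1. Q a = S}"
      and ne: "a0 \<noteq> a1" "a0 \<noteq> a2" "a1 \<noteq> a2"
      by (rule card_ge_3_obtain[OF S(2)])
    then have a: "a0 \<in> A - A1" "Q a0 = S" "a1 \<in> A - A1" "Q a1 = S" "a2 \<in> A - A1" "Q a2 = S" by auto
    have adj_a: "(x, s) \<in> E" if "x \<in> {a0, a1, a2}" "s \<in> S" for x s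
      using that a Q(1)[of a0] Q(1)[of a1] Q(1)[of a2] by (auto simp: nbrs_def)
    have cS: "card S = k" "S \<subseteq> W" and SF: "\<And>x y. x \<in> S \<Longrightarrow> y \<in> S \<Longrightarrow> x \<noteq> y \<Longrightarrow> (x, y) \<in> F"
      using S(1) by (auto simp: cliques_def)
    then have "finite S" using W finite_subset by blast
    obtain h where h: "bij_betw h {..<k} S"
      using ex_bij_betw_nat_finite[OF \<open>finite S\<close>] cS(1) by (auto simp: lessThan_atLeast0)
    define x where "x i = (if i = k then a0 else if i = Suc k then a1 else a2)" for i
    define C where "C i = (if i < k then B (h i) else {x i})" for i
    have hS: "h i \<in> S" if "i < k" for i using h that by (auto simp: bij_betw_def)
    have hinj: "h i \<noteq> h j" if "i < k" "j < k" "i \<noteq> j" for i j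
      using h that by (auto simp: bij_betw_def inj_on_def)
    have x: "x i \<in> {a0, a1, a2}" "x i \<in> A - A1" for i using a by (auto simp: x_def)
    have hB: "h i \<in> C i" if "i < k" for i using that by (simp add: C_def B_def)
    have big: "i = k \<or> i = Suc k \<or> i = Suc (Suc k)" if "i \<in> {..<k + 3}" "\<not> i < k" for i using that by auto
    have "branch_sets (W \<union> A) E {..<k + 3} (K_join_3K1 k) C"
      unfolding branch_sets_def
    proof (intro conjI ballI impI)
      fix i assume "i \<in> {..<k + 3}"
      show "C i \<subseteq> W \<union> A" using B_sub[of "h i"] hS[of i] cS(2) A1(1) x(2)[of i] by (auto simp: C_def)
      show "conn E (C i)" using B_conn[of "h i"] hS[of i] cS(2) by (auto simp: C_def conn_singleton)
    next
      fix i j assume ij: "i \<in> {..<k + 3}" "j \<in> {..<k + 3}" "i \<noteq> j"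
      have xB: "x i \<notin> B (h j)" if "j < k" for i j
        using B_sub[of "h j"] hS[OF that] cS(2) x(2)[of i] A(2) by blast
      consider "i < k" "j < k" | "i < k" "\<not> j < k" | "\<not> i < k" "j < k" | "\<not> i < k" "\<not> j < k" by blast
      then show "C i \<inter> C j = {}"
      proof cases
        case 1
        then show ?thesis using B_disj[of "h i" "h j"] hS hinj ij(3) cS(2) by (auto simp: C_def)
      next
        case 4
        then show ?thesis using big[OF ij(1)] big[OF ij(2)] ij(3) ne by (auto simp: C_def x_def)
      qed (use xB in \<open>auto simp: C_def\<close>)
      assume "(i, j) \<in> K_join_3K1 k"
      then have "i < k \<or> j < k" by (simp add: K_join_3K1_def)
      then consider "i < k" "j < k" | "i < k" "\<not> j < k" | "\<not> i < k" "j < k" by blast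
      then show "\<exists>x\<in>C i. \<exists>y\<in>C j. (x, y) \<in> E"
      proof cases
        case 1
        then have "(h i, h j) \<in> F" using SF hS hinj ij(3) by blast
        then show ?thesis using B_adj[of "h i" "h j"] hS 1 cS(2) by (auto simp: C_def)
      next
        case 2
        then have "(h i, x j) \<in> E" "x j \<in> C j" using adj_a[OF x(1) hS] symE by (auto simp: C_def)
        then show ?thesis using hB 2 by blast
      next
        case 3
        then have "(x i, h j) \<in> E" "x i \<in> C i" using adj_a[OF x(1) hS] by (auto simp: C_def)
        then show ?thesis using hB 3 by blast
      qed
    qed
    then show False using no_minor unfolding has_minor_def by blast
  qed
  also have "\<dots> \<le> 2 * ((D choose (k - 1)) * card W)"
    using degenerate_card_cliques[OF W deg k] by simp
  finally have "card (A - A1) \<le> 2 * (D choose (k - 1)) * card W" by simp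
  moreover have "card A = card A1 + card (A - A1)"
    using A1(1) A(1) by (metis card_Diff_subset card_mono finA1 le_add_diff_inverse)
  ultimately show ?thesis using cA1 by (simp add: algebra_simps)
qed

text \<open>The degree threshold that makes the count of arcs contradictory: there are at most 2D|V|
  arcs, and |V| is at most the bracket times the number of vertices above the threshold.\<close>

definition defect_bound :: "nat \<Rightarrow> nat \<Rightarrow> nat"
  where "defect_bound D k = 2 * D * (1 + 2 * D + 2 * (D choose (k - 1)))"

text \<open>Without a light edge the vertices of degree at most \<open>l\<close> are independent and
  have all their neighbours in the rest \<open>W\<close>. So |V| is bounded by a multiple of |W|,
  and the degrees above \<open>l\<close> in \<open>W\<close> add up to more arcs than a degenerate
  graph has.\<close>

lemma light_edge_exists:
  assumes V: "finite V" "V \<noteq> {}" and E: "sym E" "irrefl E" and k: "k \<ge> 1"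
    and deg: "\<And>v. v \<in> V \<Longrightarrow> k \<le> card (nbrs V E v)"
    and no_minor: "\<not> has_minor V E {..<k + 3} (K_join_3K1 k)"
    and degen: "\<And>X F. X \<subseteq> V \<Longrightarrow> sym F \<Longrightarrow> irrefl F \<Longrightarrow> has_minor V E X F \<Longrightarrow> degenerate X F D"
  shows "\<exists>x\<in>V. \<exists>y\<in>V. (x, y) \<in> E \<and> card (nbrs V E x) \<le> defect_bound D k \<and> card (nbrs V E y) \<le> defect_bound D k"
proof (rule ccontr)
  assume no: "\<not> ?thesis"
  define l where "l = defect_bound D k"
  define A where "A = {v \<in> V. card (nbrs V E v) \<le> l}"
  define W where "W = V - A"
  have indep: "(x, y) \<notin> E" if "x \<in> A" "y \<in> A" for x y
    using no that by (auto simp: A_def l_def)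
  have VWA: "V = W \<union> A" "A \<inter> W = {}" "finite W" "finite A" "W \<subseteq> V" using V by (auto simp: W_def A_def)
  have nbrsA: "nbrs W E a = nbrs V E a" if "a \<in> A" for a
    using indep[OF that] by (auto simp: nbrs_def W_def)
  have "card A \<le> (2 * D + 2 * (D choose (k - 1))) * card W"
  proof (rule independent_set_bound[OF VWA(3,4,2) E k])
    show "k \<le> card (nbrs W E a)" if "a \<in> A" for a using deg[of a] that nbrsA[OF that] by (simp add: A_def)
    show "\<not> has_minor (W \<union> A) E {..<k + 3} (K_join_3K1 k)" using no_minor VWA(1) by simp
    show "degenerate W F D" if "sym F" "irrefl F" "has_minor (W \<union> A) E W F" for F
      using degen[OF VWA(5) that(1,2)] that(3) VWA(1) by simp
  qed
  moreover have "card V = card W + card A" using VWA card_Un_disjoint[of W A] by (simp add: Int_commute)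
  ultimately have cV: "card V \<le> (1 + 2 * D + 2 * (D choose (k - 1))) * card W" by (simp add: algebra_simps)
  have "W \<noteq> {}"
  proof
    assume "W = {}"
    then have "card V = 0" using cV by simp
    then show False using V by simp
  qed
  then have W0: "card W > 0" using VWA by (simp add: card_gt_0_iff)
  have "(l + 1) * card W = (\<Sum>w\<in>W. l + 1)" by simp
  also have "\<dots> \<le> (\<Sum>w\<in>W. card (nbrs V E w))" by (intro sum_mono) (auto simp: W_def A_def)
  also have "\<dots> \<le> (\<Sum>w\<in>V. card (nbrs V E w))" using V VWA(5) by (intro sum_mono2) auto
  also have "\<dots> = (\<Sum>w\<in>V. card (nbrs V (E \<inter> V \<times> V) w))"
    by (intro sum.cong arg_cong[where f = card]) (auto simp: nbrs_def)
  also have "\<dots> = card (E \<inter> V \<times> V)" by (rule card_arcs_eq_sum_degrees[symmetric]) (use V in auto)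
  also have "\<dots> \<le> 2 * D * card V"
    by (rule degenerate_card_arcs[OF V(1) E degen[OF subset_refl E has_minor_self]])
  also have "\<dots> \<le> 2 * D * ((1 + 2 * D + 2 * (D choose (k - 1))) * card W)" using cV by (intro mult_left_mono) auto
  also have "\<dots> = l * card W" unfolding l_def defect_bound_def by (simp only: mult.assoc)
  finally show False using W0 by simp
qed

text \<open>A vertex with fewer than \<open>k\<close> neighbours is coloured last, with a colour
  that none of them has. If there is no such vertex, a light edge is deleted; restoring it changes
  the defect only at its two ends, where the degree is already at most \<open>l\<close>.\<close>

lemma light_edges_imp_choosable:
  assumes "finite V" "sym E" "irrefl E"
    and light: "\<And>X F. X \<subseteq> V \<Longrightarrow> X \<noteq> {} \<Longrightarrow> F \<subseteq> E \<Longrightarrow> sym F \<Longrightarrow> \<forall>v\<in>X. k \<le> card (nbrs X F v) \<Longrightarrow>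
      \<exists>x\<in>X. \<exists>y\<in>X. (x, y) \<in> F \<and> card (nbrs X F x) \<le> l \<and> card (nbrs X F y) \<le> l"
    and L: "\<And>v. v \<in> V \<Longrightarrow> finite (L v) \<and> card (L v) = k"
  shows "\<exists>c. \<forall>v\<in>V. c v \<in> L v \<and> card {w \<in> nbrs V E v. c w = c v} \<le> l"
proof -
  have "X \<subseteq> V \<Longrightarrow> F \<subseteq> E \<Longrightarrow> sym F \<Longrightarrow>
    \<exists>c. \<forall>v\<in>X. c v \<in> L v \<and> card {w \<in> nbrs X F v. c w = c v} \<le> l" for X F
  proof (induction "card X + card (F \<inter> X \<times> X)" arbitrary: X F rule: less_induct)
    case less
    note X = less.prems(1) and F = less.prems(2,3)
    have finX: "finite X" using X assms(1) finite_subset by blast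
    have symF: "(b, a) \<in> F" if "(a, b) \<in> F" for a b using F(2) that by (auto dest: symD)
    have irr: "(a, a) \<notin> F" for a using F(1) assms(3) by (auto simp: irrefl_def)
    consider "X = {}" | v where "v \<in> X" "card (nbrs X F v) < k" | "X \<noteq> {}" "\<forall>v\<in>X. k \<le> card (nbrs X F v)"
      by (meson not_le)
    then show ?case
    proof cases
      case 1
      then show ?thesis by simp
    next
      case (2 v)
      define X' where "X' = X - {v}"
      have "card X = Suc (card X')" unfolding X'_def by (rule card.remove[OF finX 2(1)])
      moreover have "card (F \<inter> X' \<times> X') \<le> card (F \<inter> X \<times> X)"
        using finX by (intro card_mono) (auto simp: X'_def)
      ultimately have "\<exists>c. \<forall>v\<in>X'. c v \<in> L v \<and> card {w \<in> nbrs X' F v. c w = c v} \<le> l"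
        using X F by (intro less.hyps) (auto simp: X'_def)
      then obtain c where c: "\<And>u. u \<in> X' \<Longrightarrow> c u \<in> L u"
        "\<And>u. u \<in> X' \<Longrightarrow> card {w \<in> nbrs X' F u. c w = c u} \<le> l" by blast
      have Lv: "finite (L v)" "card (L v) = k" using L[of v] 2(1) X by auto
      have "card (c ` nbrs X F v) \<le> card (nbrs X F v)" using finX by (intro card_image_le) (simp add: nbrs_def)
      then have "\<not> L v \<subseteq> c ` nbrs X F v"
        using 2(2) Lv card_mono[of "c ` nbrs X F v" "L v"] finX by (force simp: nbrs_def)
      then obtain p where p: "p \<in> L v" "p \<notin> c ` nbrs X F v" by blast
      define c' where "c' = c(v := p)"
      have "c' u \<in> L u \<and> card {w \<in> nbrs X F u. c' w = c' u} \<le> l" if u: "u \<in> X" for u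
      proof (cases "u = v")
        case True
        have none: "c' w \<noteq> p" if "w \<in> nbrs X F v" for w
        proof -
          have "w \<noteq> v" using that irr by (auto simp: nbrs_def)
          then show ?thesis using p(2) that by (auto simp: c'_def)
        qed
        moreover have "c' u = p" using True by (simp add: c'_def)
        ultimately have "{w \<in> nbrs X F u. c' w = c' u} = {}" using True by auto
        then have "card {w \<in> nbrs X F u. c' w = c' u} \<le> l" by (simp only: card.empty)
        then show ?thesis using True p(1) \<open>c' u = p\<close> by simp
      next
        case False
        then have u': "u \<in> X'" using u by (simp add: X'_def)
        have "c' w = c' u \<longleftrightarrow> w \<noteq> v \<and> c w = c u" if "w \<in> nbrs X F u" for w
        proof (cases "w = v")
          case True
          then have "u \<in> nbrs X F v" using that u symF by (auto simp: nbrs_def)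
          then show ?thesis using True False p(2) by (auto simp: c'_def)
        qed (use False in \<open>auto simp: c'_def\<close>)
        then have "{w \<in> nbrs X F u. c' w = c' u} = {w \<in> nbrs X' F u. c w = c u}"
          by (auto simp: nbrs_def X'_def)
        then show ?thesis using c[OF u'] False by (simp add: c'_def)
      qed
      then show ?thesis by blast
    next
      case 3
      obtain x y where xy: "x \<in> X" "y \<in> X" "(x, y) \<in> F" "card (nbrs X F x) \<le> l" "card (nbrs X F y) \<le> l"
        using light[OF X 3(1) F 3(2)] by blast
      define F' where "F' = F - {(x, y), (y, x)}"
      have "card (F' \<inter> X \<times> X) < card (F \<inter> X \<times> X)"
        using finX xy by (intro psubset_card_mono) (auto simp: F'_def)
      then have "\<exists>c. \<forall>v\<in>X. c v \<in> L v \<and> card {w \<in> nbrs X F' v. c w = c v} \<le> l"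
        using X F by (intro less.hyps) (auto simp: F'_def sym_def)
      then obtain c where c: "\<And>u. u \<in> X \<Longrightarrow> c u \<in> L u"
        "\<And>u. u \<in> X \<Longrightarrow> card {w \<in> nbrs X F' u. c w = c u} \<le> l" by blast
      have "card {w \<in> nbrs X F u. c w = c u} \<le> l" if u: "u \<in> X" for u
      proof (cases "u \<in> {x, y}")
        case True
        have "card {w \<in> nbrs X F u. c w = c u} \<le> card (nbrs X F u)"
          using finX by (intro card_mono) (auto simp: nbrs_def)
        then show ?thesis using True xy(4,5) by auto
      next
        case False
        then have "nbrs X F u = nbrs X F' u" by (auto simp: nbrs_def F'_def)
        then show ?thesis using c(2)[OF u] by simp
      qed
      then show ?thesis using c(1) by blast
    qed
  qed
  from this[OF subset_refl subset_refl assms(2)] show ?thesis .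
qed

theorem choosable_of_no_minor:
  assumes V: "finite V" and E: "sym E" "irrefl E" and k: "k \<ge> 1"
    and no_minor: "\<not> has_minor V E {..<k + 3} (K_join_3K1 k)"
    and d: "18 * (k + 3) * (M + 1) \<le> d" "2 * d \<le> 2 ^ M"
    and L: "\<And>v. v \<in> V \<Longrightarrow> finite (L v) \<and> card (L v) = k"
  shows "\<exists>c. \<forall>v\<in>V. c v \<in> L v \<and> card {w \<in> nbrs V E v. c w = c v} \<le> defect_bound (2 * d) k"
proof (rule light_edges_imp_choosable[OF V E _ L])
  fix X F assume X: "X \<subseteq> V" "X \<noteq> {}" and F: "F \<subseteq> E" "sym F" and deg: "\<forall>v\<in>X. k \<le> card (nbrs X F v)"
  have finX: "finite X" using X V finite_subset by blast
  have irr: "irrefl F" using F(1) E(2) by (auto simp: irrefl_def)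
  have no_minor': "\<not> has_minor X F {..<k + 3} (K_join_3K1 k)"
    using no_minor has_minor_mono[of X F "{..<k + 3}" "K_join_3K1 k" V E] X F by blast
  have "1 \<le> d" using d(1) by simp
  show "\<exists>x\<in>X. \<exists>y\<in>X. (x, y) \<in> F \<and> card (nbrs X F x) \<le> defect_bound (2 * d) k \<and>
    card (nbrs X F y) \<le> defect_bound (2 * d) k"
  proof (rule light_edge_exists[OF finX X(2) F(2) irr k _ no_minor'])
    show "k \<le> card (nbrs X F v)" if "v \<in> X" for v using deg that by blast
    fix Y H assume Y: "Y \<subseteq> X" and H: "sym H" "irrefl H" "has_minor X F Y H"
    show "degenerate Y H (2 * d)"
      unfolding degenerate_def
    proof (intro allI impI, rule ccontr)
      fix Z assume Z: "Z \<subseteq> Y" "Z \<noteq> {}" and "\<not> (\<exists>v\<in>Z. card (nbrs Z H v) \<le> 2 * d)"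
      then have big: "2 * d \<le> card (nbrs Z H v)" if "v \<in> Z" for v using that by fastforce
      have "finite Z" using finite_subset[OF subset_trans[OF Z(1) Y] finX] .
      from complete_minor_of_min_degree[OF this Z(2) H(1,2) big d(1) \<open>1 \<le> d\<close> d(2)]
      have "has_minor Z H {..<k + 3} UNIV" by simp
      then have "has_minor Y H {..<k + 3} (K_join_3K1 k)" by (rule has_minor_mono) (use Z in auto)
      then have "has_minor X F {..<k + 3} (K_join_3K1 k)" by (rule has_minor_trans[OF H(3)])
      then show False using no_minor' by blast
    qed
  qed
qed

section \<open>An upper bound for the corank\<close>

text \<open>Indices from \<open>n\<close> on are included, so that a vector vanishing on its support
  equals the zero function.\<close>

definition supported :: "(nat \<Rightarrow> real) \<Rightarrow> nat set \<Rightarrow> bool"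
  where "supported x S \<longleftrightarrow> (\<forall>i. i \<notin> S \<longrightarrow> x i = 0)"

definition restr :: "nat set \<Rightarrow> (nat \<Rightarrow> real) \<Rightarrow> nat \<Rightarrow> real"
  where "restr S x i = (if i \<in> S then x i else 0)"

lemma supported_restr: "supported (restr S x) S"
  by (simp add: supported_def restr_def)

lemma sum_negI:
  fixes f :: "'i \<Rightarrow> real"
  assumes "finite I" "\<And>i. i \<in> I \<Longrightarrow> f i \<le> 0" "j \<in> I" "f j < 0"
  shows "(\<Sum>i\<in>I. f i) < 0"
proof -
  have "(\<Sum>i\<in>I. f i) < (\<Sum>i\<in>I. 0)" by (rule sum_strict_mono_ex1) (use assms in auto)
  then show ?thesis by simp
qed

text \<open>The defining conditions of the parameter for a graph transported to the indices below
  \<open>n\<close>, with the strong Arnold property phrased for functions instead of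
  matrices.\<close>

locale cdv_matrix =
  fixes n :: nat and E :: "(nat \<times> nat) set" and M :: "real mat"
  assumes carrier: "M \<in> carrier_mat n n" and symmetric: "M\<^sup>T = M"
    and sym_E: "sym E" and irrefl_E: "irrefl E" and E_sub: "E \<subseteq> {..<n} \<times> {..<n}"
    and edge: "(i, j) \<in> E \<Longrightarrow> entries M i j < 0"
    and non_edge: "i < n \<Longrightarrow> j < n \<Longrightarrow> i \<noteq> j \<Longrightarrow> (i, j) \<notin> E \<Longrightarrow> entries M i j = 0"
    and one_neg: "one_negative_eigenvalue M"
    and sap: "(\<And>i j. X i j = X j i) \<Longrightarrow> (\<And>i j. i < n \<Longrightarrow> j < n \<Longrightarrow> app n (entries M) (\<lambda>k. X k j) i = 0) \<Longrightarrow>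
      (\<And>i j. i = j \<or> (i, j) \<in> E \<Longrightarrow> X i j = 0) \<Longrightarrow> i < n \<Longrightarrow> j < n \<Longrightarrow> X i j = 0"
begin

abbreviation Mv :: "(nat \<Rightarrow> real) \<Rightarrow> nat \<Rightarrow> real"
  where "Mv \<equiv> app n (entries M)"

abbreviation form :: "(nat \<Rightarrow> real) \<Rightarrow> (nat \<Rightarrow> real) \<Rightarrow> real"
  where "form \<equiv> bilin n (entries M)"

definition kernel_vector :: "(nat \<Rightarrow> real) \<Rightarrow> bool"
  where "kernel_vector x \<longleftrightarrow> (\<forall>i<n. Mv x i = 0)"

text \<open>Says that \<open>K\<close> is a union of connected components of the graph without
  \<open>C\<close>.\<close>

definition closed_off :: "nat set \<Rightarrow> nat set \<Rightarrow> bool"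
  where "closed_off C K \<longleftrightarrow> K \<subseteq> {..<n} - C \<and> (\<forall>x\<in>K. \<forall>y<n. y \<notin> C \<longrightarrow> (x, y) \<in> E \<longrightarrow> y \<in> K)"

lemma symE: "(i, j) \<in> E \<Longrightarrow> (j, i) \<in> E"
  using sym_E by (auto dest: symD)

lemma irreflE: "(i, i) \<notin> E"
  using irrefl_E by (simp add: irrefl_def)

lemma off_diagonal_nonpos: "i < n \<Longrightarrow> j < n \<Longrightarrow> i \<noteq> j \<Longrightarrow> entries M i j \<le> 0"
  using edge[of i j] non_edge[of i j] by (cases "(i, j) \<in> E") auto

lemma form_commute: "form x y = form y x"
  by (rule bilin_commute[OF symf_entries[OF carrier symmetric]])

lemma form_eq_0: "(\<And>i. i < n \<Longrightarrow> x i = 0 \<or> Mv y i = 0) \<Longrightarrow> form x y = 0"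
  unfolding bilin_def dotp_def by (intro sum.neutral) auto

lemma form_unit:
  assumes "i < n"
  shows "form (\<lambda>j. if j = i then 1 else 0) y = Mv y i"
proof -
  have "form (\<lambda>j. if j = i then 1 else 0) y = (\<Sum>j<n. if j = i then Mv y j else 0)"
    unfolding bilin_def dotp_def by (intro sum.cong) auto
  then show ?thesis using assms by simp
qed

text \<open>The symmetric matrix x y^T + y x^T is annihilated by \<open>M\<close> and lives on pairs
  between \<open>S\<close> and \<open>T\<close>, which are neither diagonal nor edges.\<close>

lemma no_nonadjacent_kernel_vectors:
  assumes x: "kernel_vector x" "supported x S" "i < n" "x i \<noteq> 0"
    and y: "kernel_vector y" "supported y T" "j < n" "y j \<noteq> 0"
    and sep: "S \<inter> T = {}" "\<And>u v. u \<in> S \<Longrightarrow> v \<in> T \<Longrightarrow> (u, v) \<notin> E"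
  shows False
proof -
  define X where "X u v = x u * y v + y u * x v" for u v
  have "X i j = 0"
  proof (rule sap[of X])
    show "X u v = X v u" for u v by (simp add: X_def)
    show "Mv (\<lambda>k. X k v) u = 0" if "u < n" "v < n" for u v
    proof -
      have "Mv (\<lambda>k. X k v) u = Mv (\<lambda>k. y v * x k + x v * y k) u"
        by (intro app_cong) (simp add: X_def)
      also have "\<dots> = y v * Mv x u + x v * Mv y u" by (simp add: app_add app_scale)
      finally show ?thesis using x(1) y(1) that by (simp add: kernel_vector_def)
    qed
    show "X u v = 0" if "u = v \<or> (u, v) \<in> E" for u v
    proof -
      have "\<not> (u \<in> S \<and> v \<in> T)" "\<not> (v \<in> S \<and> u \<in> T)" using that sep symE by blast+
      then show ?thesis using x(2) y(2) by (auto simp: X_def supported_def)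
    qed
  qed (use x y in auto)
  moreover have "i \<in> S" "j \<in> T" using x y by (auto simp: supported_def)
  then have "y i = 0" using sep(1) y(2) by (auto simp: supported_def)
  ultimately show False using x(4) y(4) by (simp add: X_def)
qed

lemma closed_off_restr_inside:
  assumes K: "closed_off C K" and x: "\<And>i. i \<in> C \<Longrightarrow> i < n \<Longrightarrow> x i = 0" and i: "i \<in> K"
  shows "Mv (restr K x) i = Mv x i"
  unfolding app_def
proof (rule sum.cong[OF refl])
  fix j assume j: "j \<in> {..<n}"
  have "i < n" using K i by (auto simp: closed_off_def)
  show "entries M i j * restr K x j = entries M i j * x j"
  proof (cases "j \<in> K")
    case False
    have "x j = 0 \<or> entries M i j = 0"
    proof (cases "j \<in> C")
      case True
      then show ?thesis using x j by auto
    next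
      case False
      then have "(i, j) \<notin> E" using K i j \<open>j \<notin> K\<close> by (auto simp: closed_off_def)
      moreover have "i \<noteq> j" using i \<open>j \<notin> K\<close> by auto
      ultimately show ?thesis using non_edge \<open>i < n\<close> j by auto
    qed
    then show ?thesis using False by (auto simp: restr_def)
  qed (simp add: restr_def)
qed

lemma closed_off_outside:
  assumes K: "closed_off C K" and z: "supported z K" and i: "i < n" "i \<notin> K" "i \<notin> C"
  shows "Mv z i = 0"
  unfolding app_def
proof (rule sum.neutral, rule ballI)
  fix j assume j: "j \<in> {..<n}"
  show "entries M i j * z j = 0"
  proof (cases "j \<in> K")
    case True
    then have "(j, i) \<notin> E" using K i by (auto simp: closed_off_def)
    then have "(i, j) \<notin> E" using symE by blast
    moreover have "i \<noteq> j" using True i by auto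
    ultimately show ?thesis using non_edge i j by simp
  qed (use z in \<open>simp add: supported_def\<close>)
qed

section \<open>Perron-Frobenius theory for positive semidefinite principal submatrices\<close>

definition psd_on :: "nat set \<Rightarrow> bool"
  where "psd_on K \<longleftrightarrow> (\<forall>z. supported z K \<longrightarrow> form z z \<ge> 0)"

text \<open>Kernel vectors of the principal submatrix on \<open>K\<close>, extended by 0; outside
  \<open>K\<close> their image under \<open>M\<close> is unrestricted.\<close>

definition null_on :: "nat set \<Rightarrow> (nat \<Rightarrow> real) \<Rightarrow> bool"
  where "null_on K z \<longleftrightarrow> supported z K \<and> (\<forall>i\<in>K. Mv z i = 0)"

lemma null_on_form: "null_on K z \<Longrightarrow> supported x K \<Longrightarrow> form x z = 0"
  by (rule form_eq_0) (auto simp: null_on_def supported_def)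

text \<open>Off-diagonal entries are nonpositive, so absolute values do not increase the form. Hence
  |z| is a minimum of the form on \<open>K\<close> as well, and the first-order condition puts it in
  the kernel of the submatrix.\<close>

lemma null_on_abs:
  assumes K: "K \<subseteq> {..<n}" "psd_on K" and z: "null_on K z"
  shows "null_on K (\<lambda>i. \<bar>z i\<bar>)"
proof -
  define w where "w = (\<lambda>i. \<bar>z i\<bar>)"
  have w: "supported w K" using z by (auto simp: null_on_def supported_def w_def)
  have "form w w \<le> form z z"
    unfolding bilin_def dotp_def app_def sum_distrib_left
  proof (intro sum_mono)
    fix i j assume ij: "i \<in> {..<n}" "j \<in> {..<n}"
    show "w i * (entries M i j * w j) \<le> z i * (entries M i j * z j)"
    proof (cases "i = j")
      case False
      then have "entries M i j \<le> 0" using off_diagonal_nonpos ij by auto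
      then have "entries M i j * (\<bar>z i\<bar> * \<bar>z j\<bar>) \<le> entries M i j * (z i * z j)"
        by (intro mult_left_mono_neg) (simp_all add: abs_mult[symmetric])
      then show ?thesis by (simp add: w_def mult_ac)
    qed (simp add: w_def abs_mult_self_eq mult_ac)
  qed
  also have "form z z = 0" using z null_on_form[OF z] by (simp add: null_on_def)
  finally have w0: "form w w \<le> 0" .
  have "Mv w i = 0" if i: "i \<in> K" for i
  proof -
    define e where "e = (\<lambda>j. if j = i then 1 else 0 :: real)"
    have "form e w = 0"
    proof (rule quadratic_nonneg_linear_coeff_0)
      fix t
      have "supported (\<lambda>j. w j + t * e j) K" using w i by (auto simp: supported_def e_def)
      then have "form (\<lambda>j. w j + t * e j) (\<lambda>j. w j + t * e j) \<ge> 0" using K(2) by (simp add: psd_on_def)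
      then show "2 * t * form e w + t^2 * form e e \<ge> 0"
        using w0 form_commute[of w e] unfolding bilin_add_left bilin_add_right bilin_scale_left bilin_scale_right
        by (simp add: power2_eq_square algebra_simps)
    qed
    then show ?thesis using form_unit[of i w] i K(1) by (auto simp: e_def)
  qed
  then show ?thesis using w by (simp add: null_on_def w_def)
qed

text \<open>At a zero \<open>u\<close> of \<open>z\<close> adjacent to a nonzero, row
  \<open>u\<close> applied to |z| is a sum of nonpositive terms with a negative one.\<close>

lemma null_on_nowhere_zero:
  assumes K: "K \<subseteq> {..<n}" "psd_on K" "conn E K" and z: "null_on K z" and i: "i \<in> K" "z i = 0"
  shows "z = (\<lambda>_. 0)"
proof (rule ccontr)
  assume "z \<noteq> (\<lambda>_. 0)"
  then obtain l where l: "z l \<noteq> 0" by auto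
  define Z where "Z = {j \<in> K. z j = 0}"
  have "l \<in> K" using l z by (auto simp: null_on_def supported_def)
  then have "l \<in> K - Z" "i \<in> Z" using i l by (simp_all add: Z_def)
  then have Z: "Z \<noteq> {}" "Z \<noteq> K" by blast+
  have "Z \<subseteq> K" by (auto simp: Z_def)
  obtain u v where uv: "u \<in> Z" "v \<in> K" "v \<notin> Z" "(u, v) \<in> E"
    by (rule connE[OF K(3) \<open>Z \<subseteq> K\<close> Z])
  have "Mv (\<lambda>i. \<bar>z i\<bar>) u < 0"
    unfolding app_def
  proof (rule sum_negI)
    show "finite {..<n}" by simp
    show "entries M u j * \<bar>z j\<bar> \<le> 0" if "j \<in> {..<n}" for j
    proof (cases "j = u")
      case False
      then show ?thesis using off_diagonal_nonpos[of u j] that uv(1) K(1)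
        by (auto simp: Z_def mult_le_0_iff)
    qed (use uv in \<open>simp add: Z_def\<close>)
    show "v \<in> {..<n}" using uv K by auto
    show "entries M u v * \<bar>z v\<bar> < 0" using edge[OF uv(4)] uv(2,3) by (simp add: Z_def mult_neg_pos)
  qed
  moreover have "Mv (\<lambda>i. \<bar>z i\<bar>) u = 0" using null_on_abs[OF K(1,2) z] uv(1) by (simp add: null_on_def Z_def)
  ultimately show False by simp
qed

lemma null_on_proportional:
  assumes K: "K \<subseteq> {..<n}" "psd_on K" "conn E K" and z: "null_on K z" and x: "null_on K x" and i: "i \<in> K" "z i \<noteq> 0"
  shows "x = (\<lambda>j. (x i / z i) * z j)"
proof -
  define y where "y = (\<lambda>j. x j + (- (x i / z i)) * z j)"
  have "null_on K y"
    using z x unfolding null_on_def y_def app_add app_scale by (auto simp: supported_def)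
  moreover have "y i = 0" using i by (simp add: y_def)
  ultimately have y: "y = (\<lambda>_. 0)" using null_on_nowhere_zero[OF K _ i(1)] by simp
  have "x j = (x i / z i) * z j" for j using fun_cong[OF y, of j] by (simp add: y_def)
  then show ?thesis by (rule ext)
qed

text \<open>The connected components of the graph without \<open>C\<close> that lie in
  \<open>A\<close>.\<close>

definition parts :: "nat set \<Rightarrow> nat set \<Rightarrow> nat set set"
  where "parts C A = {K. K \<subseteq> A \<and> conn E K \<and> closed_off C K}"

lemma parts_disjoint:
  assumes "K \<in> parts C A" "K' \<in> parts C A" "K \<noteq> K'"
  shows "K \<inter> K' = {}"
proof (rule ccontr)
  assume ne: "K \<inter> K' \<noteq> {}"
  have sub: "K1 \<subseteq> K2" if K12: "K1 \<in> parts C A" "K2 \<in> parts C A" "K1 \<inter> K2 \<noteq> {}" for K1 K2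
  proof (rule ccontr)
    assume "\<not> K1 \<subseteq> K2"
    then have *: "K1 \<inter> K2 \<noteq> K1" "K1 \<inter> K2 \<subseteq> K1" by auto
    have "conn E K1" using K12 by (simp add: parts_def)
    then obtain u v where uv: "u \<in> K1 \<inter> K2" "v \<in> K1" "v \<notin> K1 \<inter> K2" "(u, v) \<in> E"
      by (rule connE[OF _ *(2) K12(3) *(1)])
    have "v < n" "v \<notin> C" using uv(2) K12(1) by (auto simp: parts_def closed_off_def)
    then have "v \<in> K2" using uv K12(2) by (auto simp: parts_def closed_off_def)
    then show False using uv by simp
  qed
  have "K' \<inter> K \<noteq> {}" using ne by auto
  then have "K \<subseteq> K'" "K' \<subseteq> K" using sub[OF assms(1,2) ne] sub[OF assms(2,1)] by auto
  then show False using assms(3) by simp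
qed

lemma parts_non_adjacent:
  assumes "K \<in> parts C A" "K' \<in> parts C A" "K \<noteq> K'" "u \<in> K" "v \<in> K'"
  shows "(u, v) \<notin> E"
proof
  assume "(u, v) \<in> E"
  moreover have "v < n" "v \<notin> C" using assms(2,5) by (auto simp: parts_def closed_off_def)
  ultimately have "v \<in> K" using assms(1,4) by (auto simp: parts_def closed_off_def)
  then show False using parts_disjoint[OF assms(1-3)] assms(5) by auto
qed

lemma parts_cover:
  assumes A: "closed_off C A"
  shows "A = \<Union>(parts C A)"
proof
  show "\<Union>(parts C A) \<subseteq> A" by (auto simp: parts_def)
  show "A \<subseteq> \<Union>(parts C A)"
  proof (rule ccontr)
    assume "\<not> ?thesis"
    define R where "R = A - \<Union>(parts C A)"
    have "R \<noteq> {}" using \<open>\<not> A \<subseteq> _\<close> by (auto simp: R_def)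
    have "A \<subseteq> {..<n}" using A by (auto simp: closed_off_def)
    then have "finite R" using finite_subset[of R "{..<n}"] by (auto simp: R_def)
    from connected_component_exists[OF this \<open>R \<noteq> {}\<close>] obtain K where
      K: "K \<subseteq> R" "conn E K" "\<And>x y. x \<in> K \<Longrightarrow> y \<in> R \<Longrightarrow> (x, y) \<in> E \<Longrightarrow> y \<in> K" by metis
    have "y \<in> K" if x: "x \<in> K" and y: "y < n" "y \<notin> C" "(x, y) \<in> E" for x y
    proof -
      have xA: "x \<in> A" "x \<notin> \<Union>(parts C A)" using x K(1) by (auto simp: R_def)
      then have "y \<in> A" using A y by (auto simp: closed_off_def)
      moreover have "y \<notin> K'" if K': "K' \<in> parts C A" for K'
      proof
        assume "y \<in> K'"
        moreover have "x < n" "x \<notin> C" using xA A by (auto simp: closed_off_def)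
        ultimately have "x \<in> K'" using K' symE[OF y(3)] by (auto simp: parts_def closed_off_def)
        then show False using xA K' by auto
      qed
      ultimately have "y \<in> R" by (auto simp: R_def)
      then show ?thesis using K(3) x y by blast
    qed
    moreover have "K \<subseteq> A" "K \<subseteq> {..<n} - C" using K(1) A by (auto simp: R_def closed_off_def)
    ultimately have "K \<in> parts C A" using K(2) by (auto simp: parts_def closed_off_def)
    then show False using K conn_nonempty[OF K(2)] by (auto simp: R_def)
  qed
qed

text \<open>The coefficients make the image vanish at \<open>r\<close>; it also vanishes on
  \<open>K\<close> and on the other part, so the combination is isotropic. It is orthogonal to a
  negative vector p + u e_r, and the single negative eigenvalue then forces it into the kernel, also
  at the rest of \<open>C\<close>.\<close>

lemma two_null_parts_kernel_vector:
  assumes K: "K \<in> parts C A" "K' \<in> parts C A" "K \<noteq> K'" and r: "r < n" "r \<in> C"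
    and p: "null_on K p" "null_on K' p'" "Mv p r < 0" "Mv p' r < 0"
  shows "kernel_vector (\<lambda>i. Mv p' r * p i + (- Mv p r) * p' i)"
proof -
  define x where "x = (\<lambda>i. Mv p' r * p i + (- Mv p r) * p' i)"
  have Mx: "Mv x i = Mv p' r * Mv p i + (- Mv p r) * Mv p' i" for i
    unfolding x_def app_add app_scale by simp
  have co: "closed_off C K" "closed_off C K'" using K by (auto simp: parts_def)
  have disj: "K \<inter> K' = {}" by (rule parts_disjoint[OF K])
  have sub: "i < n \<and> i \<notin> C" if "i \<in> K \<or> i \<in> K'" for i using co that by (auto simp: closed_off_def)
  have MxKK: "Mv x i = 0" if i: "i \<in> K \<or> i \<in> K'" for i
  proof -
    have "Mv p i = 0" using closed_off_outside[OF co(1), of p i] p(1) sub[OF i]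
      by (cases "i \<in> K") (auto simp: null_on_def)
    moreover have "Mv p' i = 0" using closed_off_outside[OF co(2), of p' i] p(2) sub[OF i]
      by (cases "i \<in> K'") (auto simp: null_on_def)
    ultimately show ?thesis by (simp add: Mx)
  qed
  have xz: "x i = 0" if "i \<notin> K \<and> i \<notin> K'" for i using p that by (simp add: x_def null_on_def supported_def)
  have xx: "form x x = 0" by (rule form_eq_0) (use MxKK xz in blast)
  \<comment> \<open>This choice bounds u times the diagonal entry by - \<open>Mv p r\<close>, so the
    form at \<open>y\<close> is at most u times \<open>Mv p r\<close> and hence negative.\<close>
  define u where "u = - Mv p r / (\<bar>entries M r r\<bar> + 1)"
  have u: "u > 0" using p(3) unfolding u_def by (intro divide_pos_pos) auto
  define e where "e = (\<lambda>j. if j = r then 1 else 0 :: real)"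
  define y where "y = (\<lambda>j. p j + u * e j)"
  have ee: "form e e = entries M r r"
  proof -
    have "form e e = Mv e r" unfolding e_def by (rule form_unit[OF r(1)])
    also have "\<dots> = (\<Sum>j<n. if j = r then entries M r j else 0)" unfolding app_def e_def by (intro sum.cong) auto
    finally show ?thesis using r(1) by simp
  qed
  have "form y y = form p p + 2 * u * form e p + u^2 * form e e"
    using form_commute[of p e] unfolding y_def bilin_add_left bilin_add_right bilin_scale_left bilin_scale_right
    by (simp add: power2_eq_square algebra_simps)
  also have "form p p = 0" using null_on_form[OF p(1)] p(1) by (simp add: null_on_def)
  also have "form e p = Mv p r" unfolding e_def by (rule form_unit[OF r(1)])
  finally have "form y y = u * (2 * Mv p r + u * entries M r r)"
    by (simp add: ee power2_eq_square algebra_simps)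
  also have "\<dots> < 0"
  proof (rule mult_pos_neg[OF u])
    have "u * entries M r r \<le> u * (\<bar>entries M r r\<bar> + 1)" using u by (intro mult_left_mono) auto
    also have "\<dots> = - Mv p r" by (simp add: u_def)
    finally show "2 * Mv p r + u * entries M r r < 0" using p(3) by simp
  qed
  finally have yy: "form y y < 0" .
  have "form y x = form p x + u * form e x"
    unfolding y_def bilin_add_left bilin_scale_left by simp
  also have "form e x = Mv x r" unfolding e_def by (rule form_unit[OF r(1)])
  also have "Mv x r = 0" by (simp add: Mx)
  also have "form p x = 0"
  proof (rule form_eq_0)
    show "p i = 0 \<or> Mv x i = 0" for i using MxKK[of i] p(1) by (auto simp: null_on_def supported_def)
  qed
  finally have "form x y = 0" using form_commute by simp
  then have "Mv x i = 0" if "i < n" for i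
    by (rule one_negative_isotropic_kernel[OF carrier symmetric one_neg yy _ xx that])
  then show ?thesis unfolding kernel_vector_def x_def by blast
qed

end

text \<open>What is used of a tree closure: \<open>level\<close> is the depth in the tree, and a
  connected set has a unique topmost vertex, which is the one to delete when descending.\<close>

locale levelled_cdv_matrix = cdv_matrix +
  fixes r :: nat and level :: "nat \<Rightarrow> nat" and k :: nat
  assumes root: "r < n" "\<And>i. i < n \<Longrightarrow> i \<noteq> r \<Longrightarrow> (r, i) \<in> E"
    and level: "\<And>i. i < n \<Longrightarrow> level i < k" "\<And>i. i < n \<Longrightarrow> i \<noteq> r \<Longrightarrow> 1 \<le> level i"
    and unique_min: "\<And>K. K \<subseteq> {..<n} \<Longrightarrow> conn E K \<Longrightarrow> \<exists>c\<in>K. \<forall>y\<in>K - {c}. level c < level y"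
begin

lemma null_part_root:
  assumes K: "K \<in> parts C A" "r \<in> C" and p: "null_on K p" "\<And>i. i \<in> K \<Longrightarrow> 0 < p i"
  shows "Mv p r < 0"
  unfolding app_def
proof -
  have sub: "K \<subseteq> {..<n} - C" using K by (auto simp: parts_def closed_off_def)
  obtain v where v: "v \<in> K" using K(1) conn_nonempty[of E K] by (auto simp: parts_def)
  have neg: "entries M r j < 0" if "j \<in> K" for j
    using that sub K(2) by (intro edge root(2)) auto
  show "(\<Sum>j<n. entries M r j * p j) < 0"
  proof (rule sum_negI)
    show "entries M r j * p j \<le> 0" if "j \<in> {..<n}" for j
      using neg[of j] p(2)[of j] p(1) by (cases "j \<in> K") (auto simp: null_on_def supported_def mult_le_0_iff)
    show "entries M r v * p v < 0" using neg[OF v] p(2)[OF v] by (simp add: mult_neg_pos)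
  qed (use v sub in auto)
qed

lemma positive_null_vector:
  assumes K: "K \<in> parts C A" "psd_on K" and z: "null_on K z" "z \<noteq> (\<lambda>_. 0)"
  shows "null_on K (\<lambda>i. \<bar>z i\<bar>)" "\<And>i. i \<in> K \<Longrightarrow> 0 < \<bar>z i\<bar>"
proof -
  have sub: "K \<subseteq> {..<n}" "conn E K" using K by (auto simp: parts_def closed_off_def)
  show "null_on K (\<lambda>i. \<bar>z i\<bar>)" by (rule null_on_abs[OF sub(1) K(2) z(1)])
  show "0 < \<bar>z i\<bar>" if "i \<in> K" for i
    using null_on_nowhere_zero[OF sub(1) K(2) sub(2) z(1) that] z(2) by auto
qed

lemma restr_null_on:
  assumes "K \<in> parts C A" "kernel_vector x" "\<And>i. i \<in> C \<Longrightarrow> i < n \<Longrightarrow> x i = 0"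
  shows "null_on K (restr K x)"
proof -
  have K: "closed_off C K" using assms(1) by (simp add: parts_def)
  have "Mv (restr K x) i = 0" if "i \<in> K" for i
    using closed_off_restr_inside[OF K assms(3) that] assms(2) that K
    by (auto simp: kernel_vector_def closed_off_def)
  then show ?thesis by (simp add: null_on_def supported_restr)
qed

text \<open>Different parts are orthogonal for the form, so it is semidefinite on \<open>K'\<close>.
  A nonzero \<open>z\<close> would make |z| isotropic and orthogonal to \<open>v\<close>, hence a
  kernel vector of \<open>M\<close>, but its image at the root is negative.\<close>

lemma separated_from_negative_part:
  assumes K: "K \<in> parts C A" "K' \<in> parts C A" "K \<noteq> K'" and C: "r \<in> C"
    and v: "supported v K" "form v v < 0" and z: "null_on K' z"
  shows "z = (\<lambda>_. 0)"
proof (rule ccontr)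
  assume nz: "z \<noteq> (\<lambda>_. 0)"
  have co: "closed_off C K" "closed_off C K'" using K by (auto simp: parts_def)
  have orth: "form u v = 0" if "supported u K'" for u
  proof (rule form_eq_0)
    fix i assume i: "i < n"
    show "u i = 0 \<or> Mv v i = 0"
    proof (cases "i \<in> K'")
      case True
      then have "i \<notin> K" "i \<notin> C" using parts_disjoint[OF K] co(2) by (auto simp: closed_off_def)
      then show ?thesis using closed_off_outside[OF co(1) v(1) i] by simp
    qed (use that in \<open>simp add: supported_def\<close>)
  qed
  have "psd_on K'"
    unfolding psd_on_def using one_negative_orthogonal_nonneg[OF carrier symmetric one_neg v(2)] orth by blast
  note p = positive_null_vector[OF K(2) this z nz]
  have sup: "supported (\<lambda>i. \<bar>z i\<bar>) K'" using p(1) by (simp add: null_on_def)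
  have "Mv (\<lambda>i. \<bar>z i\<bar>) r = 0"
    by (rule one_negative_isotropic_kernel[OF carrier symmetric one_neg v(2) orth[OF sup] null_on_form[OF p(1) sup] root(1)])
  then show False using null_part_root[OF K(2) C p] by simp
qed

text \<open>Such an \<open>x\<close> would be a nonzero multiple of the positive null vector |x|,
  whose image at the root is negative.\<close>

lemma null_vector_on_single_part:
  assumes K: "K \<in> parts C A" "psd_on K" "r \<in> C" and x: "kernel_vector x" "null_on K x"
  shows "x = (\<lambda>_. 0)"
proof (rule ccontr)
  assume nz: "x \<noteq> (\<lambda>_. 0)"
  have sub: "K \<subseteq> {..<n}" "conn E K" using K by (auto simp: parts_def closed_off_def)
  note p = positive_null_vector[OF K(1,2) x(2) nz]
  obtain i where i: "i \<in> K" using conn_nonempty[OF sub(2)] by blast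
  have "\<bar>x i\<bar> \<noteq> 0" using p(2)[OF i] by simp
  from null_on_proportional[OF sub(1) K(2) sub(2) p(1) x(2) i this]
  have *: "x = (\<lambda>j. (x i / \<bar>x i\<bar>) * \<bar>x j\<bar>)" .
  have "Mv x r = (x i / \<bar>x i\<bar>) * Mv (\<lambda>j. \<bar>x j\<bar>) r"
    by (subst *) (simp only: app_scale)
  moreover have "Mv x r = 0" using x(1) root(1) by (simp add: kernel_vector_def)
  ultimately show False using null_part_root[OF K(1,3) p] p(2)[OF i] by auto
qed

text \<open>Descent with the invariant that kernel vectors vanishing on \<open>C\<close> live in
  \<open>A\<close> and that \<open>A\<close> has depth at least |C|. As depths are below
  \<open>k\<close>, a nonempty \<open>A\<close> leaves room for one more zero than |C|, which every
  case below relies on, except when no part is singular.\<close>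

lemma no_large_kernel:
  assumes dim: "kernel_dim M > k"
    and "finite C" "C \<subseteq> {..<n}" "r \<in> C" "card C \<le> k" "closed_off C A"
    and "\<And>x. kernel_vector x \<Longrightarrow> (\<And>i. i \<in> C \<Longrightarrow> x i = 0) \<Longrightarrow> (\<And>i. i < n \<Longrightarrow> i \<notin> A \<Longrightarrow> x i = 0)"
    and "\<And>a. a \<in> A \<Longrightarrow> card C \<le> level a"
  shows False
  using assms(2-)
proof (induction "card A" arbitrary: C A rule: less_induct)
  case less
  note C = less.prems(1-4) and A = less.prems(5) and supp = less.prems(6) and lev = less.prems(7)
  have vanish: "\<exists>x. (\<exists>i<n. x i \<noteq> 0) \<and> kernel_vector x \<and> (\<forall>z\<in>Z. x z = 0)" if "finite Z" "card Z \<le> k" for Z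
    using kernel_vector_vanishing_on[OF carrier symmetric that(1)] that(2) dim
    unfolding kernel_vector_def by simp
  have An: "A \<subseteq> {..<n}" "finite A" using A finite_subset[of A "{..<n}"] by (auto simp: closed_off_def)
  show ?case
  proof (cases "A = {}")
    case True
    obtain x where "\<exists>i<n. x i \<noteq> 0" "kernel_vector x" "\<forall>z\<in>C. x z = 0" using vanish[OF C(1,4)] by blast
    then show False using supp[of x] True by blast
  next
    case False
    then obtain a where a: "a \<in> A" by blast
    then have Ck: "card C + 1 \<le> k" using lev[OF a] level(1)[of a] An by auto
    have cover: "A = \<Union>(parts C A)" by (rule parts_cover[OF A])
    show False
    \<comment> \<open>A part that is not positive semidefinite carries all kernel vectors that
      vanish on \<open>C\<close>; the descent continues in it below its topmost vertex
      \<open>c\<close>.\<close>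
    proof (cases "\<exists>K\<in>parts C A. \<not> psd_on K")
      case True
      then obtain K v where K: "K \<in> parts C A" and v: "supported v K" "form v v < 0"
        unfolding psd_on_def by force
      have Ksub: "K \<subseteq> A" "conn E K" "closed_off C K" "K \<subseteq> {..<n}" using K An by (auto simp: parts_def)
      have suppK: "x i = 0" if x: "kernel_vector x" "\<And>i. i \<in> C \<Longrightarrow> x i = 0" and i: "i < n" "i \<notin> K" for x i
      proof (cases "i \<in> A")
        case True
        then obtain K' where K': "K' \<in> parts C A" "i \<in> K'" using cover by auto
        then have "K \<noteq> K'" using i by auto
        from separated_from_negative_part[OF K K'(1) this C(3) v restr_null_on[OF K'(1) x(1)]] x(2)
        have "restr K' x = (\<lambda>_. 0)" by blast
        then show ?thesis using K'(2) by (metis restr_def)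
      next
        case False
        then show ?thesis using supp[OF x] i by blast
      qed
      obtain c where c: "c \<in> K" "\<And>y. y \<in> K - {c} \<Longrightarrow> level c < level y"
        using unique_min[OF Ksub(4,2)] by blast
      have cC: "c \<notin> C" "c < n" using c(1) Ksub(3) by (auto simp: closed_off_def)
      then have card: "card (insert c C) = card C + 1" using C(1) by simp
      show False
      proof (rule less.hyps[of "K - {c}" "insert c C"])
        show "card (K - {c}) < card A" using c(1) Ksub(1) An(2) by (intro psubset_card_mono) auto
        show "finite (insert c C)" "insert c C \<subseteq> {..<n}" "r \<in> insert c C" using C cC by auto
        show "card (insert c C) \<le> k" using card Ck by simp
        show "closed_off (insert c C) (K - {c})" using Ksub(3) by (auto simp: closed_off_def)
        show "x i = 0" if x: "kernel_vector x" "\<And>i. i \<in> insert c C \<Longrightarrow> x i = 0" and i: "i < n" "i \<notin> K - {c}" for x i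
        proof (cases "i = c")
          case False
          then have "i \<notin> K" using i by auto
          then show ?thesis using suppK[OF x(1) _ i(1)] x(2) by blast
        qed (use x in auto)
        show "card (insert c C) \<le> level y" if "y \<in> K - {c}" for y
        proof -
          have "card C \<le> level c" using lev[of c] c(1) Ksub(1) by blast
          then show ?thesis using c(2)[OF that] card by simp
        qed
      qed
    next
      case psd: False
      \<comment> \<open>The singular parts: a kernel vector that vanishes on \<open>C\<close> can be
        nonzero only there.\<close>
      define Q where "Q = {K \<in> parts C A. \<exists>z. null_on K z \<and> z \<noteq> (\<lambda>_. 0)}"
      have Qparts: "K \<in> parts C A" "psd_on K" if "K \<in> Q" for K using that psd by (auto simp: Q_def)
      have "finite (parts C A)" using An(2) by (auto simp: parts_def intro: finite_subset[of _ "Pow A"])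
      then have finQ: "finite Q" by (simp add: Q_def)
      have "\<exists>p. null_on K p \<and> (\<forall>i\<in>K. 0 < p i)" if "K \<in> Q" for K
      proof -
        obtain z where "null_on K z" "z \<noteq> (\<lambda>_. 0)" using \<open>K \<in> Q\<close> by (auto simp: Q_def)
        from positive_null_vector[OF Qparts[OF \<open>K \<in> Q\<close>] this] show ?thesis by blast
      qed
      then obtain p where p: "\<And>K. K \<in> Q \<Longrightarrow> null_on K (p K)" "\<And>K i. K \<in> Q \<Longrightarrow> i \<in> K \<Longrightarrow> 0 < p K i"
        by metis
      have root_neg: "Mv (p K) r < 0" if "K \<in> Q" for K
        by (rule null_part_root[OF Qparts(1)[OF that] C(3)]) (use p that in auto)
      have zero_off_Q: "x i = 0" if x: "kernel_vector x" "\<And>i. i \<in> C \<Longrightarrow> x i = 0"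
          and Ki: "K \<in> parts C A" "i \<in> K" and K: "K \<notin> Q \<or> (\<exists>l\<in>K. x l = 0)" for x i K
      proof -
        have nul: "null_on K (restr K x)" using restr_null_on[OF Ki(1) x(1)] x(2) by blast
        have "restr K x = (\<lambda>_. 0)"
        proof (cases "K \<in> Q")
          case True
          then obtain l where l: "l \<in> K" "x l = 0" using K by blast
          show ?thesis
          proof (rule null_on_nowhere_zero[OF _ Qparts(2)[OF True] _ nul l(1)])
            show "K \<subseteq> {..<n}" "conn E K" using Ki An by (auto simp: parts_def)
            show "restr K x l = 0" using l by (simp add: restr_def)
          qed
        qed (use nul Ki in \<open>auto simp: Q_def\<close>)
        then show ?thesis using Ki(2) by (metis restr_def)
      qed
      show False
      proof (cases "card Q \<le> 3")
        case True
        show False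
        proof (cases "Q = {}")
          case True
          obtain x where x: "\<exists>i<n. x i \<noteq> 0" "kernel_vector x" "\<forall>z\<in>C. x z = 0" using vanish[OF C(1,4)] by blast
          have "x i = 0" if "i < n" for i
          proof (cases "i \<in> A")
            case True
            then obtain K where "K \<in> parts C A" "i \<in> K" using cover by auto
            then show ?thesis using zero_off_Q[OF x(2)] x(3) \<open>Q = {}\<close> by auto
          qed (use supp[OF x(2)] x(3) that in blast)
          then show False using x(1) by blast
        next
          case False
          then obtain K3 where K3: "K3 \<in> Q" by blast
          define rep where "rep K = (SOME i. i \<in> K)" for K :: "nat set"
          have rep: "rep K \<in> K" if "K \<in> Q" for K
          proof -
            have "K \<noteq> {}" using Qparts(1)[OF that] conn_nonempty[of E K] by (auto simp: parts_def)
            then show ?thesis unfolding rep_def by (rule some_in_eq[THEN iffD2])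
          qed
          \<comment> \<open>Dropping \<open>r\<close> from \<open>C\<close> saves one condition, so
            zeros in two further parts cost at most |C| + 1, which is at most \<open>k\<close>.
            Nonzero null vectors have no zeros, so one vertex per part suffices.\<close>
          define Z where "Z = (C - {r}) \<union> rep ` (Q - {K3})"
          have "card Z \<le> card (C - {r}) + card (rep ` (Q - {K3}))" unfolding Z_def by (rule card_Un_le)
          also have "card (rep ` (Q - {K3})) \<le> card (Q - {K3})" using finQ by (intro card_image_le) auto
          also have "card (Q - {K3}) \<le> 2" using True K3 finQ by simp
          also have "card (C - {r}) = card C - 1" using C by simp
          finally have "card Z \<le> card C - 1 + 2" by simp
          moreover have "card C > 0" using C by (auto simp: card_gt_0_iff)
          ultimately have "card Z \<le> k" using Ck by linarith
          moreover have "finite Z" using C finQ by (simp add: Z_def)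
          ultimately obtain x where x: "\<exists>i<n. x i \<noteq> 0" "kernel_vector x" "\<forall>z\<in>Z. x z = 0" using vanish by blast
          have co3: "closed_off C K3" using Qparts(1)[OF K3] by (simp add: parts_def)
          \<comment> \<open>The image of \<open>p K3\<close> vanishes outside \<open>C\<close>, and
            \<open>x\<close> vanishes on \<open>C\<close> except possibly at \<open>r\<close>; hence
            the pairing reduces to the term at \<open>r\<close> and yields the omitted zero.\<close>
          have "form x (p K3) = 0"
            unfolding form_commute[of x] by (rule form_eq_0) (use x(2) in \<open>auto simp: kernel_vector_def\<close>)
          moreover have "form x (p K3) = x r * Mv (p K3) r"
          proof -
            have "form x (p K3) = (\<Sum>i<n. if i = r then x r * Mv (p K3) r else 0)"
              unfolding bilin_def dotp_def
            proof (rule sum.cong[OF refl])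
              fix i assume i: "i \<in> {..<n}"
              show "x i * Mv (p K3) i = (if i = r then x r * Mv (p K3) r else 0)"
              proof (cases "i = r")
                case False
                consider "i \<in> K3" | "i \<in> C" | "i \<notin> K3" "i \<notin> C" by blast
                then have "x i = 0 \<or> Mv (p K3) i = 0"
                proof cases
                  case 1
                  then show ?thesis using p(1)[OF K3] by (auto simp: null_on_def)
                next
                  case 2
                  then show ?thesis using x(3) False by (auto simp: Z_def)
                next
                  case 3
                  then show ?thesis using closed_off_outside[OF co3 _ _ 3] p(1)[OF K3] i by (auto simp: null_on_def)
                qed
                then show ?thesis using False by auto
              qed simp
            qed
            then show ?thesis using root(1) by simp
          qed
          ultimately have "x r = 0" using root_neg[OF K3] by simp
          then have xC: "x i = 0" if "i \<in> C" for i using x(3) that by (cases "i = r") (auto simp: Z_def)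
          have off: "x i = 0" if "i < n" "i \<notin> K3" for i
          proof (cases "i \<in> A")
            case True
            then obtain K where K: "K \<in> parts C A" "i \<in> K" using cover by auto
            have "K \<notin> Q \<or> (\<exists>l\<in>K. x l = 0)"
            proof (cases "K \<in> Q")
              case True
              then have "rep K \<in> Z" using K(2) that(2) by (auto simp: Z_def)
              then show ?thesis using rep[OF True] x(3) by blast
            qed simp
            then show ?thesis using zero_off_Q[OF x(2) _ K] xC by blast
          qed (use supp[OF x(2)] xC that in blast)
          define y where "y = restr K3 x"
          have yx: "y i = x i" if "i < n" for i using off[OF that] by (simp add: y_def restr_def)
          have "Mv y i = Mv x i" for i by (rule app_cong) (rule yx)
          then have "kernel_vector y" using x(2) by (simp add: kernel_vector_def)
          moreover have "null_on K3 y" unfolding y_def using restr_null_on[OF Qparts(1)[OF K3] x(2)] xC by blast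
          ultimately have "y = (\<lambda>_. 0)" by (rule null_vector_on_single_part[OF Qparts[OF K3] C(3)])
          then show False using x(1) yx by metis
        qed
      next
        case False
        then obtain T where T: "T \<subseteq> Q" "card T = 4"
          using obtain_subset_with_card_n[of 4 Q] by (metis not_less_eq_eq eval_nat_numeral(2,3) semiring_norm(26-28))
        have "finite T" using T(2) card.infinite by fastforce
        then obtain Ks where Ks: "set Ks = T" "distinct Ks" using finite_distinct_list by blast
        then have "length Ks = 4" using T(2) distinct_card by metis
        define K where "K i = Ks ! i" for i
        have KQ: "K i \<in> Q" if "i < 4" for i using that T(1) Ks(1) \<open>length Ks = 4\<close> by (auto simp: K_def)
        have Kne: "K i \<noteq> K j" if "i < 4" "j < 4" "i \<noteq> j" for i j
          using that Ks(2) \<open>length Ks = 4\<close> by (simp add: K_def nth_eq_iff_index_eq)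
        have KP: "K i \<in> parts C A" if "i < 4" for i using Qparts(1)[OF KQ[OF that]] .
        define x where "x i j = (\<lambda>l. Mv (p (K j)) r * p (K i) l + (- Mv (p (K i)) r) * p (K j) l)" for i j
        have ker: "kernel_vector (x i j)" if "i < 4" "j < 4" "i \<noteq> j" for i j
          unfolding x_def using two_null_parts_kernel_vector[OF KP KP Kne root(1) C(3)] that
            p(1)[OF KQ] root_neg[OF KQ] by blast
        have sup: "supported (x i j) (K i \<union> K j)" if "i < 4" "j < 4" for i j
          using p(1)[OF KQ[OF that(1)]] p(1)[OF KQ[OF that(2)]] by (auto simp: x_def supported_def null_on_def)
        have nz: "\<exists>l<n. x i j l \<noteq> 0" if ij: "i < 4" "j < 4" "i \<noteq> j" for i j
        proof -
          obtain l where l: "l \<in> K i" using KP[OF ij(1)] conn_nonempty[of E "K i"] by (auto simp: parts_def)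
          then have "l \<notin> K j" "l < n" using parts_disjoint[OF KP KP Kne] that KP[OF that(1)]
            by (auto simp: parts_def closed_off_def)
          then have "x i j l = Mv (p (K j)) r * p (K i) l"
            using p(1)[OF KQ[OF that(2)]] by (simp add: x_def null_on_def supported_def)
          moreover have "\<dots> < 0" using root_neg[OF KQ[OF that(2)]] p(2)[OF KQ[OF that(1)] l] by (simp add: mult_neg_pos)
          ultimately have "x i j l < 0" by simp
          then show ?thesis using \<open>l < n\<close> by (intro exI[of _ l]) simp
        qed
        obtain l where l: "l < n" "x 0 1 l \<noteq> 0" using nz[of 0 1] by auto
        obtain m where m: "m < n" "x 2 3 m \<noteq> 0" using nz[of 2 3] by auto
        have k01: "kernel_vector (x 0 1)" "kernel_vector (x 2 3)" using ker[of 0 1] ker[of 2 3] by auto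
        have s01: "supported (x 0 1) (K 0 \<union> K 1)" "supported (x 2 3) (K 2 \<union> K 3)" using sup[of 0 1] sup[of 2 3] by auto
        have disj: "K i \<inter> K j = {}" if "i \<in> {0, 1}" "j \<in> {2, 3}" for i j
          by (rule parts_disjoint[OF KP KP Kne]) (use that in auto)
        have adj: "(u, w) \<notin> E" if "i \<in> {0, 1}" "j \<in> {2, 3}" "u \<in> K i" "w \<in> K j" for i j u w
          by (rule parts_non_adjacent[OF KP KP Kne that(3,4)]) (use that in auto)
        show False
        proof (rule no_nonadjacent_kernel_vectors[OF k01(1) s01(1) l k01(2) s01(2) m])
          show "(K 0 \<union> K 1) \<inter> (K 2 \<union> K 3) = {}" using disj by blast
          show "(u, w) \<notin> E" if "u \<in> K 0 \<union> K 1" "w \<in> K 2 \<union> K 3" for u w using that adj by blast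
        qed
      qed
    qed
  qed
qed

theorem kernel_dim_le_levels: "kernel_dim M \<le> k"
proof (rule ccontr)
  assume "\<not> ?thesis"
  then have dim: "kernel_dim M > k" by simp
  show False
  proof (rule no_large_kernel[OF dim, of "{r}" "{..<n} - {r}"])
    show "card {r} \<le> k" using level(1)[OF root(1)] by simp
    show "closed_off {r} ({..<n} - {r})" by (auto simp: closed_off_def)
    show "card {r} \<le> level a" if "a \<in> {..<n} - {r}" for a using level(2)[of a] that by simp
  qed (use root(1) in auto)
qed

end

section \<open>Closures of complete rooted trees\<close>

lemma pair_graph_arcs:
  assumes "pair_graph G"
  shows "finite (pverts G)" "sym (parcs G)" "irrefl (parcs G)" "parcs G \<subseteq> pverts G \<times> pverts G"
proof -
  interpret pair_graph G by (rule assms)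
  show "finite (pverts G)" by (rule pair_finite_verts)
  show "sym (parcs G)" using pair_sym_arcs by (simp add: symmetric_def)
  have "a \<noteq> b" if "(a, b) \<in> parcs G" for a b using pair_no_loops[OF that] by simp
  then show "irrefl (parcs G)" unfolding irrefl_def by blast
  show "parcs G \<subseteq> pverts G \<times> pverts G" 
    by (rule subsetI) (simp add: mem_Times_iff arc_fst_in_verts arc_snd_in_verts)
qed

lemma pair_graphI:
  assumes "finite (pverts G)" "sym (parcs G)" "irrefl (parcs G)" "parcs G \<subseteq> pverts G \<times> pverts G"
  shows "pair_graph G"
proof -
  have "finite (parcs G)" using assms(1,4) finite_subset by blast
  then show ?thesis using assms by unfold_locales (auto simp: symmetric_def irrefl_def mem_Times_iff)
qed

definition index_arcs :: "'a pair_pre_digraph \<Rightarrow> nat \<Rightarrow> (nat \<Rightarrow> 'a) \<Rightarrow> (nat \<times> nat) set"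
  where "index_arcs G n f = {(i, j). i < n \<and> j < n \<and> (f i, f j) \<in> parcs G}"

lemma cdv_matrix_of_graph:
  assumes G: "pair_graph G" and M: "colin_de_verdiere_matrix G n f M"
  shows "cdv_matrix n (index_arcs G n f) M"
proof -
  note GE = pair_graph_arcs[OF G]
  have carrier: "M \<in> carrier_mat n n" and symM: "M\<^sup>T = M"
    and neg: "\<And>i j. i < n \<Longrightarrow> j < n \<Longrightarrow> (f i, f j) \<in> parcs G \<Longrightarrow> M $$ (i, j) < 0"
    and zero: "\<And>i j. i < n \<Longrightarrow> j < n \<Longrightarrow> i \<noteq> j \<Longrightarrow> (f i, f j) \<notin> parcs G \<Longrightarrow> M $$ (i, j) = 0"
    and one: "one_negative_eigenvalue M" and sap: "strong_arnold_property G n f M"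
    using M by (auto simp: colin_de_verdiere_matrix_def one_negative_eigenvalue_def)
  show ?thesis
  proof
    show "sym (index_arcs G n f)" using GE(2) by (auto simp: index_arcs_def sym_def)
    show "irrefl (index_arcs G n f)" using GE(3) by (auto simp: index_arcs_def irrefl_def)
    show "index_arcs G n f \<subseteq> {..<n} \<times> {..<n}" by (auto simp: index_arcs_def)
    show "entries M i j < 0" if "(i, j) \<in> index_arcs G n f" for i j
      using neg that by (auto simp: index_arcs_def entries_def)
    show "entries M i j = 0" if "i < n" "j < n" "i \<noteq> j" "(i, j) \<notin> index_arcs G n f" for i j
      using zero that by (auto simp: index_arcs_def entries_def)
    fix X :: "nat \<Rightarrow> nat \<Rightarrow> real" and i j
    assume X: "\<And>i j. X i j = X j i" and MX: "\<And>i j. i < n \<Longrightarrow> j < n \<Longrightarrow> app n (entries M) (\<lambda>k. X k j) i = 0"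
      and pat: "\<And>i j. i = j \<or> (i, j) \<in> index_arcs G n f \<Longrightarrow> X i j = 0" and ij: "i < n" "j < n"
    define Y where "Y = mat n n (\<lambda>(i, j). X i j)"
    have "Y \<in> carrier_mat n n" by (simp add: Y_def)
    moreover have "Y\<^sup>T = Y" by (intro eq_matI) (auto simp: Y_def X)
    moreover have "M * Y = 0\<^sub>m n n"
    proof (rule eq_matI)
      fix u v assume "u < dim_row (0\<^sub>m n n :: real mat)" "v < dim_col (0\<^sub>m n n :: real mat)"
      then have uv: "u < n" "v < n" by auto
      then have "(M * Y) $$ (u, v) = app n (entries M) (\<lambda>k. X k v) u"
        using carrier by (simp add: Y_def scalar_prod_def app_def entries_def lessThan_atLeast0)
      then show "(M * Y) $$ (u, v) = 0\<^sub>m n n $$ (u, v)" using MX[OF uv] uv by simp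
    qed (use carrier in \<open>auto simp: Y_def\<close>)
    moreover have "\<forall>u<n. \<forall>v<n. u = v \<or> (f u, f v) \<in> parcs G \<longrightarrow> Y $$ (u, v) = 0"
      using pat by (auto simp: Y_def index_arcs_def)
    ultimately have "Y = 0\<^sub>m n n" using sap unfolding strong_arnold_property_def by blast
    then have "Y $$ (i, j) = 0" using ij by simp
    then show "X i j = 0" using ij by (simp add: Y_def)
  qed (use carrier symM one in auto)
qed

definition comparable :: "nat list \<Rightarrow> nat list \<Rightarrow> bool"
  where "comparable xs ys \<longleftrightarrow> xs \<noteq> ys \<and> (prefix xs ys \<or> prefix ys xs)"

text \<open>A vertex of the complete \<open>(d + 1)\<close>-ary tree with \<open>k\<close> levels is the code of the list of
  choices that leads to it from the root.\<close>

definition tree_closure :: "nat \<Rightarrow> nat \<Rightarrow> nat pair_pre_digraph"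
  where "tree_closure k d =
    (let V = {v. length (list_decode v) < k \<and> set (list_decode v) \<subseteq> {..d}}
     in \<lparr>pverts = V, parcs = {(u, v). u \<in> V \<and> v \<in> V \<and> comparable (list_decode u) (list_decode v)}\<rparr>)"

lemma tree_closure_verts:
  "v \<in> pverts (tree_closure k d) \<longleftrightarrow> length (list_decode v) < k \<and> set (list_decode v) \<subseteq> {..d}"
  by (simp add: tree_closure_def Let_def)

lemma tree_closure_arcs:
  "(u, v) \<in> parcs (tree_closure k d) \<longleftrightarrow> u \<in> pverts (tree_closure k d) \<and> v \<in> pverts (tree_closure k d) \<and>
    comparable (list_decode u) (list_decode v)"
  by (simp add: tree_closure_def Let_def)

lemma pair_graph_tree_closure: "pair_graph (tree_closure k d)"
proof (rule pair_graphI)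
  have "pverts (tree_closure k d) \<subseteq> list_encode ` {xs. set xs \<subseteq> {..d} \<and> length xs \<le> k}"
  proof
    fix v assume "v \<in> pverts (tree_closure k d)"
    then show "v \<in> list_encode ` {xs. set xs \<subseteq> {..d} \<and> length xs \<le> k}"
      by (intro image_eqI[of _ _ "list_decode v"]) (auto simp: tree_closure_verts)
  qed
  then show "finite (pverts (tree_closure k d))"
    by (rule finite_subset) (intro finite_imageI finite_lists_length_le finite_atMost)
  show "sym (parcs (tree_closure k d))" by (auto simp: sym_def tree_closure_arcs comparable_def)
  show "irrefl (parcs (tree_closure k d))" by (auto simp: irrefl_def tree_closure_arcs comparable_def)
  show "parcs (tree_closure k d) \<subseteq> pverts (tree_closure k d) \<times> pverts (tree_closure k d)"
    by (auto simp: tree_closure_arcs)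
qed

lemma colin_de_verdiere_tree_closure:
  assumes k: "k \<ge> 1"
  shows "colin_de_verdiere (tree_closure k d) \<le> k"
proof -
  define G where "G = tree_closure k d"
  have G: "pair_graph G" unfolding G_def by (rule pair_graph_tree_closure)
  have "c \<le> k" if "c \<in> colin_de_verdiere_coranks G" for c
  proof -
    define n where "n = card (pverts G)"
    obtain M f where c: "c = kernel_dim M" and f: "bij_betw f {..<n} (pverts G)"
      and M: "colin_de_verdiere_matrix G n f M"
      using \<open>c \<in> _\<close> unfolding colin_de_verdiere_coranks_def n_def by blast
    define E where "E = index_arcs G n f"
    define w where "w i = list_decode (f i)" for i
    interpret cdv_matrix n E M unfolding E_def by (rule cdv_matrix_of_graph[OF G M])
    have fV: "f i \<in> pverts G" if "i < n" for i using f that by (auto simp: bij_betw_def)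
    have w_inj: "w i \<noteq> w j" if "i < n" "j < n" "i \<noteq> j" for i j
      using f that unfolding w_def bij_betw_def inj_on_def by (metis lessThan_iff list_decode_inverse)
    have E_iff: "(i, j) \<in> E \<longleftrightarrow> i < n \<and> j < n \<and> comparable (w i) (w j)" for i j
      using fV by (auto simp: E_def index_arcs_def w_def G_def tree_closure_arcs)
    have "list_encode [] \<in> pverts G" using k by (simp add: G_def tree_closure_verts)
    then obtain r where r: "r < n" "f r = list_encode []" using f unfolding bij_betw_def by (metis imageE lessThan_iff)
    have wr: "w r = []" using r by (simp add: w_def del: list_encode.simps)
    interpret levelled_cdv_matrix n E M r "\<lambda>i. length (w i)" k
    proof
      show "r < n" by (rule r)
      show "(r, i) \<in> E" if "i < n" "i \<noteq> r" for i
        using that r(1) wr w_inj[of i r] by (auto simp: E_iff comparable_def)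
      show "length (w i) < k" if "i < n" for i
        using fV[OF that] by (simp add: G_def tree_closure_verts w_def)
      show "1 \<le> length (w i)" if "i < n" "i \<noteq> r" for i
        using w_inj[of i r] that r(1) wr by (cases "w i") auto
      fix K assume K: "K \<subseteq> {..<n}" "conn E K"
      then obtain c where c: "c \<in> K" "\<And>i. i \<in> K \<Longrightarrow> length (w c) \<le> length (w i)"
        using ex_has_least_nat[of "\<lambda>i. i \<in> K" _ "\<lambda>i. length (w i)"] conn_nonempty[OF K(2)] by blast
      \<comment> \<open>A shortest list in \<open>K\<close> is a prefix of all others: this property
        passes along every arc, since comparable lists share their prefixes and none in
        \<open>K\<close> is shorter than \<open>w c\<close>.\<close>
      define X where "X = {i \<in> K. prefix (w c) (w i)}"
      have "X = K"
      proof (rule ccontr)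
        assume ne: "X \<noteq> K"
        have "X \<subseteq> K" "X \<noteq> {}" using c(1) by (auto simp: X_def)
        then obtain i j where ij: "i \<in> X" "j \<in> K" "j \<notin> X" "(i, j) \<in> E" using ne by (rule connE[OF K(2)])
        have ci: "prefix (w c) (w i)" using ij(1) by (simp add: X_def)
        have "prefix (w i) (w j) \<or> prefix (w j) (w i)" using ij(4) by (simp add: E_iff comparable_def)
        then have "prefix (w c) (w j)"
        proof
          assume "prefix (w i) (w j)"
          then show ?thesis using ci prefix_order.trans by blast
        next
          assume "prefix (w j) (w i)"
          then show ?thesis using ci c(2)[OF ij(2)] prefix_length_prefix by blast
        qed
        then show False using ij by (simp add: X_def)
      qed
      have "length (w c) < length (w y)" if "y \<in> K - {c}" for y
      proof -
        have "prefix (w c) (w y)" using that \<open>X = K\<close> unfolding X_def by auto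
        moreover have "w c \<noteq> w y" using w_inj[of c y] that K(1) c(1) by auto
        ultimately show ?thesis by (intro prefix_length_less) (simp add: strict_prefix_def)
      qed
      then show "\<exists>c\<in>K. \<forall>y\<in>K - {c}. length (w c) < length (w y)" using c(1) by blast
    qed
    show ?thesis unfolding c by (rule kernel_dim_le_levels)
  qed
  then show ?thesis unfolding colin_de_verdiere_def G_def[symmetric]
  proof (cases "colin_de_verdiere_coranks G = {}")
    case True
    then show "Sup (colin_de_verdiere_coranks G) \<le> k" by (simp add: Sup_nat_def)
  qed (rule cSup_least)
qed

text \<open>Walking down from the root, at depth \<open>j\<close> the current subtree avoids
  \<open>j\<close> colours. If all d + 1 child subtrees contained the colour of the current vertex,
  it would have d + 1 neighbours of its own colour, being adjacent to all its descendants. At depth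
  \<open>m\<close> no colour is left.\<close>

lemma tree_closure_not_defective_colourable:
  "\<not> defective_colourable (tree_closure (Suc m) d) m d"
proof
  define G where "G = tree_closure (Suc m) d"
  assume "defective_colourable (tree_closure (Suc m) d) m d"
  then obtain c where c: "\<And>v. v \<in> pverts G \<Longrightarrow> c v < m"
    "\<And>v. v \<in> pverts G \<Longrightarrow> card {w. (v, w) \<in> parcs G \<and> c w = c v} \<le> d"
    by (auto simp: defective_colourable_def has_defect_def G_def)
  have G: "pair_graph G" unfolding G_def by (rule pair_graph_tree_closure)
  define node where "node xs \<longleftrightarrow> length xs < Suc m \<and> set xs \<subseteq> {..d}" for xs :: "nat list"
  have enc: "list_encode xs \<in> pverts G" if "node xs" for xs
    using that by (simp add: G_def tree_closure_verts node_def)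
  have "j \<le> m \<Longrightarrow> \<exists>xs S. length xs = j \<and> node xs \<and> S \<subseteq> {..<m} \<and> card S = j \<and>
    (\<forall>ys. node ys \<longrightarrow> prefix xs ys \<longrightarrow> c (list_encode ys) \<notin> S)" for j
  proof (induction j)
    case 0
    show ?case by (intro exI[of _ "[]"] exI[of _ "{}"]) (auto simp: node_def)
  next
    case (Suc j)
    then obtain xs S where xs: "length xs = j" "node xs" "S \<subseteq> {..<m}" "card S = j"
      "\<And>ys. node ys \<Longrightarrow> prefix xs ys \<Longrightarrow> c (list_encode ys) \<notin> S" by auto
    define a where "a = c (list_encode xs)"
    have a: "a \<notin> S" "a < m" using xs(5)[OF xs(2)] c(1)[OF enc[OF xs(2)]] by (auto simp: a_def)
    have "\<exists>i\<le>d. \<forall>ys. node ys \<longrightarrow> prefix (xs @ [i]) ys \<longrightarrow> c (list_encode ys) \<noteq> a"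
    proof (rule ccontr)
      assume "\<not> ?thesis"
      then have "\<forall>i. i \<le> d \<longrightarrow> (\<exists>ys. node ys \<and> prefix (xs @ [i]) ys \<and> c (list_encode ys) = a)" by blast
      then obtain y where y: "\<And>i. i \<le> d \<Longrightarrow> node (y i)" "\<And>i. i \<le> d \<Longrightarrow> prefix (xs @ [i]) (y i)"
        "\<And>i. i \<le> d \<Longrightarrow> c (list_encode (y i)) = a" by metis
      have nth: "y i ! j = i" "prefix xs (y i)" "xs \<noteq> y i" if "i \<le> d" for i
        using y(2)[OF that] xs(1) by (auto simp: prefix_def nth_append)
      have inj: "inj_on (\<lambda>i. list_encode (y i)) {..d}"
      proof (rule inj_onI)
        fix i i' assume "i \<in> {..d}" "i' \<in> {..d}" and eq: "list_encode (y i) = list_encode (y i')"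
        then have "y i = y i'" using list_encode_eq by blast
        moreover have "i \<le> d" "i' \<le> d" using \<open>i \<in> {..d}\<close> \<open>i' \<in> {..d}\<close> by auto
        ultimately show "i = i'" using nth(1)[of i] nth(1)[of i'] by metis
      qed
      define N where "N = {w. (list_encode xs, w) \<in> parcs G \<and> c w = c (list_encode xs)}"
      have "list_encode (y i) \<in> N" if "i \<le> d" for i
      proof -
        have "(list_encode xs, list_encode (y i)) \<in> parcs G"
          unfolding G_def tree_closure_arcs
          using enc[OF xs(2)] enc[OF y(1)[OF that]] nth(2,3)[OF that] by (simp add: G_def comparable_def)
        then show ?thesis using y(3)[OF that] by (simp add: N_def a_def)
      qed
      then have "(\<lambda>i. list_encode (y i)) ` {..d} \<subseteq> N" by auto
      moreover have "finite N"
      proof (rule finite_subset)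
        show "N \<subseteq> pverts G" using pair_graph_arcs(4)[OF G] by (auto simp: N_def)
      qed (rule pair_graph_arcs(1)[OF G])
      ultimately have "card ((\<lambda>i. list_encode (y i)) ` {..d}) \<le> card N" by (intro card_mono)
      then have "d + 1 \<le> card N" using inj by (simp add: card_image)
      then show False using c(2)[OF enc[OF xs(2)]] by (simp add: N_def)
    qed
    then obtain i where i: "i \<le> d" "\<And>ys. node ys \<Longrightarrow> prefix (xs @ [i]) ys \<Longrightarrow> c (list_encode ys) \<noteq> a" by blast
    have "finite S" using xs(3) finite_subset by blast
    then have "card (insert a S) = Suc j" using a xs(4) by simp
    moreover have "node (xs @ [i])" using xs(1,2) i(1) Suc.prems by (auto simp: node_def)
    moreover have "c (list_encode ys) \<notin> insert a S" if ys: "node ys" "prefix (xs @ [i]) ys" for ys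
    proof -
      have "prefix xs ys" using ys(2) prefix_order.trans by (meson append_prefixD)
      then show ?thesis using xs(5)[OF ys(1)] i(2)[OF ys] by simp
    qed
    ultimately show ?case using xs(1,3) a by (intro exI[of _ "xs @ [i]"] exI[of _ "insert a S"]) auto
  qed
  from this[of m] obtain xs S where xs: "node xs" "S \<subseteq> {..<m}" "card S = m"
    "\<And>ys. node ys \<Longrightarrow> prefix xs ys \<Longrightarrow> c (list_encode ys) \<notin> S" by auto
  have "S = {..<m}" using xs(2,3) by (intro card_subset_eq) auto
  then show False using xs(4)[OF xs(1)] c(1)[OF enc[OF xs(1)]] by simp
qed

section \<open>Perturbation\<close>

text \<open>Polynomials in the parameter and the coordinates are tame.\<close>

definition tame :: "'v set \<Rightarrow> (real \<Rightarrow> ('v \<Rightarrow> real) \<Rightarrow> real) \<Rightarrow> bool"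
  where "tame I q \<longleftrightarrow> (\<forall>R. \<exists>K\<ge>0. \<forall>s x y D. 0 \<le> s \<longrightarrow> s \<le> 1 \<longrightarrow>
    (\<forall>v\<in>I. \<bar>x v\<bar> \<le> R \<and> \<bar>y v\<bar> \<le> R \<and> \<bar>x v - y v\<bar> \<le> D) \<longrightarrow> 0 \<le> D \<longrightarrow>
    \<bar>q s x\<bar> \<le> K \<and> \<bar>q s x - q s y\<bar> \<le> K * D)"

lemma tameE:
  assumes "tame I q"
  obtains K where "K \<ge> 0" "\<And>s x y D. 0 \<le> s \<Longrightarrow> s \<le> 1 \<Longrightarrow>
    (\<And>v. v \<in> I \<Longrightarrow> \<bar>x v\<bar> \<le> R \<and> \<bar>y v\<bar> \<le> R \<and> \<bar>x v - y v\<bar> \<le> D) \<Longrightarrow> 0 \<le> D \<Longrightarrow>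
    \<bar>q s x\<bar> \<le> K \<and> \<bar>q s x - q s y\<bar> \<le> K * D"
proof -
  obtain K where K: "K \<ge> 0" "\<forall>s x y D. 0 \<le> s \<longrightarrow> s \<le> 1 \<longrightarrow>
    (\<forall>v\<in>I. \<bar>x v\<bar> \<le> R \<and> \<bar>y v\<bar> \<le> R \<and> \<bar>x v - y v\<bar> \<le> D) \<longrightarrow> 0 \<le> D \<longrightarrow>
    \<bar>q s x\<bar> \<le> K \<and> \<bar>q s x - q s y\<bar> \<le> K * D"
    using assms[unfolded tame_def, rule_format, of R] by metis
  show ?thesis by (rule that[OF K(1)]) (use K(2)[rule_format] in blast)
qed

lemma tameI:
  assumes "\<And>R. \<exists>K\<ge>0. \<forall>s x y D. 0 \<le> s \<longrightarrow> s \<le> 1 \<longrightarrow>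
    (\<forall>v\<in>I. \<bar>x v\<bar> \<le> R \<and> \<bar>y v\<bar> \<le> R \<and> \<bar>x v - y v\<bar> \<le> D) \<longrightarrow> 0 \<le> D \<longrightarrow>
    \<bar>q s x\<bar> \<le> K \<and> \<bar>q s x - q s y\<bar> \<le> K * D"
  shows "tame I q"
  unfolding tame_def by (rule allI) (rule assms)

lemma tame_const: "tame I (\<lambda>s x. c)"
  by (rule tameI) (intro exI[of _ "\<bar>c\<bar>"], simp)

lemma tame_param: "tame I (\<lambda>s x. s)"
  by (rule tameI) (intro exI[of _ 1], simp)

lemma tame_coord: "v \<in> I \<Longrightarrow> tame I (\<lambda>s x. x v)"
proof (rule tameI)
  fix R :: real
  assume v: "v \<in> I"
  show "\<exists>K\<ge>0. \<forall>s x y D. 0 \<le> s \<longrightarrow> s \<le> 1 \<longrightarrow>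
    (\<forall>v\<in>I. \<bar>x v\<bar> \<le> R \<and> \<bar>y v\<bar> \<le> R \<and> \<bar>x v - y v\<bar> \<le> D) \<longrightarrow> 0 \<le> D \<longrightarrow>
    \<bar>x v\<bar> \<le> K \<and> \<bar>x v - y v\<bar> \<le> K * D"
  proof (intro exI[of _ "\<bar>R\<bar> + 1"] conjI allI impI)
    fix s D :: real and x y :: "'a \<Rightarrow> real"
    assume *: "\<forall>v\<in>I. \<bar>x v\<bar> \<le> R \<and> \<bar>y v\<bar> \<le> R \<and> \<bar>x v - y v\<bar> \<le> D" and "0 \<le> D"
    show "\<bar>x v\<bar> \<le> \<bar>R\<bar> + 1" using * v by force
    have "\<bar>x v - y v\<bar> \<le> 1 * D" using * v by auto
    also have "\<dots> \<le> (\<bar>R\<bar> + 1) * D" using \<open>0 \<le> D\<close> by (intro mult_right_mono) auto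
    finally show "\<bar>x v - y v\<bar> \<le> (\<bar>R\<bar> + 1) * D" .
  qed simp
qed

lemma tame_add:
  assumes "tame I p" "tame I q"
  shows "tame I (\<lambda>s x. p s x + q s x)"
proof (rule tameI)
  fix R
  obtain K where K: "K \<ge> 0" "\<And>s x y D. 0 \<le> s \<Longrightarrow> s \<le> 1 \<Longrightarrow>
    (\<And>v. v \<in> I \<Longrightarrow> \<bar>x v\<bar> \<le> R \<and> \<bar>y v\<bar> \<le> R \<and> \<bar>x v - y v\<bar> \<le> D) \<Longrightarrow> 0 \<le> D \<Longrightarrow>
    \<bar>p s x\<bar> \<le> K \<and> \<bar>p s x - p s y\<bar> \<le> K * D" by (rule tameE[OF assms(1)]) blast
  obtain K' where K': "K' \<ge> 0" "\<And>s x y D. 0 \<le> s \<Longrightarrow> s \<le> 1 \<Longrightarrow>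
    (\<And>v. v \<in> I \<Longrightarrow> \<bar>x v\<bar> \<le> R \<and> \<bar>y v\<bar> \<le> R \<and> \<bar>x v - y v\<bar> \<le> D) \<Longrightarrow> 0 \<le> D \<Longrightarrow>
    \<bar>q s x\<bar> \<le> K' \<and> \<bar>q s x - q s y\<bar> \<le> K' * D" by (rule tameE[OF assms(2)]) blast
  show "\<exists>K\<ge>0. \<forall>s x y D. 0 \<le> s \<longrightarrow> s \<le> 1 \<longrightarrow>
    (\<forall>v\<in>I. \<bar>x v\<bar> \<le> R \<and> \<bar>y v\<bar> \<le> R \<and> \<bar>x v - y v\<bar> \<le> D) \<longrightarrow> 0 \<le> D \<longrightarrow>
    \<bar>p s x + q s x\<bar> \<le> K \<and> \<bar>p s x + q s x - (p s y + q s y)\<bar> \<le> K * D"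
  proof (intro exI[of _ "K + K'"] conjI allI impI)
    fix s D :: real and x y :: "'a \<Rightarrow> real"
    assume s: "0 \<le> s" "s \<le> 1" and *: "\<forall>v\<in>I. \<bar>x v\<bar> \<le> R \<and> \<bar>y v\<bar> \<le> R \<and> \<bar>x v - y v\<bar> \<le> D" and D: "0 \<le> D"
    have a: "\<bar>p s x\<bar> \<le> K" "\<bar>p s x - p s y\<bar> \<le> K * D" using K(2)[OF s _ D, of x y] * by auto
    have b: "\<bar>q s x\<bar> \<le> K'" "\<bar>q s x - q s y\<bar> \<le> K' * D" using K'(2)[OF s _ D, of x y] * by auto
    show "\<bar>p s x + q s x\<bar> \<le> K + K'" using a(1) b(1) by linarith
    have "\<bar>p s x + q s x - (p s y + q s y)\<bar> \<le> K * D + K' * D" using a(2) b(2) by linarith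
    then show "\<bar>p s x + q s x - (p s y + q s y)\<bar> \<le> (K + K') * D" by (simp add: algebra_simps)
  qed (use K(1) K'(1) in simp)
qed

lemma tame_mult:
  assumes "tame I p" "tame I q"
  shows "tame I (\<lambda>s x. p s x * q s x)"
proof (rule tameI)
  fix R
  obtain K where K: "K \<ge> 0" "\<And>s x y D. 0 \<le> s \<Longrightarrow> s \<le> 1 \<Longrightarrow>
    (\<And>v. v \<in> I \<Longrightarrow> \<bar>x v\<bar> \<le> R \<and> \<bar>y v\<bar> \<le> R \<and> \<bar>x v - y v\<bar> \<le> D) \<Longrightarrow> 0 \<le> D \<Longrightarrow>
    \<bar>p s x\<bar> \<le> K \<and> \<bar>p s x - p s y\<bar> \<le> K * D" by (rule tameE[OF assms(1)]) blast
  obtain K' where K': "K' \<ge> 0" "\<And>s x y D. 0 \<le> s \<Longrightarrow> s \<le> 1 \<Longrightarrow>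
    (\<And>v. v \<in> I \<Longrightarrow> \<bar>x v\<bar> \<le> R \<and> \<bar>y v\<bar> \<le> R \<and> \<bar>x v - y v\<bar> \<le> D) \<Longrightarrow> 0 \<le> D \<Longrightarrow>
    \<bar>q s x\<bar> \<le> K' \<and> \<bar>q s x - q s y\<bar> \<le> K' * D" by (rule tameE[OF assms(2)]) blast
  have nn: "0 \<le> K * K'" using K(1) K'(1) by simp
  show "\<exists>K\<ge>0. \<forall>s x y D. 0 \<le> s \<longrightarrow> s \<le> 1 \<longrightarrow>
    (\<forall>v\<in>I. \<bar>x v\<bar> \<le> R \<and> \<bar>y v\<bar> \<le> R \<and> \<bar>x v - y v\<bar> \<le> D) \<longrightarrow> 0 \<le> D \<longrightarrow>
    \<bar>p s x * q s x\<bar> \<le> K \<and> \<bar>p s x * q s x - p s y * q s y\<bar> \<le> K * D"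
  proof (intro exI[of _ "2 * (K * K')"] conjI allI impI)
    fix s D :: real and x y :: "'a \<Rightarrow> real"
    assume s: "0 \<le> s" "s \<le> 1" and *: "\<forall>v\<in>I. \<bar>x v\<bar> \<le> R \<and> \<bar>y v\<bar> \<le> R \<and> \<bar>x v - y v\<bar> \<le> D" and D: "0 \<le> D"
    have a: "\<bar>p s x\<bar> \<le> K" "\<bar>p s x - p s y\<bar> \<le> K * D" using K(2)[OF s _ D, of x y] * by auto
    have "\<bar>y v - x v\<bar> \<le> D" if "v \<in> I" for v using * that by (simp add: abs_minus_commute)
    then have b: "\<bar>q s x\<bar> \<le> K'" "\<bar>q s y\<bar> \<le> K'" "\<bar>q s x - q s y\<bar> \<le> K' * D"
      using K'(2)[OF s _ D, of x y] K'(2)[OF s _ D, of y x] * by auto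
    have "\<bar>p s x * q s x\<bar> \<le> K * K'" unfolding abs_mult by (intro mult_mono) (use a b K(1) in auto)
    then show "\<bar>p s x * q s x\<bar> \<le> 2 * (K * K')" using nn by linarith
    have "p s x * q s x - p s y * q s y = p s x * (q s x - q s y) + (p s x - p s y) * q s y"
      by (simp add: algebra_simps)
    also have "\<bar>\<dots>\<bar> \<le> \<bar>p s x\<bar> * \<bar>q s x - q s y\<bar> + \<bar>p s x - p s y\<bar> * \<bar>q s y\<bar>"
      unfolding abs_mult[symmetric] by (rule abs_triangle_ineq)
    also have "\<dots> \<le> K * (K' * D) + (K * D) * K'"
      by (intro add_mono mult_mono) (use a b K(1) K'(1) D in auto)
    also have "\<dots> = 2 * (K * K') * D" by simp
    finally show "\<bar>p s x * q s x - p s y * q s y\<bar> \<le> 2 * (K * K') * D" .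
  qed (use nn in simp)
qed

lemma tame_diff: "tame I p \<Longrightarrow> tame I q \<Longrightarrow> tame I (\<lambda>s x. p s x - q s x)"
  using tame_add[OF _ tame_mult[OF tame_const[of I "-1"]], of p q] by simp

lemma tame_sum: "(\<And>j. j \<in> J \<Longrightarrow> tame I (q j)) \<Longrightarrow> tame I (\<lambda>s x. \<Sum>j\<in>J. q j s x)"
proof (induction J rule: infinite_finite_induct)
  case (insert j J)
  then show ?case using tame_add[of I "q j" "\<lambda>s x. \<Sum>j\<in>J. q j s x"] by simp
qed (simp_all add: tame_const)

text \<open>Contraction principle: on the cube of radius \<open>R\<close> the map x0 + s q is, for
  small \<open>s\<close>, close to the constant \<open>x0\<close> and halves distances.\<close>

lemma tame_fixpoint:
  assumes I: "finite I" and q: "\<And>v. v \<in> I \<Longrightarrow> tame I (q v)"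
  shows "\<exists>C s0. 0 < s0 \<and> s0 \<le> 1 \<and> (\<forall>s. 0 < s \<longrightarrow> s \<le> s0 \<longrightarrow>
    (\<exists>x. \<forall>v\<in>I. x v = x0 v + s * q v s x \<and> \<bar>x v - x0 v\<bar> \<le> C * s))"
proof -
  define R where "R = (\<Sum>v\<in>I. \<bar>x0 v\<bar>) + 1"
  have x0R: "\<bar>x0 v\<bar> \<le> R - 1" if "v \<in> I" for v
    unfolding R_def using member_le_sum[OF that, of "\<lambda>v. \<bar>x0 v\<bar>"] I by simp
  have "\<forall>v\<in>I. \<exists>K\<ge>0. \<forall>s x y D. 0 \<le> s \<longrightarrow> s \<le> 1 \<longrightarrow>
    (\<forall>v\<in>I. \<bar>x v\<bar> \<le> R \<and> \<bar>y v\<bar> \<le> R \<and> \<bar>x v - y v\<bar> \<le> D) \<longrightarrow> 0 \<le> D \<longrightarrow>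
    \<bar>q v s x\<bar> \<le> K \<and> \<bar>q v s x - q v s y\<bar> \<le> K * D"
    using q unfolding tame_def by blast
  then obtain Kf where Kf: "\<And>v. v \<in> I \<Longrightarrow> Kf v \<ge> 0"
    "\<And>v s x y D. v \<in> I \<Longrightarrow> 0 \<le> s \<Longrightarrow> s \<le> 1 \<Longrightarrow>
      \<forall>v\<in>I. \<bar>x v\<bar> \<le> R \<and> \<bar>y v\<bar> \<le> R \<and> \<bar>x v - y v\<bar> \<le> D \<Longrightarrow> 0 \<le> D \<Longrightarrow>
      \<bar>q v s x\<bar> \<le> Kf v \<and> \<bar>q v s x - q v s y\<bar> \<le> Kf v * D" by metis
  define K where "K = (\<Sum>v\<in>I. Kf v) + 1"
  have KfK: "Kf v \<le> K" if "v \<in> I" for v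
    unfolding K_def using member_le_sum[OF that, of Kf] I Kf(1) by simp
  have K1: "K \<ge> 1" unfolding K_def using Kf(1) by (simp add: sum_nonneg)
  have bnd: "\<bar>q v s x\<bar> \<le> K" "\<bar>q v s x - q v s y\<bar> \<le> K * D"
    if "v \<in> I" "0 \<le> s" "s \<le> 1" "\<forall>v\<in>I. \<bar>x v\<bar> \<le> R \<and> \<bar>y v\<bar> \<le> R \<and> \<bar>x v - y v\<bar> \<le> D" "0 \<le> D" for v s x y D
  proof -
    have "Kf v * D \<le> K * D" using KfK[OF that(1)] that(5) by (rule mult_right_mono)
    then show "\<bar>q v s x\<bar> \<le> K" "\<bar>q v s x - q v s y\<bar> \<le> K * D"
      using Kf(2)[OF that] KfK[OF that(1)] by auto
  qed
  \<comment> \<open>Ensures that s K is at most 1/2: iterates stay within the margin 1 that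
    \<open>R\<close> leaves around \<open>x0\<close>, and successive differences halve.\<close>
  define s0 where "s0 = 1 / (2 * K)"
  have "\<exists>x. \<forall>v\<in>I. x v = x0 v + s * q v s x \<and> \<bar>x v - x0 v\<bar> \<le> K * s" if s: "0 < s" "s \<le> s0" for s
  proof -
    have sK: "s * K \<le> 1 / 2" using s(2) K1 by (simp add: s0_def field_simps)
    have "s * 1 \<le> s * K" using K1 s by (intro mult_left_mono) auto
    then have "s \<le> s * K" by simp
    then have s1: "0 \<le> s" "s \<le> 1" using s(1) sK by linarith+
    define step where "step x v = x0 v + s * q v s x" for x v
    define X where "X m = (step ^^ m) x0" for m
    have X0: "X 0 = x0" and XS: "X (Suc m) = step (X m)" for m by (simp_all add: X_def)
    have near: "\<bar>X m v - x0 v\<bar> \<le> K * s" if "v \<in> I" for m v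
      using that
    proof (induction m arbitrary: v)
      case 0
      then show ?case using K1 s by (simp add: X0)
    next
      case (Suc m)
      have "\<forall>v\<in>I. \<bar>X m v\<bar> \<le> R \<and> \<bar>X m v\<bar> \<le> R \<and> \<bar>X m v - X m v\<bar> \<le> 0"
      proof
        fix w assume "w \<in> I"
        then show "\<bar>X m w\<bar> \<le> R \<and> \<bar>X m w\<bar> \<le> R \<and> \<bar>X m w - X m w\<bar> \<le> 0"
          using Suc.IH[of w] x0R[of w] sK by (simp add: mult.commute)
      qed
      from bnd(1)[OF Suc.prems s1 this] have "\<bar>q v s (X m)\<bar> \<le> K" by simp
      then show ?case using s by (simp add: XS step_def abs_mult mult.commute)
    qed
    have XR: "\<bar>X m v\<bar> \<le> R" if "v \<in> I" for m v
      using near[OF that, of m] x0R[OF that] sK by (simp add: mult.commute)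
    have diff: "\<bar>X (Suc m) v - X m v\<bar> \<le> (1 / 2) ^ m" if "v \<in> I" for m v
      using that
    proof (induction m arbitrary: v)
      case 0
      then show ?case using near[of v 1] sK by (simp add: X0 mult.commute)
    next
      case (Suc m)
      have "\<forall>v\<in>I. \<bar>X (Suc m) v\<bar> \<le> R \<and> \<bar>X m v\<bar> \<le> R \<and> \<bar>X (Suc m) v - X m v\<bar> \<le> (1 / 2) ^ m"
        using XR Suc.IH by blast
      from bnd(2)[OF Suc.prems s1 this] have "\<bar>q v s (X (Suc m)) - q v s (X m)\<bar> \<le> K * (1 / 2) ^ m" by simp
      then have "s * \<bar>q v s (X (Suc m)) - q v s (X m)\<bar> \<le> s * (K * (1 / 2) ^ m)"
        using s by (intro mult_left_mono) auto
      also have "\<dots> = (s * K) * (1 / 2) ^ m" by simp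
      also have "\<dots> \<le> 1 / 2 * (1 / 2) ^ m" using sK by (intro mult_right_mono) auto
      finally show ?case unfolding XS step_def using s
        by (simp add: abs_mult right_diff_distrib[symmetric] XS[symmetric] step_def)
    qed
    have "\<exists>l. (\<lambda>m. X m v) \<longlonglongrightarrow> l" if "v \<in> I" for v
    proof -
      have "summable (\<lambda>m. X (Suc m) v - X m v)"
        by (rule summable_comparison_test'[of "\<lambda>m. (1 / 2 :: real) ^ m" 0]) (use diff[OF that] in auto)
      then have "convergent (\<lambda>m. \<Sum>i<m. X (Suc i) v - X i v)" by (simp add: summable_iff_convergent)
      moreover have "(\<Sum>i<m. X (Suc i) v - X i v) = X m v - X 0 v" for m by (rule sum_lessThan_telescope)
      ultimately obtain l where "(\<lambda>m. X m v - X 0 v) \<longlonglongrightarrow> l" by (auto simp: convergent_def)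
      from tendsto_add[OF this tendsto_const[of "X 0 v"]] show ?thesis by auto
    qed
    then obtain x where x: "\<And>v. v \<in> I \<Longrightarrow> (\<lambda>m. X m v) \<longlonglongrightarrow> x v" by metis
    have lim_near: "\<bar>x v - x0 v\<bar> \<le> K * s" if "v \<in> I" for v
    proof -
      have "(\<lambda>m. \<bar>X m v - x0 v\<bar>) \<longlonglongrightarrow> \<bar>x v - x0 v\<bar>" by (intro tendsto_intros x that)
      then show ?thesis using near[OF that] by (intro LIMSEQ_le_const2) auto
    qed
    have limR: "\<bar>x v\<bar> \<le> R" if "v \<in> I" for v
      using lim_near[OF that] x0R[OF that] sK by (simp add: mult.commute)
    have "x v = x0 v + s * q v s x" if v: "v \<in> I" for v
    proof -
      define D where "D m = (\<Sum>w\<in>I. \<bar>X m w - x w\<bar>)" for m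
      have "(\<lambda>m. D m) \<longlonglongrightarrow> (\<Sum>w\<in>I. \<bar>x w - x w\<bar>)" unfolding D_def by (intro tendsto_intros x)
      then have "(\<lambda>m. K * D m) \<longlonglongrightarrow> K * 0" by (intro tendsto_intros) simp
      then have KD: "(\<lambda>m. K * D m) \<longlonglongrightarrow> 0" by simp
      have "\<bar>q v s (X m) - q v s x\<bar> \<le> K * D m" for m
      proof (rule bnd(2)[OF v s1])
        show "\<forall>w\<in>I. \<bar>X m w\<bar> \<le> R \<and> \<bar>x w\<bar> \<le> R \<and> \<bar>X m w - x w\<bar> \<le> D m"
          unfolding D_def using XR limR member_le_sum[of _ I "\<lambda>w. \<bar>X m w - x w\<bar>"] I by auto
        show "0 \<le> D m" by (simp add: D_def sum_nonneg)
      qed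
      then have "(\<lambda>m. q v s (X m) - q v s x) \<longlonglongrightarrow> 0"
        by (intro tendsto_rabs_zero_cancel[OF tendsto_sandwich[OF _ _ tendsto_const KD]]) auto
      from tendsto_add[OF this tendsto_const[of "q v s x"]] have "(\<lambda>m. q v s (X m)) \<longlonglongrightarrow> q v s x" by simp
      then have "(\<lambda>m. x0 v + s * q v s (X m)) \<longlonglongrightarrow> x0 v + s * q v s x" by (intro tendsto_intros)
      then have "(\<lambda>m. X (Suc m) v) \<longlonglongrightarrow> x0 v + s * q v s x" by (simp add: XS step_def)
      moreover have "(\<lambda>m. X (Suc m) v) \<longlonglongrightarrow> x v" by (rule LIMSEQ_Suc[OF x[OF v]])
      ultimately show ?thesis using LIMSEQ_unique by blast
    qed
    then show ?thesis using lim_near by blast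
  qed
  moreover have "0 < s0" "s0 \<le> 1" using K1 by (auto simp: s0_def field_simps)
  ultimately show ?thesis by blast
qed

text \<open>Nonzero solutions of homogeneous conditions for infinitely many \<open>m\<close> could
  be normalised, and a limit of norm 1 would satisfy the limit conditions. It serves both for
  definiteness and for the strong Arnold property.\<close>

lemma eventually_only_trivial:
  fixes bad :: "nat \<Rightarrow> ('i \<Rightarrow> real) \<Rightarrow> bool"
  assumes I: "finite I" and scale: "\<And>m x c. bad m x \<Longrightarrow> bad m (\<lambda>i. c * x i)"
    and lim: "\<And>r x l. strict_mono (r :: nat \<Rightarrow> nat) \<Longrightarrow> (\<And>m. bad (r m) (x m)) \<Longrightarrow>
      (\<And>i. i \<in> I \<Longrightarrow> (\<lambda>m. x m i) \<longlonglongrightarrow> l i) \<Longrightarrow> \<forall>i\<in>I. l i = 0"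
  shows "\<exists>m0. \<forall>m\<ge>m0. \<forall>x. bad m x \<longrightarrow> (\<forall>i\<in>I. x i = 0)"
proof (rule ccontr)
  assume no: "\<not> ?thesis"
  define P where "P m \<longleftrightarrow> (\<exists>x. bad m x \<and> (\<exists>i\<in>I. x i \<noteq> 0))" for m
  have "\<exists>m>j. P m" for j
  proof -
    obtain m where "m \<ge> Suc j" "P m" using no unfolding P_def by blast
    then show ?thesis by (intro exI[of _ m]) auto
  qed
  then have "infinite {m. P m}" unfolding infinite_nat_iff_unbounded by auto
  from infinite_enumerate[OF this] obtain r where r: "strict_mono (r :: nat \<Rightarrow> nat)" "\<And>m. P (r m)" by auto
  have "\<exists>x. bad (r m) x \<and> (\<Sum>i\<in>I. \<bar>x i\<bar>) = 1" for m
  proof -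
    obtain x i where x: "bad (r m) x" "i \<in> I" "x i \<noteq> 0" using r(2)[of m] by (auto simp: P_def)
    define c where "c = (\<Sum>i\<in>I. \<bar>x i\<bar>)"
    have "\<bar>x i\<bar> \<le> c" unfolding c_def using x(2) I by (intro member_le_sum) auto
    then have "c > 0" using x(3) by linarith
    have "(\<Sum>i\<in>I. \<bar>inverse c * x i\<bar>) = inverse c * c"
      using \<open>c > 0\<close> by (simp add: abs_mult c_def sum_distrib_left)
    then show ?thesis using scale[OF x(1), of "inverse c"] \<open>c > 0\<close> by (intro exI[of _ "\<lambda>i. inverse c * x i"]) auto
  qed
  then obtain x where x: "\<And>m. bad (r m) (x m)" "\<And>m. (\<Sum>i\<in>I. \<bar>x m i\<bar>) = 1" by metis
  have "\<bar>x m i\<bar> \<le> 1" if "i \<in> I" for m i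
    using member_le_sum[OF that, of "\<lambda>i. \<bar>x m i\<bar>"] I x(2)[of m] by simp
  from bounded_family_convergent_subseq[OF I, of x 1, OF this] obtain t l where
    t: "strict_mono (t :: nat \<Rightarrow> nat)" "\<forall>i\<in>I. (\<lambda>m. x (t m) i) \<longlonglongrightarrow> l i" by blast
  have "\<forall>i\<in>I. l i = 0"
  proof (rule lim)
    show "strict_mono (r \<circ> t)" by (rule strict_mono_o[OF r(1) t(1)])
    show "bad ((r \<circ> t) m) (x (t m))" for m using x(1) by simp
  qed (use t in blast)
  moreover have "(\<lambda>m. \<Sum>i\<in>I. \<bar>x (t m) i\<bar>) \<longlonglongrightarrow> (\<Sum>i\<in>I. \<bar>l i\<bar>)" by (intro tendsto_intros) (use t in blast)
  then have "(\<Sum>i\<in>I. \<bar>l i\<bar>) = 1" using x(2) LIMSEQ_unique[OF _ tendsto_const] by simp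
  ultimately show False by simp
qed

section \<open>A lower bound for the Colin de Verdiere parameter\<close>

text \<open>\<open>blk i\<close> is the branch set containing the vertex \<open>i\<close>, or \<open>k + 3\<close> if there is none; the
  vertices \<open>0, \<dots>, k + 2\<close> are representatives of the branch sets.\<close>

locale join_minor =
  fixes n k :: nat and E :: "(nat \<times> nat) set" and blk :: "nat \<Rightarrow> nat"
  assumes k: "k \<ge> 1" and size: "k + 3 \<le> n"
    and sym_E: "sym E" and irrefl_E: "irrefl E"
    and blk_root: "\<And>a. a < k + 3 \<Longrightarrow> blk a = a"
    and blk_le: "\<And>i. i < n \<Longrightarrow> blk i \<le> k + 3"
    and branch_conn: "\<And>a. a < k + 3 \<Longrightarrow> conn E {i. i < n \<and> blk i = a}"
    and branch_adj: "\<And>a b. a < k + 3 \<Longrightarrow> b < k + 3 \<Longrightarrow> a \<noteq> b \<Longrightarrow> a < k \<or> b < k \<Longrightarrow>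
      \<exists>i<n. \<exists>j<n. blk i = a \<and> blk j = b \<and> (i, j) \<in> E"
begin

abbreviation h :: nat
  where "h \<equiv> k + 3"

lemma symE: "(i, j) \<in> E \<Longrightarrow> (j, i) \<in> E"
  using sym_E by (auto dest: symD)

lemma irreflE: "(i, i) \<notin> E"
  using irrefl_E by (simp add: irrefl_def)

section \<open>The Laplacian of the branch sets and its kernel\<close>

definition inner :: "nat \<Rightarrow> nat \<Rightarrow> real"
  where "inner i j = (if (i, j) \<in> E \<and> blk i = blk j \<and> blk i < h then 1 else 0)"

text \<open>A diagonal term at the vertices outside all branch sets, so that the kernel of
  \<open>lap\<close> is spanned by the indicator vectors \<open>prj b\<close> alone.\<close>

definition unused :: "nat \<Rightarrow> real"
  where "unused i = (if blk i < h then 0 else 1)"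

definition lap :: "nat \<Rightarrow> nat \<Rightarrow> real"
  where "lap i j = (if i = j then (\<Sum>l<n. inner i l) + unused i else 0) - inner i j"

definition prj :: "nat \<Rightarrow> nat \<Rightarrow> real"
  where "prj b i = (if blk i = b then 1 else 0)"

lemma inner_commute: "inner i j = inner j i"
  using symE by (auto simp: inner_def)

lemma inner_nonneg: "inner i j \<ge> 0"
  by (simp add: inner_def)

lemma symf_lap: "symf n lap"
  unfolding symf_def lap_def by (auto simp: inner_commute)

lemma app_lap:
  assumes "i < n"
  shows "app n lap x i = unused i * x i + (\<Sum>l<n. inner i l * (x i - x l))"
proof -
  have "app n lap x i = (\<Sum>j<n. (if i = j then ((\<Sum>l<n. inner i l) + unused i) * x i else 0) - inner i j * x j)"
    unfolding app_def by (intro sum.cong) (auto simp: lap_def left_diff_distrib)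
  also have "\<dots> = ((\<Sum>l<n. inner i l) + unused i) * x i - (\<Sum>j<n. inner i j * x j)"
    using assms by (simp add: sum_subtractf)
  also have "\<dots> = unused i * x i + (\<Sum>l<n. inner i l * x i - inner i l * x l)"
    by (simp add: sum_subtractf sum_distrib_right distrib_right)
  finally show ?thesis by (simp add: right_diff_distrib)
qed

lemma bilin_lap:
  "bilin n lap x x = (\<Sum>i<n. unused i * (x i)\<^sup>2) + (\<Sum>i<n. \<Sum>l<n. inner i l * (x i - x l)\<^sup>2) / 2"
proof -
  define S where "S = (\<Sum>i<n. \<Sum>l<n. inner i l * (x i * (x i - x l)))"
  have "bilin n lap x x = (\<Sum>i<n. unused i * (x i)\<^sup>2 + (\<Sum>l<n. inner i l * (x i * (x i - x l))))"
    unfolding bilin_def dotp_def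
    by (intro sum.cong) (simp_all add: app_lap distrib_left sum_distrib_left power2_eq_square mult_ac)
  then have 1: "bilin n lap x x = (\<Sum>i<n. unused i * (x i)\<^sup>2) + S" by (simp add: sum.distrib S_def)
  have "S = (\<Sum>l<n. \<Sum>i<n. inner i l * (x i * (x i - x l)))" unfolding S_def by (rule sum.swap)
  also have "\<dots> = (\<Sum>i<n. \<Sum>l<n. inner i l * (x l * (x l - x i)))"
    by (intro sum.cong refl) (subst inner_commute, rule refl)
  finally have "S + S = (\<Sum>i<n. \<Sum>l<n. inner i l * (x i * (x i - x l)) + inner i l * (x l * (x l - x i)))"
    by (simp add: S_def sum.distrib)
  also have "\<dots> = (\<Sum>i<n. \<Sum>l<n. inner i l * (x i - x l)\<^sup>2)"
    by (intro sum.cong refl) (simp add: power2_eq_square algebra_simps)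
  finally have "S = (\<Sum>i<n. \<Sum>l<n. inner i l * (x i - x l)\<^sup>2) / 2" by simp
  then show ?thesis using 1 by simp
qed

text \<open>The form is a sum of squares, so a null vector is constant along inner edges and hence
  on every branch set, whose representative is \<open>blk i\<close>.\<close>

lemma lap_null_constant:
  assumes x: "bilin n lap x x \<le> 0" and i: "i < n"
  shows "blk i < h \<Longrightarrow> x i = x (blk i)" "blk i = h \<Longrightarrow> x i = 0"
proof -
  define U where "U = (\<Sum>i<n. unused i * (x i)\<^sup>2)"
  define S where "S = (\<Sum>i<n. \<Sum>l<n. inner i l * (x i - x l)\<^sup>2)"
  have U: "U \<ge> 0" unfolding U_def by (intro sum_nonneg) (simp add: unused_def)
  have S: "S \<ge> 0" unfolding S_def by (intro sum_nonneg) (simp add: inner_nonneg)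
  have "U + S / 2 \<le> 0" using x unfolding bilin_lap U_def S_def .
  then have U0: "U = 0" and S0: "S = 0" using U S by auto
  have unused0: "unused j * (x j)\<^sup>2 = 0" if "j < n" for j
    using U0 that unfolding U_def by (subst (asm) sum_nonneg_eq_0_iff) (auto simp: unused_def)
  have step: "x j = x l" if jl: "j < n" "l < n" "(j, l) \<in> E" "blk j = blk l" "blk j < h" for j l
  proof -
    have "(\<Sum>l<n. inner j l * (x j - x l)\<^sup>2) = 0"
      using S0 jl(1) unfolding S_def
      by (subst (asm) sum_nonneg_eq_0_iff) (auto intro!: sum_nonneg simp: inner_nonneg)
    then have "inner j l * (x j - x l)\<^sup>2 = 0"
      using jl(2) by (subst (asm) sum_nonneg_eq_0_iff) (auto simp: inner_nonneg)
    then show ?thesis using jl by (simp add: inner_def)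
  qed
  show "x i = 0" if "blk i = h" using unused0[OF i] that by (simp add: unused_def)
  show "x i = x (blk i)" if b: "blk i < h"
  proof (rule ccontr)
    assume ne: "x i \<noteq> x (blk i)"
    define B where "B = {j. j < n \<and> blk j = blk i}"
    define X where "X = {j \<in> B. x j = x i}"
    have "blk i \<in> B" using b size blk_root[OF b] by (simp add: B_def)
    moreover have "blk i \<notin> X" using ne by (simp add: X_def)
    ultimately have "X \<noteq> B" by blast
    moreover have "i \<in> X" using i by (simp add: X_def B_def)
    then have "X \<noteq> {}" by blast
    moreover have "X \<subseteq> B" by (auto simp: X_def)
    moreover have "conn E B" unfolding B_def by (rule branch_conn[OF b])
    ultimately obtain u v where uv: "u \<in> X" "v \<in> B" "v \<notin> X" "(u, v) \<in> E" using connE by metis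
    then have "x u = x v" using b by (intro step) (auto simp: X_def B_def)
    then show False using uv by (simp add: X_def)
  qed
qed

lemma app_lap_prj:
  assumes "b < h" "i < n"
  shows "app n lap (prj b) i = 0"
proof -
  have "inner i l * (prj b i - prj b l) = 0" for l by (simp add: inner_def prj_def)
  moreover have "unused i * prj b i = 0" using assms by (simp add: unused_def prj_def)
  ultimately show ?thesis unfolding app_lap[OF assms(2)] by simp
qed

lemma dotp_prj_lap: "b < h \<Longrightarrow> dotp n (prj b) (app n lap x) = 0"
  using dotp_app_commute[OF symf_lap, of "prj b" x] app_lap_prj[of b]
  by (simp add: dotp_def)

text \<open>A null vector that vanishes at the representatives vanishes everywhere, so the block of
  \<open>lap\<close> on the remaining vertices is nonsingular and can be eliminated.\<close>

lemma lap_inverse_exists: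
  "\<exists>g. \<forall>i\<in>{h..<n}. \<forall>l\<in>{h..<n}. (\<Sum>j\<in>{h..<n}. lap i j * g j l) = (if i = l then 1 else 0)"
proof -
  define m where "m = n - h"
  define A where "A = mat m m (\<lambda>(i, j). lap (h + i) (h + j))"
  have A: "A \<in> carrier_mat m m" by (simp add: A_def)
  have shift: "(\<Sum>j\<in>{h..<n}. f j) = (\<Sum>j<m. f (h + j))" for f :: "nat \<Rightarrow> real"
    using sum.shift_bounds_nat_ivl[of f 0 h m] size
    by (simp add: m_def lessThan_atLeast0 add.commute)
  have "det A \<noteq> 0"
  proof
    assume "det A = 0"
    then obtain v where v: "v \<in> carrier_vec m" "v \<noteq> 0\<^sub>v m" "A *\<^sub>v v = 0\<^sub>v m"
      using det_0_iff_vec_prod_zero_field[OF A] by auto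
    define x where "x i = (if h \<le> i then v $ (i - h) else 0)" for i
    have "app n lap x i = 0" if i: "i < n" "h \<le> i" for i
    proof -
      have "app n lap x i = (\<Sum>j\<in>{h..<n}. lap i j * x j)"
        unfolding app_def by (rule sum.mono_neutral_cong_right) (auto simp: x_def)
      also have "\<dots> = (\<Sum>j<m. lap i (h + j) * v $ j)" unfolding shift by (simp add: x_def)
      also have "\<dots> = (A *\<^sub>v v) $ (i - h)"
        using i v(1) by (auto simp: A_def m_def scalar_prod_def lessThan_atLeast0 intro!: sum.cong)
      also have "\<dots> = 0" using v(3) i by (simp add: m_def)
      finally show ?thesis .
    qed
    then have "bilin n lap x x = 0" unfolding bilin_def dotp_def by (intro sum.neutral) (auto simp: x_def)
    then have null: "bilin n lap x x \<le> 0" by simp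
    have "v $ i = 0" if i: "i < m" for i
    proof -
      have hi: "h + i < n" using i by (simp add: m_def)
      have "blk (h + i) < h \<or> blk (h + i) = h" using blk_le[OF hi] by linarith
      then have "x (h + i) = 0"
        using lap_null_constant[OF null hi] by (auto simp: x_def)
      then show ?thesis by (simp add: x_def)
    qed
    then have "v = 0\<^sub>v m" using v(1) by (intro eq_vecI) auto
    then show False using v(2) by simp
  qed
  from det_non_zero_imp_unit[OF A this, unfolded Units_def, of "()"]
  obtain B where B: "B \<in> carrier_mat m m" "A * B = 1\<^sub>m m" by (auto simp: ring_mat_def)
  have "(\<Sum>j\<in>{h..<n}. lap i j * B $$ (j - h, l - h)) = (if i = l then 1 else 0)"
    if "i \<in> {h..<n}" "l \<in> {h..<n}" for i l
  proof -
    have "(\<Sum>j\<in>{h..<n}. lap i j * B $$ (j - h, l - h)) = (\<Sum>j<m. lap i (h + j) * B $$ (j, l - h))"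
      unfolding shift by simp
    also have "\<dots> = (A * B) $$ (i - h, l - h)"
      using that B(1) by (auto simp: A_def m_def scalar_prod_def lessThan_atLeast0 intro!: sum.cong)
    also have "\<dots> = (if i = l then 1 else 0)" using that B(2) by (auto simp: m_def)
    finally show ?thesis .
  qed
  then show ?thesis by (intro exI[of _ "\<lambda>j l. B $$ (j - h, l - h)"]) blast
qed

section \<open>Small weights on the remaining edges and the reduced matrix they induce\<close>

definition ecount :: "nat \<Rightarrow> nat \<Rightarrow> real"
  where "ecount a b = (\<Sum>i<n. \<Sum>j<n. prj a i * prj b j * (if (i, j) \<in> E then 1 else 0))"

text \<open>\<open>\<nu>\<close> prescribes the reduced matrix: an entry involving a core vertex is
  spread evenly over the edges between the two branch sets, a diagonal entry sits at the
  representative. Other edges not inside a branch set get weight -1.\<close>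

definition wt :: "(nat \<times> nat \<Rightarrow> real) \<Rightarrow> nat \<Rightarrow> nat \<Rightarrow> real"
  where "wt \<nu> i j =
    (if (i, j) \<in> E \<and> (blk i \<noteq> blk j \<or> \<not> blk i < h) then
       (if blk i < h \<and> blk j < h \<and> (blk i < k \<or> blk j < k)
        then \<nu> (min (blk i) (blk j), max (blk i) (blk j)) * inverse (ecount (blk i) (blk j)) else - 1)
     else if i = j \<and> i < h then \<nu> (i, i) else 0)"

lemma ecount_commute: "ecount a b = ecount b a"
  unfolding ecount_def by (subst sum.swap) (auto intro!: sum.cong dest: symE simp: mult_ac)

lemma ecount_nonneg: "ecount a b \<ge> 0"
  unfolding ecount_def by (intro sum_nonneg) (simp add: prj_def)

lemma ecount_pos:
  assumes "a < h" "b < h" "a \<noteq> b" "a < k \<or> b < k"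
  shows "ecount a b > 0"
proof -
  obtain i j where ij: "i < n" "j < n" "blk i = a" "blk j = b" "(i, j) \<in> E" using branch_adj[OF assms] by blast
  define t where "t i j = prj a i * prj b j * (if (i, j) \<in> E then 1 else 0)" for i j
  have t: "t i j \<ge> 0" for i j by (simp add: t_def prj_def)
  have "1 = t i j" using ij by (simp add: t_def prj_def)
  also have "t i j \<le> (\<Sum>j<n. t i j)" using ij t by (intro member_le_sum) auto
  also have "\<dots> \<le> (\<Sum>i<n. \<Sum>j<n. t i j)"
    using ij t by (intro member_le_sum[of i _ "\<lambda>i. \<Sum>j<n. t i j"]) (auto intro: sum_nonneg)
  finally show ?thesis unfolding ecount_def t_def by simp
qed

lemma symf_wt: "symf n (wt \<nu>)"
proof -
  have "wt \<nu> i j = wt \<nu> j i" for i j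
  proof (cases "i = j")
    case False
    have "(i, j) \<in> E \<longleftrightarrow> (j, i) \<in> E" using symE by blast
    then show ?thesis using False
      by (auto simp: wt_def ecount_commute[of "blk j" "blk i"] min.commute[of "blk j" "blk i"] max.commute[of "blk j" "blk i"])
  qed simp
  then show ?thesis by (simp add: symf_def)
qed

lemma dotp_prj_app: "dotp n (prj a) (app n A (prj b)) = (\<Sum>i<n. \<Sum>j<n. prj a i * prj b j * A i j)"
  unfolding dotp_def app_def by (simp add: sum_distrib_left mult_ac)

lemma reduced_wt_diag:
  assumes "a < h"
  shows "dotp n (prj a) (app n (wt \<nu>) (prj a)) = \<nu> (a, a)"
proof -
  have "prj a i * prj a j * wt \<nu> i j = (if j = a then if i = a then \<nu> (a, a) else 0 else 0)" if "i < n" "j < n" for i j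
  proof (cases "blk i = a \<and> blk j = a")
    case True
    then show ?thesis using blk_root assms by (auto simp: prj_def wt_def)
  next
    case False
    then show ?thesis using blk_root[OF assms] by (auto simp: prj_def)
  qed
  then have "dotp n (prj a) (app n (wt \<nu>) (prj a)) = (\<Sum>i<n. \<Sum>j<n. if j = a then if i = a then \<nu> (a, a) else 0 else 0)"
    unfolding dotp_prj_app by (intro sum.cong refl) auto
  then show ?thesis using assms size by simp
qed

lemma reduced_wt_core:
  assumes "a < h" "b < h" "a \<noteq> b" "a < k \<or> b < k"
  shows "dotp n (prj a) (app n (wt \<nu>) (prj b)) = \<nu> (min a b, max a b)"
proof -
  define c where "c = \<nu> (min a b, max a b) * inverse (ecount a b)"
  have *: "prj a i * prj b j * wt \<nu> i j = c * (prj a i * prj b j * (if (i, j) \<in> E then 1 else 0))" for i j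
    using assms by (auto simp: prj_def wt_def c_def)
  have "dotp n (prj a) (app n (wt \<nu>) (prj b)) = c * ecount a b"
    unfolding dotp_prj_app ecount_def * by (simp only: sum_distrib_left)
  then show ?thesis using ecount_pos[OF assms] by (simp add: c_def)
qed

text \<open>The entries at pairs of leaves do not depend on \<open>\<nu>\<close>, and
  \<open>ecount a b\<close> may be 0; \<beta> has to be adapted to them.\<close>

lemma reduced_wt_leaf:
  assumes "a < h" "b < h" "a \<noteq> b" "k \<le> a" "k \<le> b"
  shows "dotp n (prj a) (app n (wt \<nu>) (prj b)) = - ecount a b"
proof -
  have *: "prj a i * prj b j * wt \<nu> i j = - (prj a i * prj b j * (if (i, j) \<in> E then 1 else 0))" for i j
    using assms by (auto simp: prj_def wt_def)
  show ?thesis unfolding dotp_prj_app ecount_def * by (simp only: sum_negf)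
qed

text \<open>The numbers \<open>x\<close> at the three leaves \<open>k\<close>, \<open>k + 1\<close>, \<open>k + 2\<close> with prescribed pairwise sums.\<close>

definition leafsol :: "real \<Rightarrow> (nat \<Rightarrow> nat \<Rightarrow> real) \<Rightarrow> nat \<Rightarrow> real"
  where "leafsol c f a =
    (if a = k then (f k (k + 1) + f k (k + 2) - f (k + 1) (k + 2)) / 2
     else if a = k + 1 then (f k (k + 1) + f (k + 1) (k + 2) - f k (k + 2)) / 2
     else if a = k + 2 then (f k (k + 2) + f (k + 1) (k + 2) - f k (k + 1)) / 2 else c)"

lemma leafsol_pair:
  assumes "k \<le> a" "a < b" "b < h"
  shows "leafsol c f a + leafsol c f b = f a b"
proof -
  have "a = k \<and> b = k + 1 \<or> a = k \<and> b = k + 2 \<or> a = k + 1 \<and> b = k + 2" using assms by linarith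
  then show ?thesis by (auto simp: leafsol_def field_simps)
qed

lemma leafsol_linear:
  "leafsol c (\<lambda>a b. f a b - s * t a b) a = leafsol c f a - s * leafsol 0 t a"
  by (simp add: leafsol_def field_simps)

text \<open>The unknowns of the fixed-point system: \<open>Inl (a, b)\<close> is a prescribed
  reduced entry, \<open>Inr (i, b)\<close> the correction of column \<open>b\<close> at a vertex
  \<open>i\<close> that is not a representative.\<close>

definition coords :: "((nat \<times> nat) + (nat \<times> nat)) set"
  where "coords = Inl ` ({..<h} \<times> {..<h}) \<union> Inr ` ({h..<n} \<times> {..<h})"

definition zeta :: "((nat \<times> nat) + (nat \<times> nat) \<Rightarrow> real) \<Rightarrow> nat \<Rightarrow> nat \<Rightarrow> real"
  where "zeta x b i = (if h \<le> i then x (Inr (i, b)) else 0)"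

text \<open>At the representatives this is the unit vector of \<open>b\<close>. In a solution the
  correction makes \<open>M\<close> annihilate it at all other vertices, so these columns compute
  the Schur complement.\<close>

definition col :: "real \<Rightarrow> ((nat \<times> nat) + (nat \<times> nat) \<Rightarrow> real) \<Rightarrow> nat \<Rightarrow> nat \<Rightarrow> real"
  where "col s x b i = prj b i + s * zeta x b i"

definition wtx :: "((nat \<times> nat) + (nat \<times> nat) \<Rightarrow> real) \<Rightarrow> nat \<Rightarrow> nat \<Rightarrow> real"
  where "wtx x = wt (\<lambda>p. x (Inl p))"

text \<open>The contribution of the corrections to the reduced matrix, one order of \<open>s\<close>
  smaller than that of the weights.\<close>

definition corr :: "((nat \<times> nat) + (nat \<times> nat) \<Rightarrow> real) \<Rightarrow> nat \<Rightarrow> nat \<Rightarrow> real"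
  where "corr x a b = dotp n (prj a) (app n (wtx x) (zeta x b))"

text \<open>At s = 0 the leaf values of \<beta> are at least 1 - \<open>core_val\<close>, so every
  entry in a core row is at most -1, and still negative after a small perturbation.\<close>

definition core_val :: real
  where "core_val = 1 + ecount k (k + 1) + ecount k (k + 2) + ecount (k + 1) (k + 2)"

definition beta :: "real \<Rightarrow> ((nat \<times> nat) + (nat \<times> nat) \<Rightarrow> real) \<Rightarrow> nat \<Rightarrow> real"
  where "beta s x = leafsol core_val (\<lambda>a b. ecount a b - s * corr x a b)"

text \<open>The solution of the system at s = 0.\<close>

definition start :: "(nat \<times> nat) + (nat \<times> nat) \<Rightarrow> real"
  where "start v = (case v of Inl (a, b) \<Rightarrow> - (leafsol core_val ecount a + leafsol core_val ecount b) | Inr _ \<Rightarrow> 0)"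

text \<open>For M = lap + s^2 W, annihilating column \<open>b\<close> off the representatives means
  lap zeta = - s W col there, and the reduced entry is s^2 times (W reduced + s corr). Scaling
  weights by s^2 and corrections by s thus puts a factor \<open>s\<close> before both increments, as
  the contraction lemma requires; \<open>g\<close> inverts the block of \<open>lap\<close>.\<close>

definition incr :: "(nat \<Rightarrow> nat \<Rightarrow> real) \<Rightarrow> (nat \<times> nat) + (nat \<times> nat) \<Rightarrow> real \<Rightarrow>
    ((nat \<times> nat) + (nat \<times> nat) \<Rightarrow> real) \<Rightarrow> real"
  where "incr g v s x = (case v of
      Inl (a, b) \<Rightarrow> leafsol 0 (corr x) a + leafsol 0 (corr x) b - corr x a b
    | Inr (i, b) \<Rightarrow> 0 - (\<Sum>l\<in>{h..<n}. g i l * app n (wtx x) (col s x b) l))"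

lemma tame_wtx: "i < n \<Longrightarrow> j < n \<Longrightarrow> tame coords (\<lambda>s x. wtx x i j)"
proof -
  assume ij: "i < n" "j < n"
  consider (cross) "(i, j) \<in> E \<and> (blk i \<noteq> blk j \<or> \<not> blk i < h)" "blk i < h \<and> blk j < h \<and> (blk i < k \<or> blk j < k)"
    | (other) "(i, j) \<in> E \<and> (blk i \<noteq> blk j \<or> \<not> blk i < h)" "\<not> (blk i < h \<and> blk j < h \<and> (blk i < k \<or> blk j < k))"
    | (diag) "\<not> ((i, j) \<in> E \<and> (blk i \<noteq> blk j \<or> \<not> blk i < h))" "i = j \<and> i < h"
    | (zero) "\<not> ((i, j) \<in> E \<and> (blk i \<noteq> blk j \<or> \<not> blk i < h))" "\<not> (i = j \<and> i < h)" by blast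
  then show ?thesis
  proof cases
    case cross
    then have eq: "(\<lambda>(s :: real) x. wtx x i j) =
      (\<lambda>s x. x (Inl (min (blk i) (blk j), max (blk i) (blk j))) * inverse (ecount (blk i) (blk j)))"
      by (intro ext) (auto simp: wtx_def wt_def)
    have "Inl (min (blk i) (blk j), max (blk i) (blk j)) \<in> coords"
      unfolding coords_def using cross by (intro UnI1 imageI) auto
    then show ?thesis unfolding eq by (intro tame_mult tame_coord tame_const)
  next
    case other
    then have eq: "(\<lambda>(s :: real) x. wtx x i j) = (\<lambda>s x. - 1)"
      by (intro ext) (auto simp: wtx_def wt_def)
    show ?thesis unfolding eq by (rule tame_const)
  next
    case diag
    then have eq: "(\<lambda>(s :: real) x. wtx x i j) = (\<lambda>s x. x (Inl (i, i)))"
      by (intro ext) (auto simp: wtx_def wt_def)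
    have "Inl (i, i) \<in> coords" using diag by (simp add: coords_def)
    then show ?thesis unfolding eq by (rule tame_coord)
  next
    case zero
    then have eq: "(\<lambda>(s :: real) x. wtx x i j) = (\<lambda>s x. 0)"
      by (intro ext) (auto simp: wtx_def wt_def)
    show ?thesis unfolding eq by (rule tame_const)
  qed
qed

lemma tame_zeta: "i < n \<Longrightarrow> b < h \<Longrightarrow> tame coords (\<lambda>s x. zeta x b i)"
  by (cases "h \<le> i") (auto simp: zeta_def coords_def intro: tame_coord tame_const)

lemma tame_corr: "b < h \<Longrightarrow> tame coords (\<lambda>s x. corr x a b)"
  unfolding corr_def dotp_def app_def
  by (intro tame_sum tame_mult tame_const tame_wtx tame_zeta) auto

lemma tame_leafsol: "tame coords (\<lambda>s x. leafsol 0 (corr x) a)"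
proof -
  have "tame coords (\<lambda>s x. (corr x k (k + 1) + corr x k (k + 2) - corr x (k + 1) (k + 2)) * inverse 2)"
    "tame coords (\<lambda>s x. (corr x k (k + 1) + corr x (k + 1) (k + 2) - corr x k (k + 2)) * inverse 2)"
    "tame coords (\<lambda>s x. (corr x k (k + 2) + corr x (k + 1) (k + 2) - corr x k (k + 1)) * inverse 2)"
    by (intro tame_mult tame_diff tame_add tame_corr tame_const; simp)+
  then show ?thesis unfolding leafsol_def divide_inverse
    by (cases "a = k"; cases "a = k + 1"; cases "a = k + 2") (auto simp: tame_const)
qed

lemma tame_incr:
  assumes "v \<in> coords"
  shows "tame coords (incr g v)"
proof -
  from assms consider a b where "v = Inl (a, b)" "a < h" "b < h" | i b where "v = Inr (i, b)" "h \<le> i" "i < n" "b < h"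
    by (auto simp: coords_def)
  then show ?thesis
  proof cases
    case 1
    have "incr g v = (\<lambda>s x. leafsol 0 (corr x) a + leafsol 0 (corr x) b - corr x a b)"
      by (simp add: incr_def 1(1) fun_eq_iff)
    then show ?thesis using tame_diff[OF tame_add[OF tame_leafsol tame_leafsol] tame_corr[OF 1(3)], of a b a] by simp
  next
    case 2
    have eq: "incr g v = (\<lambda>s x. 0 - (\<Sum>l\<in>{h..<n}. g i l * (\<Sum>j<n. wtx x l j * (prj b j + s * zeta x b j))))"
      by (simp add: incr_def 2(1) fun_eq_iff app_def col_def)
    show ?thesis unfolding eq
      by (intro tame_diff tame_sum tame_mult tame_add tame_const tame_param tame_wtx tame_zeta) (use 2 in auto)
  qed
qed

lemma finite_coords: "finite coords"
  by (simp add: coords_def)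

lemma dotp_prj_split:
  assumes "a < h"
  shows "dotp n (prj a) y = y a + (\<Sum>i\<in>{h..<n}. prj a i * y i)"
proof -
  have "{..<n} = {..<h} \<union> {h..<n}" using size by auto
  then have "dotp n (prj a) y = (\<Sum>i<h. prj a i * y i) + (\<Sum>i\<in>{h..<n}. prj a i * y i)"
    unfolding dotp_def by (simp add: sum.union_disjoint ivl_disj_int)
  also have "(\<Sum>i<h. prj a i * y i) = (\<Sum>i<h. if i = a then y a else 0)"
    by (intro sum.cong) (auto simp: prj_def blk_root)
  finally show ?thesis using assms by simp
qed

end

text \<open>A solution of the system for one parameter, with the two properties that hold once it is
  small: negative tuned entries, and definiteness on vectors that vanish at the
  representatives.\<close>

locale join_solution = join_minor +
  fixes s :: real and x :: "(nat \<times> nat) + (nat \<times> nat) \<Rightarrow> real"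
  assumes s: "0 < s"
    and sol_Inl: "\<And>a b. a \<le> b \<Longrightarrow> b < k + 3 \<Longrightarrow> a = b \<or> a < k \<Longrightarrow>
      x (Inl (a, b)) = - (beta s x a + beta s x b) - s * corr x a b"
    and sol_Inr: "\<And>i b. i < n \<Longrightarrow> k + 3 \<le> i \<Longrightarrow> b < k + 3 \<Longrightarrow>
      app n lap (zeta x b) i = - s * app n (wtx x) (col s x b) i"
    and neg_Inl: "\<And>a b. a < b \<Longrightarrow> b < k + 3 \<Longrightarrow> a < k \<Longrightarrow> x (Inl (a, b)) < 0"
    and pos_def: "\<And>w. (\<And>i. i < k + 3 \<Longrightarrow> w i = 0) \<Longrightarrow>
      bilin n (\<lambda>i j. lap i j + s\<^sup>2 * wtx x i j) w w \<le> 0 \<Longrightarrow> (\<And>i. i < n \<Longrightarrow> w i = 0)"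
begin

definition Mf :: "nat \<Rightarrow> nat \<Rightarrow> real"
  where "Mf i j = lap i j + s\<^sup>2 * wtx x i j"

lemma app_Mf: "app n Mf y i = app n lap y i + s\<^sup>2 * app n (wtx x) y i"
  unfolding app_def Mf_def by (simp add: algebra_simps sum.distrib sum_distrib_left)

lemma symf_Mf: "symf n Mf"
  using symf_lap symf_wt unfolding symf_def Mf_def wtx_def by simp

lemma app_Mf_col:
  assumes "b < h" "i < n"
  shows "app n Mf (col s x b) i = s * app n lap (zeta x b) i + s\<^sup>2 * app n (wtx x) (col s x b) i"
proof -
  have "app n lap (col s x b) i = app n lap (prj b) i + s * app n lap (zeta x b) i"
    unfolding col_def[abs_def] app_add app_scale ..
  then show ?thesis unfolding app_Mf using app_lap_prj[OF assms] by simp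
qed

lemma app_Mf_col_other: "b < h \<Longrightarrow> i < n \<Longrightarrow> h \<le> i \<Longrightarrow> app n Mf (col s x b) i = 0"
  using app_Mf_col[of b i] sol_Inr[of i b] by (simp add: power2_eq_square)

lemma app_Mf_col_root:
  assumes a: "a < h" and b: "b < h"
  shows "app n Mf (col s x b) a = s\<^sup>2 * (dotp n (prj a) (app n (wtx x) (prj b)) + s * corr x a b)"
proof -
  define y where "y = app n (wtx x) (col s x b)"
  \<comment> \<open>\<open>prj a\<close> is orthogonal to the image of \<open>lap\<close>, so the
    value at the representative is minus the sum over the rest of its branch set, which is known
    from the equations.\<close>
  have "0 = app n lap (zeta x b) a + (\<Sum>i\<in>{h..<n}. prj a i * app n lap (zeta x b) i)"
    using dotp_prj_lap[OF a, of "zeta x b"] dotp_prj_split[OF a] by simp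
  also have "(\<Sum>i\<in>{h..<n}. prj a i * app n lap (zeta x b) i) = (\<Sum>i\<in>{h..<n}. - s * (prj a i * y i))"
    by (intro sum.cong) (auto simp: sol_Inr b y_def)
  also have "\<dots> = - s * (\<Sum>i\<in>{h..<n}. prj a i * y i)" by (simp only: sum_distrib_left)
  finally have "app n lap (zeta x b) a = s * (\<Sum>i\<in>{h..<n}. prj a i * y i)" by simp
  then have "app n Mf (col s x b) a = s\<^sup>2 * (y a + (\<Sum>i\<in>{h..<n}. prj a i * y i))"
    using app_Mf_col[OF b, of a] a size by (simp add: y_def power2_eq_square algebra_simps)
  also have "\<dots> = s\<^sup>2 * dotp n (prj a) y" using dotp_prj_split[OF a] by simp
  also have "dotp n (prj a) y = dotp n (prj a) (app n (wtx x) (prj b)) + s * corr x a b"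
    unfolding y_def corr_def col_def[abs_def] app_add app_scale dotp_add_right dotp_scale_right ..
  finally show ?thesis .
qed

lemma dotp_col:
  assumes b: "b < h" and y: "\<And>i. i < n \<Longrightarrow> h \<le> i \<Longrightarrow> y i = 0"
  shows "dotp n (col s x b) y = y b"
proof -
  have "dotp n (col s x b) y = (\<Sum>i<n. if i = b then y b else 0)"
    unfolding dotp_def by (intro sum.cong) (auto simp: col_def zeta_def prj_def blk_root y not_le)
  then show ?thesis using b size by simp
qed

lemma reduced_commute:
  assumes "a < h" "b < h"
  shows "app n Mf (col s x b) a = app n Mf (col s x a) b"
proof -
  have "app n Mf (col s x b) a = bilin n Mf (col s x a) (col s x b)"
    unfolding bilin_def using dotp_col[OF assms(1)] app_Mf_col_other[OF assms(2)] by simp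
  also have "\<dots> = bilin n Mf (col s x b) (col s x a)" by (rule bilin_commute[OF symf_Mf])
  also have "\<dots> = app n Mf (col s x a) b"
    unfolding bilin_def using dotp_col[OF assms(2)] app_Mf_col_other[OF assms(1)] by simp
  finally show ?thesis .
qed

text \<open>For pairs of leaves this holds by the choice of \<open>beta\<close>, for all other pairs
  by the choice of the weights.\<close>

lemma reduced_matrix:
  assumes a: "a < h" and b: "b < h"
  shows "app n Mf (col s x b) a = - s\<^sup>2 * (beta s x a + beta s x b)"
proof -
  have le: "app n Mf (col s x b) a = - s\<^sup>2 * (beta s x a + beta s x b)" if ab: "a \<le> b" "b < h" for a b
  proof -
    have a: "a < h" using ab by simp
    have "dotp n (prj a) (app n (wtx x) (prj b)) + s * corr x a b = - (beta s x a + beta s x b)"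
    proof (cases "a = b \<or> a < k")
      case True
      have "dotp n (prj a) (app n (wtx x) (prj b)) = x (Inl (a, b))"
      proof (cases "a = b")
        case True
        then show ?thesis using reduced_wt_diag[OF a] by (simp add: wtx_def)
      next
        case False
        then show ?thesis using reduced_wt_core[OF a ab(2), of "\<lambda>p. x (Inl p)"] True ab by (simp add: wtx_def)
      qed
      then show ?thesis using sol_Inl[OF ab True] by simp
    next
      case False
      then have lf: "k \<le> a" "a < b" using ab by auto
      have "dotp n (prj a) (app n (wtx x) (prj b)) = - ecount a b"
        unfolding wtx_def by (rule reduced_wt_leaf) (use a ab lf in auto)
      then show ?thesis using leafsol_pair[OF lf ab(2), of core_val "\<lambda>a b. ecount a b - s * corr x a b"]
        by (simp add: beta_def)
    qed
    then have "app n Mf (col s x b) a = s\<^sup>2 * (- (beta s x a + beta s x b))"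
      unfolding app_Mf_col_root[OF a ab(2)] by (rule arg_cong)
    then show ?thesis by (simp only: mult_minus_left mult_minus_right)
  qed
  show ?thesis
  proof (cases "a \<le> b")
    case True
    then show ?thesis using le b by blast
  next
    case False
    then show ?thesis using le[of b a] a reduced_commute[OF a b] by (simp add: add.commute)
  qed
qed

text \<open>Extends values at the representatives so that the image under \<open>Mf\<close> vanishes
  at all other vertices.\<close>

definition lift :: "(nat \<Rightarrow> real) \<Rightarrow> nat \<Rightarrow> real"
  where "lift y i = (\<Sum>b<h. y b * col s x b i)"

lemma lift_root: "a < h \<Longrightarrow> lift y a = y a"
proof -
  assume a: "a < h"
  have "lift y a = (\<Sum>b<h. if b = a then y a else 0)"
    unfolding lift_def by (intro sum.cong) (use a in \<open>auto simp: col_def zeta_def prj_def blk_root\<close>)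
  then show ?thesis using a by simp
qed

lemma app_lift: "app n A (lift y) i = (\<Sum>b<h. y b * app n A (col s x b) i)"
proof -
  have "app n A (lift y) i = (\<Sum>j<n. \<Sum>b<h. y b * (A i j * col s x b j))"
    unfolding app_def lift_def by (simp add: sum_distrib_left mult_ac)
  also have "\<dots> = (\<Sum>b<h. \<Sum>j<n. y b * (A i j * col s x b j))" by (rule sum.swap)
  finally show ?thesis by (simp add: app_def sum_distrib_left)
qed

lemma app_Mf_lift_other: "i < n \<Longrightarrow> h \<le> i \<Longrightarrow> app n Mf (lift y) i = 0"
  unfolding app_lift by (intro sum.neutral) (simp add: app_Mf_col_other)

lemma app_Mf_lift_root:
  assumes "a < h"
  shows "app n Mf (lift y) a = - s\<^sup>2 * (beta s x a * (\<Sum>b<h. y b) + (\<Sum>b<h. beta s x b * y b))"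
proof -
  have "app n Mf (lift y) a = (\<Sum>b<h. - s\<^sup>2 * (beta s x a * y b + beta s x b * y b))"
    unfolding app_lift by (intro sum.cong) (auto simp: reduced_matrix assms algebra_simps)
  then show ?thesis by (simp only: sum_distrib_left[symmetric] sum.distrib)
qed

definition Mm :: "real mat"
  where "Mm = mat n n (\<lambda>(i, j). Mf i j)"

lemma Mm_carrier: "Mm \<in> carrier_mat n n"
  by (simp add: Mm_def)

lemma entries_Mm: "i < n \<Longrightarrow> j < n \<Longrightarrow> entries Mm i j = Mf i j"
  by (simp add: entries_def Mm_def)

lemma Mm_symmetric: "Mm\<^sup>T = Mm"
  using symf_Mf by (intro eq_matI) (auto simp: Mm_def symf_def)

lemma app_Mm: "i < n \<Longrightarrow> app n (entries Mm) y i = app n Mf y i"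
  unfolding app_def by (intro sum.cong) (auto simp: entries_Mm)

lemma bilin_Mm: "bilin n (entries Mm) y z = bilin n Mf y z"
  unfolding bilin_def by (intro dotp_cong) (auto simp: app_Mm)

lemma Mm_edge:
  assumes "i < n" "j < n" "(i, j) \<in> E"
  shows "entries Mm i j < 0"
proof -
  have ij: "i \<noteq> j" using assms irreflE by auto
  have s2: "s\<^sup>2 > 0" using s by simp
  show ?thesis
  proof (cases "blk i \<noteq> blk j \<or> \<not> blk i < h")
    case True
    then have lap0: "lap i j = 0" using ij by (simp add: lap_def inner_def)
    have "wtx x i j < 0"
    proof (cases "blk i < h \<and> blk j < h \<and> (blk i < k \<or> blk j < k)")
      case core: True
      then have ne: "blk i \<noteq> blk j" using True by auto
      have "x (Inl (min (blk i) (blk j), max (blk i) (blk j))) < 0"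
        by (rule neg_Inl) (use core ne in auto)
      moreover have "inverse (ecount (blk i) (blk j)) > 0" using ecount_pos[of "blk i" "blk j"] core ne by simp
      ultimately show ?thesis using core True assms(3) by (simp add: wtx_def wt_def mult_neg_pos)
    next
      case False
      have "wtx x i j = - 1"
        unfolding wtx_def wt_def using False True assms(3) by auto
      then show ?thesis by simp
    qed
    then show ?thesis using lap0 s2 assms by (simp add: entries_Mm Mf_def mult_pos_neg)
  next
    case False
    then have "wtx x i j = 0" using ij by (simp add: wtx_def wt_def)
    moreover have "lap i j = - 1" using False ij assms(3) by (simp add: lap_def inner_def)
    ultimately show ?thesis using assms by (simp add: entries_Mm Mf_def)
  qed
qed

lemma Mm_non_edge:
  assumes "i < n" "j < n" "i \<noteq> j" "(i, j) \<notin> E"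
  shows "entries Mm i j = 0"
  using assms by (simp add: entries_Mm Mf_def lap_def inner_def wtx_def wt_def)

text \<open>The reduced matrix kills every \<open>y\<close> with sum 0 and
  \<open>beta\<close>-weighted sum 0. These two conditions, indexed by \<open>bool\<close>, and
  \<open>k\<close> functionals leave a nonzero \<open>y\<close> on k + 3 representatives, and its
  lift is a kernel vector.\<close>

lemma kernel_dim_Mm: "kernel_dim Mm > k"
proof (rule kernel_dim_greater[OF Mm_carrier Mm_symmetric])
  fix Z :: "nat set" and c :: "nat \<Rightarrow> nat \<Rightarrow> real"
  assume Z: "finite Z" "card Z \<le> k"
  define a :: "nat + bool \<Rightarrow> nat \<Rightarrow> real" where "a z b = (case z of Inl z \<Rightarrow> dotp n (c z) (col s x b)
    | Inr t \<Rightarrow> if t then 1 else beta s x b)" for z b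
  have "card (Z <+> (UNIV :: bool set)) = card Z + 2" using Z by (simp add: card_Plus)
  then obtain y where y: "\<exists>b\<in>{..<h}. y b \<noteq> 0" "\<forall>z\<in>Z <+> (UNIV :: bool set). (\<Sum>b<h. a z b * y b) = 0"
    using homogeneous_system[of "Z <+> (UNIV :: bool set)" "{..<h}" a] Z by auto
  have "Inr t \<in> Z <+> (UNIV :: bool set)" for t by (rule InrI) simp
  then have *: "(\<Sum>b<h. a (Inr t) b * y b) = 0" for t using y(2) by blast
  have sum0: "(\<Sum>b<h. y b) = 0" using *[of True] by (simp add: a_def)
  have beta0: "(\<Sum>b<h. beta s x b * y b) = 0" using *[of False] by (simp add: a_def)
  have "app n (entries Mm) (lift y) i = 0" if i: "i < n" for i
    unfolding app_Mm[OF i] using app_Mf_lift_other[OF i] app_Mf_lift_root[of i y] sum0 beta0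
    by (cases "h \<le> i") auto
  moreover have "\<exists>i<n. lift y i \<noteq> 0"
  proof -
    obtain b where b: "b < h" "y b \<noteq> 0" using y(1) by auto
    then show ?thesis using size by (intro exI[of _ b]) (simp add: lift_root)
  qed
  moreover have "dotp n (c z) (lift y) = 0" if "z \<in> Z" for z
  proof -
    have "dotp n (c z) (lift y) = app n (\<lambda>_. c z) (lift y) 0" by (simp add: dotp_def app_def)
    also have "\<dots> = (\<Sum>b<h. a (Inl z) b * y b)"
      unfolding app_lift by (simp add: a_def dotp_def app_def mult_ac)
    also have "\<dots> = 0" using y(2) that by blast
    finally show ?thesis .
  qed
  ultimately show "\<exists>x. (\<exists>i<n. x i \<noteq> 0) \<and> (\<forall>i<n. app n (entries Mm) x i = 0) \<and> (\<forall>z\<in>Z. dotp n (c z) x = 0)"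
    by blast
qed

lemma beta_core: "b < k \<Longrightarrow> beta s x b = core_val"
  by (simp add: beta_def leafsol_def)

lemma core_val_pos: "core_val > 0"
  unfolding core_val_def using ecount_nonneg[of k "k + 1"] ecount_nonneg[of k "k + 2"] ecount_nonneg[of "k + 1" "k + 2"]
  by linarith

text \<open>A vector whose values at the representatives sum to 0 splits orthogonally into a lift,
  where the form is 0, and a vector vanishing at the representatives, where it is nonnegative.
  Column 0 belongs to a core vertex and is negative.\<close>

lemma one_negative_Mm: "one_negative_eigenvalue Mm"
proof (rule one_negative_eigenvalueI[OF Mm_carrier Mm_symmetric])
  define u :: "nat \<Rightarrow> real" where "u i = (if i < h then 1 else 0)" for i
  have h0: "0 < h" "(0 :: nat) < k" using k by auto
  have "bilin n Mf (col s x 0) (col s x 0) = app n Mf (col s x 0) 0"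
    unfolding bilin_def using dotp_col[OF h0(1)] app_Mf_col_other[OF h0(1)] by simp
  also have "\<dots> < 0"
    using reduced_matrix[OF h0(1) h0(1)] beta_core[OF h0(2)] core_val_pos s by (simp add: mult_pos_neg)
  finally show "bilin n (entries Mm) (col s x 0) (col s x 0) < 0" by (simp add: bilin_Mm)
  fix v assume uv: "dotp n u v = 0"
  have "dotp n u v = (\<Sum>a<h. v a)"
    unfolding dotp_def u_def by (rule sum.mono_neutral_cong_right) (use size in auto)
  then have sum0: "(\<Sum>a<h. v a) = 0" using uv by simp
  define y where "y = lift v"
  define w where "w i = v i - y i" for i
  have w0: "w i = 0" if "i < h" for i using that by (simp add: w_def y_def lift_root)
  have wy: "bilin n Mf w y = 0"
    unfolding bilin_def dotp_def
  proof (rule sum.neutral, rule ballI)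
    fix i assume "i \<in> {..<n}"
    then show "w i * app n Mf y i = 0" using w0[of i] app_Mf_lift_other[of i v] by (cases "i < h") (auto simp: y_def)
  qed
  have "bilin n Mf y y = (\<Sum>i<n. y i * app n Mf y i)" by (simp add: bilin_def dotp_def)
  also have "\<dots> = (\<Sum>a<h. v a * app n Mf y a)"
    by (rule sum.mono_neutral_cong_right) (use size app_Mf_lift_other[of _ v] in \<open>auto simp: y_def lift_root\<close>)
  also have "\<dots> = (\<Sum>a<h. v a * (- s\<^sup>2 * (\<Sum>b<h. beta s x b * v b)))"
    by (intro sum.cong) (auto simp: y_def app_Mf_lift_root sum0)
  also have "\<dots> = (\<Sum>a<h. v a) * (- s\<^sup>2 * (\<Sum>b<h. beta s x b * v b))" by (simp only: sum_distrib_right)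
  finally have yy: "bilin n Mf y y = 0" using sum0 by simp
  have ww: "bilin n Mf w w \<ge> 0"
  proof (rule ccontr)
    assume neg: "\<not> bilin n Mf w w \<ge> 0"
    then have "bilin n (\<lambda>i j. lap i j + s\<^sup>2 * wtx x i j) w w \<le> 0" by (simp add: Mf_def[abs_def])
    then have "w i = 0" if "i < n" for i using pos_def[of w] w0 that by blast
    then have "bilin n Mf w w = 0" by (simp add: bilin_def dotp_def)
    then show False using neg by simp
  qed
  have "v = (\<lambda>i. w i + y i)" by (simp add: w_def fun_eq_iff)
  then have "bilin n Mf v v = bilin n Mf w w + 2 * bilin n Mf w y + bilin n Mf y y"
    using bilin_commute[OF symf_Mf, of y w] by (simp add: bilin_add_left bilin_add_right)
  then show "bilin n (entries Mm) v v \<ge> 0" using wy yy ww by (simp add: bilin_Mm)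
qed

end

lemma sum_lessThan_plus_3:
  fixes f :: "nat \<Rightarrow> real"
  shows "(\<Sum>b<k + 3. f b) = (\<Sum>b<k. f b) + f k + f (k + 1) + f (k + 2)"
  by (simp add: numeral_3_eq_3)

section \<open>The limit of vanishing parameter and the strong Arnold property\<close>

context join_minor
begin

abbreviation beta0 :: "nat \<Rightarrow> real"
  where "beta0 \<equiv> leafsol core_val ecount"

lemma beta0_bounds:
  "beta0 b \<ge> 1 - core_val" "k \<le> b \<Longrightarrow> b < h \<Longrightarrow> beta0 b < core_val"
  using ecount_nonneg[of k "k + 1"] ecount_nonneg[of k "k + 2"] ecount_nonneg[of "k + 1" "k + 2"]
  by (auto simp: leafsol_def core_val_def)

lemma start_Inl_le: "a < k \<Longrightarrow> start (Inl (a, b)) \<le> - 1"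
  using beta0_bounds(1)[of b] by (simp add: start_def leafsol_def)

lemma reduced_start:
  assumes "a < h" "b < h"
  shows "dotp n (prj a) (app n (wtx start) (prj b)) = - (beta0 a + beta0 b)"
proof -
  have le: "dotp n (prj a) (app n (wtx start) (prj b)) = - (beta0 a + beta0 b)" if ab: "a \<le> b" "b < h" for a b
  proof -
    have a: "a < h" using ab by simp
    consider "a = b" | "a \<noteq> b" "a < k" | "k \<le> a" "a < b" using ab by linarith
    then show ?thesis
    proof cases
      case 1
      then show ?thesis using reduced_wt_diag[OF a] by (simp add: wtx_def start_def)
    next
      case 2
      then show ?thesis
        using reduced_wt_core[OF a ab(2), of "\<lambda>p. start (Inl p)"] ab by (simp add: wtx_def start_def)
    next
      case 3
      then show ?thesis
        using reduced_wt_leaf[OF a ab(2), of "\<lambda>p. start (Inl p)"] leafsol_pair[OF 3 ab(2), of core_val ecount]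
        by (simp add: wtx_def)
    qed
  qed
  show ?thesis
  proof (cases "a \<le> b")
    case False
    have "dotp n (prj a) (app n (wtx start) (prj b)) = dotp n (prj b) (app n (wtx start) (prj a))"
      using dotp_app_commute[OF symf_wt, of "\<lambda>p. start (Inl p)" "prj a" "prj b"]
      by (simp add: wtx_def dotp_commute)
    then show ?thesis using le[of b a] False assms by simp
  qed (use le assms in auto)
qed

lemma wtx_tendsto:
  assumes X: "\<And>v. v \<in> coords \<Longrightarrow> (\<lambda>m. X m v) \<longlonglongrightarrow> x v" and ij: "i < n" "j < n"
  shows "(\<lambda>m. wtx (X m) i j) \<longlonglongrightarrow> wtx x i j"
proof -
  consider (cross) "(i, j) \<in> E \<and> (blk i \<noteq> blk j \<or> \<not> blk i < h)" "blk i < h \<and> blk j < h \<and> (blk i < k \<or> blk j < k)"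
    | (other) "(i, j) \<in> E \<and> (blk i \<noteq> blk j \<or> \<not> blk i < h)" "\<not> (blk i < h \<and> blk j < h \<and> (blk i < k \<or> blk j < k))"
    | (diag) "\<not> ((i, j) \<in> E \<and> (blk i \<noteq> blk j \<or> \<not> blk i < h))" "i = j \<and> i < h"
    | (zero) "\<not> ((i, j) \<in> E \<and> (blk i \<noteq> blk j \<or> \<not> blk i < h))" "\<not> (i = j \<and> i < h)" by blast
  then show ?thesis
  proof cases
    case cross
    then have eq: "wtx y i j = y (Inl (min (blk i) (blk j), max (blk i) (blk j))) * inverse (ecount (blk i) (blk j))" for y
      by (auto simp: wtx_def wt_def)
    have "Inl (min (blk i) (blk j), max (blk i) (blk j)) \<in> coords"
      unfolding coords_def using cross by (intro UnI1 imageI) auto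
    then show ?thesis unfolding eq by (intro tendsto_mult X tendsto_const)
  next
    case other
    then have eq: "wtx y i j = - 1" for y by (auto simp: wtx_def wt_def)
    show ?thesis unfolding eq by (rule tendsto_const)
  next
    case diag
    then have eq: "wtx y i j = y (Inl (i, i))" for y by (auto simp: wtx_def wt_def)
    have "Inl (i, i) \<in> coords" using diag by (simp add: coords_def)
    then show ?thesis unfolding eq by (rule X)
  next
    case zero
    then have eq: "wtx y i j = 0" for y by (auto simp: wtx_def wt_def)
    show ?thesis unfolding eq by (rule tendsto_const)
  qed
qed

lemma app_tendsto:
  assumes "\<And>j. j < n \<Longrightarrow> (\<lambda>m. A m i j) \<longlonglongrightarrow> a i j" "\<And>j. j < n \<Longrightarrow> (\<lambda>m. Y m j) \<longlonglongrightarrow> y j"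
  shows "(\<lambda>m. app n (A m) (Y m) i) \<longlonglongrightarrow> app n a y i"
  unfolding app_def by (intro tendsto_intros assms) auto

lemma dotp_tendsto:
  assumes "\<And>j. j < n \<Longrightarrow> (\<lambda>m. X m j) \<longlonglongrightarrow> x j" "\<And>j. j < n \<Longrightarrow> (\<lambda>m. Y m j) \<longlonglongrightarrow> y j"
  shows "(\<lambda>m. dotp n (X m) (Y m)) \<longlonglongrightarrow> dotp n x y"
  unfolding dotp_def by (intro tendsto_intros assms) auto

text \<open>The strong Arnold property of the limit: \<open>Z\<close> is constant on pairs of branch sets and hence
  reduces to a symmetric matrix that is supported on the three leaves and has vanishing row sums.\<close>

lemma limit_arnold:
  assumes symZ: "\<And>i j. i < n \<Longrightarrow> j < n \<Longrightarrow> Z (i, j) = Z (j, i)"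
    and lapZ: "\<And>i j. i < n \<Longrightarrow> j < n \<Longrightarrow> app n lap (\<lambda>l. Z (l, j)) i = 0"
    and redZ: "\<And>a j. a < h \<Longrightarrow> j < n \<Longrightarrow> dotp n (prj a) (app n (wtx start) (\<lambda>l. Z (l, j))) = 0"
    and patZ: "\<And>i j. i < n \<Longrightarrow> j < n \<Longrightarrow> i = j \<or> (i, j) \<in> E \<Longrightarrow> Z (i, j) = (0 :: real)"
    and ij: "i < n" "j < n"
  shows "Z (i, j) = 0"
proof -
  have hn: "a < n" if "a < h" for a using that size by simp
  have null: "bilin n lap (\<lambda>l. Z (l, j)) (\<lambda>l. Z (l, j)) \<le> 0" if "j < n" for j
    unfolding bilin_def dotp_def using lapZ that by simp
  have const: "Z (i, j) = Z (blk i, j)" if "i < n" "j < n" "blk i < h" for i j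
    using lap_null_constant(1)[OF null[OF that(2)] that(1,3)] .
  have const2: "Z (i, j) = Z (blk i, blk j)" if "i < n" "j < n" "blk i < h" "blk j < h" for i j
    using const[OF that(1,2,3)] const[OF that(2) hn[OF that(3)] that(4)]
      symZ[OF hn[OF that(3)] that(2)] symZ[OF hn[OF that(3)] hn[OF that(4)]] by simp
  have zero: "Z (i, j) = 0" if "i < n" "j < n" "blk i = h" for i j
    using lap_null_constant(2)[OF null[OF that(2)] that(1,3)] .
  have core: "Z (a, b) = 0" if ab: "a < h" "b < h" "a = b \<or> a < k \<or> b < k" for a b
  proof (cases "a = b")
    case True
    then show ?thesis using patZ[OF hn[OF ab(1)] hn[OF ab(2)]] by simp
  next
    case False
    then obtain i j where ij: "i < n" "j < n" "blk i = a" "blk j = b" "(i, j) \<in> E"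
      using branch_adj[OF ab(1,2)] ab(3) by blast
    then have "Z (i, j) = Z (a, b)" using const2[of i j] ab(1,2) by simp
    then show ?thesis using patZ[OF ij(1,2)] ij(5) by simp
  qed
  \<comment> \<open>Every row \<open>a\<close> gives one equation between the plain and the weighted
    sum of a column. Subtracting a leaf row from a core row, where \<open>beta0\<close> differs,
    shows that the plain sum is 0.\<close>
  have rowsum: "(\<Sum>b<h. Z (b, j)) = 0" if j: "j < n" for j
  proof -
    have Zj: "Z (l, j) = (\<Sum>b<h. Z (b, j) * prj b l)" if l: "l < n" for l
    proof (cases "blk l < h")
      case True
      have "(\<Sum>b<h. Z (b, j) * prj b l) = (\<Sum>b<h. if b = blk l then Z (b, j) else 0)"
        by (intro sum.cong) (auto simp: prj_def)
      then show ?thesis using True const[OF l j True] by simp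
    next
      case False
      then have "blk l = h" using blk_le[OF l] by simp
      then show ?thesis using zero[OF l j] by (auto simp: prj_def intro!: sum.neutral[symmetric])
    qed
    have eq: "beta0 a * (\<Sum>b<h. Z (b, j)) + (\<Sum>b<h. beta0 b * Z (b, j)) = 0" if a: "a < h" for a
    proof -
      have "app n (wtx start) (\<lambda>l. Z (l, j)) i = (\<Sum>b<h. Z (b, j) * app n (wtx start) (prj b) i)" for i
      proof -
        have "app n (wtx start) (\<lambda>l. Z (l, j)) i = (\<Sum>l<n. \<Sum>b<h. Z (b, j) * (wtx start i l * prj b l))"
          unfolding app_def by (intro sum.cong) (auto simp: Zj sum_distrib_left mult_ac)
        also have "\<dots> = (\<Sum>b<h. \<Sum>l<n. Z (b, j) * (wtx start i l * prj b l))" by (rule sum.swap)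
        finally show ?thesis by (simp add: app_def sum_distrib_left)
      qed
      then have "dotp n (prj a) (app n (wtx start) (\<lambda>l. Z (l, j))) =
        (\<Sum>i<n. \<Sum>b<h. Z (b, j) * (prj a i * app n (wtx start) (prj b) i))"
        by (simp add: dotp_def sum_distrib_left mult_ac)
      also have "\<dots> = (\<Sum>b<h. \<Sum>i<n. Z (b, j) * (prj a i * app n (wtx start) (prj b) i))" by (rule sum.swap)
      also have "\<dots> = (\<Sum>b<h. Z (b, j) * dotp n (prj a) (app n (wtx start) (prj b)))"
        by (simp add: dotp_def sum_distrib_left)
      also have "\<dots> = (\<Sum>b<h. - (beta0 a * Z (b, j) + beta0 b * Z (b, j)))"
        by (intro sum.cong) (auto simp: reduced_start[OF a] algebra_simps)
      also have "\<dots> = - (beta0 a * (\<Sum>b<h. Z (b, j)) + (\<Sum>b<h. beta0 b * Z (b, j)))"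
        by (simp only: sum_negf sum.distrib sum_distrib_left)
      finally show ?thesis using redZ[OF a j] by simp
    qed
    have "0 < h" "k < h" by auto
    from eq[OF this(1)] eq[OF this(2)] have "(beta0 0 - beta0 k) * (\<Sum>b<h. Z (b, j)) = 0"
      unfolding left_diff_distrib by linarith
    moreover have "beta0 0 - beta0 k \<noteq> 0"
      using beta0_bounds(2)[of k] k by (simp add: leafsol_def)
    ultimately show ?thesis by simp
  qed
  have leaf_sum: "Z (k, c) + Z (k + 1, c) + Z (k + 2, c) = 0" if c: "c < h" for c
  proof -
    have "(\<Sum>b<k. Z (b, c)) = 0" by (intro sum.neutral) (use core c in auto)
    then show ?thesis using rowsum[OF hn[OF c]] unfolding sum_lessThan_plus_3 by simp
  qed
  have hk: "k < h" "k + 1 < h" "k + 2 < h" by auto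
  have d: "Z (k, k) = 0" "Z (k + 1, k + 1) = 0" "Z (k + 2, k + 2) = 0" using core hk by auto
  have sy: "Z (k + 1, k) = Z (k, k + 1)" "Z (k + 2, k) = Z (k, k + 2)" "Z (k + 2, k + 1) = Z (k + 1, k + 2)"
    using symZ hn hk by blast+
  \<comment> \<open>With zero diagonal the three remaining entries have pairwise sums 0, so they
    vanish; here again three leaves are what makes the system regular.\<close>
  have leaf: "Z (k, k + 1) = 0" "Z (k, k + 2) = 0" "Z (k + 1, k + 2) = 0"
    using leaf_sum[OF hk(1)] leaf_sum[OF hk(2)] leaf_sum[OF hk(3)] d sy by linarith+
  have all: "Z (a, b) = 0" if ab: "a < h" "b < h" for a b
  proof (cases "a = b \<or> a < k \<or> b < k")
    case False
    then have "a = k \<or> a = k + 1 \<or> a = k + 2" "b = k \<or> b = k + 1 \<or> b = k + 2" using ab by linarith+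
    then show ?thesis using leaf sy d by (elim disjE) simp_all
  qed (use core ab in blast)
  show ?thesis
  proof (cases "blk i = h \<or> blk j = h")
    case True
    then show ?thesis using zero[OF ij] zero[OF ij(2,1)] symZ[OF ij] by auto
  next
    case False
    then have "blk i < h" "blk j < h" using blk_le[OF ij(1)] blk_le[OF ij(2)] by auto
    then show ?thesis using const2[OF ij] all by simp
  qed
qed

theorem large_corank_matrix_exists:
  "\<exists>M. M \<in> carrier_mat n n \<and> M\<^sup>T = M \<and> (\<forall>i<n. \<forall>j<n. (i, j) \<in> E \<longrightarrow> entries M i j < 0) \<and>
    (\<forall>i<n. \<forall>j<n. i \<noteq> j \<and> (i, j) \<notin> E \<longrightarrow> entries M i j = 0) \<and>
    one_negative_eigenvalue M \<and> k < kernel_dim M \<and>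
    (\<forall>X. (\<forall>i<n. \<forall>j<n. X i j = X j i) \<and> (\<forall>i<n. \<forall>j<n. app n (entries M) (\<lambda>l. X l j) i = 0) \<and>
      (\<forall>i<n. \<forall>j<n. i = j \<or> (i, j) \<in> E \<longrightarrow> X i j = 0) \<longrightarrow> (\<forall>i<n. \<forall>j<n. X i j = 0))"
proof -
  obtain g where g: "\<And>i l. i \<in> {h..<n} \<Longrightarrow> l \<in> {h..<n} \<Longrightarrow>
    (\<Sum>j\<in>{h..<n}. lap i j * g j l) = (if i = l then 1 else 0)" using lap_inverse_exists by blast
  have "\<exists>C s0. 0 < s0 \<and> s0 \<le> 1 \<and> (\<forall>s. 0 < s \<longrightarrow> s \<le> s0 \<longrightarrow>
    (\<exists>x. \<forall>v\<in>coords. x v = start v + s * incr g v s x \<and> \<bar>x v - start v\<bar> \<le> C * s))"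
    by (rule tame_fixpoint[where I = coords and q = "incr g" and ?x0.0 = start]) (fact finite_coords, rule tame_incr)
  then obtain C s0 where s0: "0 < s0" and fix_ex: "\<forall>s. 0 < s \<longrightarrow> s \<le> s0 \<longrightarrow>
    (\<exists>x. \<forall>v\<in>coords. x v = start v + s * incr g v s x \<and> \<bar>x v - start v\<bar> \<le> C * s)"
    by (elim exE conjE) (rule that)
  \<comment> \<open>A sequence of admissible parameters tending to 0, to which the compactness lemma
    applies; one late member is used in the end.\<close>
  define sm where "sm m = s0 * inverse (real (Suc m))" for m
  have sm: "0 < sm m" "sm m \<le> s0" for m using s0 by (auto simp: sm_def field_simps)
  have sm_lim: "sm \<longlonglongrightarrow> 0" unfolding sm_def
    using tendsto_mult[OF tendsto_const LIMSEQ_inverse_real_of_nat, of s0] by simp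
  have "\<forall>m. \<exists>x. \<forall>v\<in>coords. x v = start v + sm m * incr g v (sm m) x \<and> \<bar>x v - start v\<bar> \<le> C * sm m"
    using fix_ex sm by simp
  from choice[OF this] obtain X where X_all:
    "\<forall>m. \<forall>v\<in>coords. X m v = start v + sm m * incr g v (sm m) (X m) \<and> \<bar>X m v - start v\<bar> \<le> C * sm m" ..
  have X: "X m v = start v + sm m * incr g v (sm m) (X m)" "\<bar>X m v - start v\<bar> \<le> C * sm m"
    if "v \<in> coords" for m v
    using X_all that by blast+
  have X_lim: "(\<lambda>m. X m v) \<longlonglongrightarrow> start v" if "v \<in> coords" for v
  proof -
    have lim0: "(\<lambda>m. C * sm m) \<longlonglongrightarrow> 0" using tendsto_mult[OF tendsto_const[of C] sm_lim] by simp
    have "(\<lambda>m. X m v - start v) \<longlonglongrightarrow> 0"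
    proof (rule tendsto_0_le[OF lim0])
      have "\<bar>X m v - start v\<bar> \<le> \<bar>C * sm m\<bar> * 1" for m
        using X(2)[OF that, of m] by linarith
      then show "\<forall>\<^sub>F m in sequentially. norm (X m v - start v) \<le> norm (C * sm m) * 1"
        by (simp only: real_norm_def eventually_True)
    qed
    from tendsto_add[OF this tendsto_const[of "start v"]] show ?thesis by simp
  qed
  define A where "A m i j = lap i j + (sm m)\<^sup>2 * wtx (X m) i j" for m i j
  have W_lim: "(\<lambda>m. wtx (X (r m)) i j) \<longlonglongrightarrow> wtx start i j"
    if r: "strict_mono (r :: nat \<Rightarrow> nat)" and ij: "i < n" "j < n" for r i j
  proof (rule wtx_tendsto[where X = "\<lambda>m. X (r m)" and x = start, OF _ ij])
    fix v assume "v \<in> coords"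
    from LIMSEQ_subseq_LIMSEQ[OF X_lim[OF this] r] show "(\<lambda>m. X (r m) v) \<longlonglongrightarrow> start v"
      unfolding o_def .
  qed
  have A_lim: "(\<lambda>m. A (r m) i j) \<longlonglongrightarrow> lap i j"
    if r: "strict_mono (r :: nat \<Rightarrow> nat)" and ij: "i < n" "j < n" for r i j
  proof -
    have "(\<lambda>m. sm (r m)) \<longlonglongrightarrow> 0" using LIMSEQ_subseq_LIMSEQ[OF sm_lim r] unfolding o_def .
    from tendsto_add[OF tendsto_const[of "lap i j"] tendsto_mult[OF tendsto_power[OF this, of 2] W_lim[OF r ij]]]
    show ?thesis by (simp add: A_def)
  qed
  have app_A: "app n (A m) y i = app n lap y i + (sm m)\<^sup>2 * app n (wtx (X m)) y i" for m y i
    unfolding app_def A_def by (simp add: algebra_simps sum.distrib sum_distrib_left)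
  \<comment> \<open>Witnesses against definiteness on vectors that vanish at the
    representatives.\<close>
  define bad1 where "bad1 m w \<longleftrightarrow> (\<forall>i<h. w i = 0) \<and> bilin n (A m) w w \<le> 0" for m w
  have "\<exists>m0. \<forall>m\<ge>m0. \<forall>w. bad1 m w \<longrightarrow> (\<forall>i\<in>{..<n}. w i = 0)"
  proof (rule eventually_only_trivial)
    show "bad1 m (\<lambda>i. c * w i)" if "bad1 m w" for m w c
    proof -
      have "bilin n (A m) (\<lambda>i. c * w i) (\<lambda>i. c * w i) = c\<^sup>2 * bilin n (A m) w w"
        by (simp add: bilin_scale_left bilin_scale_right power2_eq_square)
      then show ?thesis using that by (simp add: bad1_def mult_nonneg_nonpos)
    qed
    fix r w l
    assume r: "strict_mono (r :: nat \<Rightarrow> nat)" and w: "\<And>m. bad1 (r m) (w m)"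
      and l: "\<And>i. i \<in> {..<n} \<Longrightarrow> (\<lambda>m. w m i) \<longlonglongrightarrow> l i"
    have "(\<lambda>m. bilin n (A (r m)) (w m) (w m)) \<longlonglongrightarrow> bilin n lap l l"
      unfolding bilin_def by (intro dotp_tendsto app_tendsto A_lim r) (use l in auto)
    then have null: "bilin n lap l l \<le> 0" by (rule LIMSEQ_le_const2) (use w in \<open>auto simp: bad1_def\<close>)
    have root: "l a = 0" if "a < h" for a
    proof -
      have "(\<lambda>m. w m a) = (\<lambda>m. 0)" using w that by (auto simp: bad1_def)
      then show ?thesis using l[of a] that size LIMSEQ_unique[OF _ tendsto_const, of 0 "l a"] by simp
    qed
    show "\<forall>i\<in>{..<n}. l i = 0"
    proof
      fix i assume "i \<in> {..<n}"
      then have i: "i < n" by simp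
      have "blk i < h \<or> blk i = h" using blk_le[OF i] by linarith
      then show "l i = 0" using lap_null_constant[OF null i] root by auto
    qed
  qed simp
  then obtain m1 where m1: "\<And>m w i. m \<ge> m1 \<Longrightarrow> bad1 m w \<Longrightarrow> i < n \<Longrightarrow> w i = 0" by auto
  \<comment> \<open>Witnesses against the strong Arnold property, with matrices as functions on
    pairs so that the compactness lemma applies.\<close>
  define bad2 where "bad2 m Y \<longleftrightarrow> (\<forall>i<n. \<forall>j<n. Y (i, j) = Y (j, i)) \<and>
    (\<forall>i<n. \<forall>j<n. app n (A m) (\<lambda>l. Y (l, j)) i = 0) \<and>
    (\<forall>i<n. \<forall>j<n. i = j \<or> (i, j) \<in> E \<longrightarrow> Y (i, j) = 0)" for m and Y :: "nat \<times> nat \<Rightarrow> real"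
  have "\<exists>m0. \<forall>m\<ge>m0. \<forall>Y. bad2 m Y \<longrightarrow> (\<forall>p\<in>{..<n} \<times> {..<n}. Y p = 0)"
  proof (rule eventually_only_trivial)
    show "bad2 m (\<lambda>p. c * Y p)" if "bad2 m Y" for m Y c
      using that by (simp add: bad2_def app_scale)
    fix r Y Z
    assume r: "strict_mono (r :: nat \<Rightarrow> nat)" and Y: "\<And>m. bad2 (r m) (Y m)"
      and Z: "\<And>p. p \<in> {..<n} \<times> {..<n} \<Longrightarrow> (\<lambda>m. Y m p) \<longlonglongrightarrow> Z p"
    have Zl: "(\<lambda>m. Y m (i, j)) \<longlonglongrightarrow> Z (i, j)" if "i < n" "j < n" for i j using Z that by simp
    have "Z (i, j) = 0" if ij: "i < n" "j < n" for i j
    proof (rule limit_arnold[OF _ _ _ _ ij])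
      show "Z (i, j) = Z (j, i)" if "i < n" "j < n" for i j
      proof -
        have "(\<lambda>m. Y m (i, j)) = (\<lambda>m. Y m (j, i))" using Y that unfolding bad2_def by blast
        then show ?thesis using Zl[OF that] Zl[OF that(2,1)] LIMSEQ_unique by metis
      qed
      show "app n lap (\<lambda>l. Z (l, j)) i = 0" if "i < n" "j < n" for i j
      proof -
        have "(\<lambda>m. app n (A (r m)) (\<lambda>l. Y m (l, j)) i) \<longlonglongrightarrow> app n lap (\<lambda>l. Z (l, j)) i"
          by (intro app_tendsto A_lim r Zl that)
        moreover have "(\<lambda>m. app n (A (r m)) (\<lambda>l. Y m (l, j)) i) = (\<lambda>m. 0)" using Y that unfolding bad2_def by blast
        ultimately show ?thesis using LIMSEQ_unique[OF _ tendsto_const] by metis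
      qed
      show "dotp n (prj a) (app n (wtx start) (\<lambda>l. Z (l, j))) = 0" if "a < h" "j < n" for a j
      proof -
        \<comment> \<open>Pairing with \<open>prj a\<close> removes \<open>lap\<close>; dividing by
          the square of the parameter leaves a condition on the weights that survives in the
          limit.\<close>
        have "dotp n (prj a) (app n (wtx (X (r m))) (\<lambda>l. Y m (l, j))) = 0" for m
        proof -
          have "0 = dotp n (prj a) (app n (A (r m)) (\<lambda>l. Y m (l, j)))"
            using Y that(2) unfolding bad2_def dotp_def by simp
          also have "\<dots> = (sm (r m))\<^sup>2 * dotp n (prj a) (app n (wtx (X (r m))) (\<lambda>l. Y m (l, j)))"
            unfolding app_A[abs_def] dotp_add_right dotp_scale_right using dotp_prj_lap[OF that(1)] by simp
          finally show ?thesis using sm(1)[of "r m"] by simp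
        qed
        moreover have "(\<lambda>m. dotp n (prj a) (app n (wtx (X (r m))) (\<lambda>l. Y m (l, j)))) \<longlonglongrightarrow>
          dotp n (prj a) (app n (wtx start) (\<lambda>l. Z (l, j)))"
          by (intro dotp_tendsto app_tendsto W_lim r Zl that tendsto_const)
        ultimately show ?thesis using LIMSEQ_unique[OF _ tendsto_const] by simp
      qed
      show "Z (i, j) = 0" if "i < n" "j < n" "i = j \<or> (i, j) \<in> E" for i j
      proof -
        have "(\<lambda>m. Y m (i, j)) = (\<lambda>m. 0)" using Y that unfolding bad2_def by blast
        then show ?thesis using Zl[OF that(1,2)] LIMSEQ_unique[OF _ tendsto_const] by metis
      qed
    qed
    then show "\<forall>p\<in>{..<n} \<times> {..<n}. Z p = 0" by auto
  qed simp
  then obtain m2 where m2: "\<And>m Y i j. m \<ge> m2 \<Longrightarrow> bad2 m Y \<Longrightarrow> i < n \<Longrightarrow> j < n \<Longrightarrow> Y (i, j) = 0" by fastforce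
  have "(\<lambda>m. C * sm m) \<longlonglongrightarrow> 0" using tendsto_mult[OF tendsto_const[of C] sm_lim] by simp
  then have "\<forall>\<^sub>F m in sequentially. C * sm m < 1" by (rule order_tendstoD(2)) simp
  then obtain m3 where m3: "\<And>m. m \<ge> m3 \<Longrightarrow> C * sm m < 1" unfolding eventually_sequentially by blast
  define m where "m = max m1 (max m2 m3)"
  interpret join_solution n k E blk "sm m" "X m"
  proof
    show "0 < sm m" by (rule sm)
    show "X m (Inl (a, b)) = - (beta (sm m) (X m) a + beta (sm m) (X m) b) - sm m * corr (X m) a b"
      if "a \<le> b" "b < h" for a b
    proof -
      have "Inl (a, b) \<in> coords" using that by (simp add: coords_def)
      from X(1)[OF this, of m] show ?thesis
        unfolding beta_def leafsol_linear by (simp add: start_def incr_def algebra_simps)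
    qed
    show "app n lap (zeta (X m) b) i = - sm m * app n (wtx (X m)) (col (sm m) (X m) b) i"
      if i: "i < n" "h \<le> i" and b: "b < h" for i b
    proof -
      define y where "y = app n (wtx (X m)) (col (sm m) (X m) b)"
      have z: "zeta (X m) b j = - sm m * (\<Sum>l\<in>{h..<n}. g j l * y l)" if j: "j \<in> {h..<n}" for j
      proof -
        have "Inr (j, b) \<in> coords" using j b by (auto simp: coords_def)
        from X(1)[OF this, of m] show ?thesis using j by (simp add: zeta_def start_def incr_def y_def)
      qed
      have "app n lap (zeta (X m) b) i = (\<Sum>j\<in>{h..<n}. lap i j * zeta (X m) b j)"
        unfolding app_def by (rule sum.mono_neutral_cong_right) (auto simp: zeta_def)
      also have "\<dots> = (\<Sum>j\<in>{h..<n}. \<Sum>l\<in>{h..<n}. - sm m * (lap i j * g j l * y l))"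
        by (intro sum.cong) (auto simp: z sum_distrib_left mult_ac)
      also have "\<dots> = (\<Sum>l\<in>{h..<n}. \<Sum>j\<in>{h..<n}. - sm m * (lap i j * g j l * y l))" by (rule sum.swap)
      also have "\<dots> = (\<Sum>l\<in>{h..<n}. - sm m * ((\<Sum>j\<in>{h..<n}. lap i j * g j l) * y l))"
        by (simp add: sum_distrib_left sum_distrib_right)
      also have "\<dots> = (\<Sum>l\<in>{h..<n}. if l = i then - sm m * y i else 0)"
        by (intro sum.cong) (use g i in auto)
      also have "\<dots> = - sm m * y i" using i by simp
      finally show ?thesis by (simp add: y_def)
    qed
    show "X m (Inl (a, b)) < 0" if "a < b" "b < h" "a < k" for a b
    proof -
      have "Inl (a, b) \<in> coords" using that by (simp add: coords_def)
      moreover have "m \<ge> m3" by (simp add: m_def)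
      ultimately show ?thesis using X(2)[of "Inl (a, b)" m] m3[of m] start_Inl_le[OF that(3), of b] by linarith
    qed
    show "w i = 0" if "\<And>i. i < h \<Longrightarrow> w i = 0" "bilin n (\<lambda>i j. lap i j + (sm m)\<^sup>2 * wtx (X m) i j) w w \<le> 0" "i < n" for w i
    proof (rule m1[of m w i])
      show "bad1 m w" using that unfolding bad1_def A_def[abs_def] by blast
    qed (use that in \<open>auto simp: m_def\<close>)
  qed
  have "Mf = A m" by (simp add: Mf_def A_def fun_eq_iff)
  have "X' i j = 0" if X': "\<forall>i<n. \<forall>j<n. X' i j = X' j i" "\<forall>i<n. \<forall>j<n. app n (entries Mm) (\<lambda>l. X' l j) i = 0"
    "\<forall>i<n. \<forall>j<n. i = j \<or> (i, j) \<in> E \<longrightarrow> X' i j = 0" "i < n" "j < n" for X' i j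
  proof -
    have "bad2 m (\<lambda>(i, j). X' i j)"
      unfolding bad2_def using X' app_Mm \<open>Mf = A m\<close> by simp
    from m2[OF _ this that(4,5)] show ?thesis by (simp add: m_def)
  qed
  then show ?thesis
    using Mm_carrier Mm_symmetric Mm_edge Mm_non_edge one_negative_Mm kernel_dim_Mm
    by (intro exI[of _ Mm]) auto
qed

end

lemma conn_vimage:
  assumes f: "bij_betw f I S" and S: "conn E S"
    and E': "\<And>i j. i \<in> I \<Longrightarrow> j \<in> I \<Longrightarrow> (f i, f j) \<in> E \<Longrightarrow> (i, j) \<in> E'"
  shows "conn E' I"
  unfolding conn_def
proof (intro conjI allI impI)
  have fI: "f ` I = S" and inj: "inj_on f I" using f by (auto simp: bij_betw_def)
  show "I \<noteq> {}" using fI conn_nonempty[OF S] by auto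
  fix X assume X: "X \<subset> I" "X \<noteq> {}"
  have "f ` X \<subseteq> S" "f ` X \<noteq> {}" using X fI by auto
  moreover have "f ` X \<noteq> S"
  proof
    assume "f ` X = S"
    then have "f ` X = f ` I" using fI by simp
    then have "X = I" using inj_on_image_eq_iff[OF inj, of X I] X by auto
    then show False using X by auto
  qed
  ultimately obtain u v where uv: "u \<in> f ` X" "v \<in> S" "v \<notin> f ` X" "(u, v) \<in> E" by (rule connE[OF S])
  then obtain i j where "i \<in> X" "u = f i" "j \<in> I" "v = f j" using fI by auto
  then show "\<exists>x\<in>X. \<exists>y\<in>I - X. (x, y) \<in> E'" using uv E'[of i j] X by blast
qed

theorem colin_de_verdiere_of_join_minor:
  assumes G: "pair_graph G" and k: "k \<ge> 1"
    and minor: "has_minor (pverts G) (parcs G) {..<k + 3} (K_join_3K1 k)"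
  shows "k < colin_de_verdiere G"
proof -
  note GE = pair_graph_arcs[OF G]
  define n where "n = card (pverts G)"
  obtain B where B: "branch_sets (pverts G) (parcs G) {..<k + 3} (K_join_3K1 k) B"
    using minor unfolding has_minor_def by blast
  have BV: "B a \<subseteq> pverts G" "conn (parcs G) (B a)" if "a < k + 3" for a
    using B that unfolding branch_sets_def by auto
  have Bdisj: "B a \<inter> B b = {}" if "a < k + 3" "b < k + 3" "a \<noteq> b" for a b
    using B that unfolding branch_sets_def by auto
  define r where "r a = (SOME x. x \<in> B a)" for a
  have rB: "r a \<in> B a" if "a < k + 3" for a
    unfolding r_def using conn_nonempty[OF BV(2)[OF that]] by (rule some_in_eq[THEN iffD2])
  have r_inj: "inj_on r {..<k + 3}"
  proof (rule inj_onI)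
    fix a b assume "a \<in> {..<k + 3}" "b \<in> {..<k + 3}" "r a = r b"
    then show "a = b" using rB[of a] rB[of b] Bdisj[of a b] by auto
  qed
  have rV: "r ` {..<k + 3} \<subseteq> pverts G" using rB BV by blast
  have "card (r ` {..<k + 3}) = k + 3" using r_inj by (simp add: card_image)
  then have size: "k + 3 \<le> n" using card_mono[OF GE(1) rV] by (simp add: n_def)
  define V' where "V' = pverts G - r ` {..<k + 3}"
  have cV': "card V' = n - (k + 3)"
    using \<open>card (r ` {..<k + 3}) = k + 3\<close> rV by (simp add: V'_def card_Diff_subset n_def)
  have "finite V'" using GE(1) by (simp add: V'_def)
  from ex_bij_betw_nat_finite[OF this] obtain e where e: "bij_betw e {0..<n - (k + 3)} V'" unfolding cV' by blast
  \<comment> \<open>The numbering puts the chosen representatives first, representative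
    \<open>a\<close> at index \<open>a\<close>, as \<open>join_minor\<close> demands.\<close>
  define f where "f i = (if i < k + 3 then r i else e (i - (k + 3)))" for i
  have f: "bij_betw f {..<n} (pverts G)"
  proof -
    have "bij_betw f {..<k + 3} (r ` {..<k + 3})"
    proof (rule bij_betw_cong[THEN iffD1])
      show "bij_betw r {..<k + 3} (r ` {..<k + 3})" by (rule inj_on_imp_bij_betw[OF r_inj])
    qed (simp add: f_def)
    moreover have "bij_betw f {k + 3..<n} V'"
    proof -
      have "bij_betw (\<lambda>i. i - (k + 3)) {k + 3..<n} {0..<n - (k + 3)}"
        by (rule bij_betw_byWitness[of _ "\<lambda>i. i + (k + 3)"]) auto
      from bij_betw_trans[OF this e] have *: "bij_betw (e \<circ> (\<lambda>i. i - (k + 3))) {k + 3..<n} V'" .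
      show ?thesis by (rule bij_betw_cong[THEN iffD1, OF _ *]) (simp add: f_def)
    qed
    moreover have "r ` {..<k + 3} \<inter> V' = {}" by (auto simp: V'_def)
    ultimately have "bij_betw f ({..<k + 3} \<union> {k + 3..<n}) (r ` {..<k + 3} \<union> V')" by (rule bij_betw_combine)
    moreover have "{..<k + 3} \<union> {k + 3..<n} = {..<n}" using size by auto
    moreover have "r ` {..<k + 3} \<union> V' = pverts G" using rV by (auto simp: V'_def)
    ultimately show ?thesis by simp
  qed
  have fV: "f i \<in> pverts G" if "i < n" for i using f that by (auto simp: bij_betw_def)
  define E where "E = index_arcs G n f"
  define blk where "blk i = (if \<exists>a<k + 3. f i \<in> B a then SOME a. a < k + 3 \<and> f i \<in> B a else k + 3)" for i
  have blk_iff: "blk i = a \<longleftrightarrow> f i \<in> B a" if a: "a < k + 3" for a i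
  proof
    assume "f i \<in> B a"
    then have ex: "\<exists>a<k + 3. f i \<in> B a" using a by blast
    then have "blk i < k + 3 \<and> f i \<in> B (blk i)" unfolding blk_def using someI_ex[OF ex] by simp
    then show "blk i = a" using Bdisj[of "blk i" a] a \<open>f i \<in> B a\<close> by auto
  next
    assume b: "blk i = a"
    then have ex: "\<exists>a<k + 3. f i \<in> B a" using a by (auto simp: blk_def split: if_splits)
    then show "f i \<in> B a" using b unfolding blk_def using someI_ex[OF ex] by auto
  qed
  interpret join_minor n k E blk
  proof
    show "1 \<le> k" "k + 3 \<le> n" by (fact k size)+
    show "sym E" using GE(2) by (auto simp: E_def index_arcs_def sym_def)
    show "irrefl E" using GE(3) by (auto simp: E_def index_arcs_def irrefl_def)
    show "blk a = a" if "a < k + 3" for a using blk_iff[OF that] rB[OF that] that by (simp add: f_def)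
    show "blk i \<le> k + 3" for i
    proof (cases "\<exists>a<k + 3. f i \<in> B a")
      case True
      then obtain a where "a < k + 3" "f i \<in> B a" by blast
      then show ?thesis using blk_iff[of a i] by simp
    qed (auto simp: blk_def)
    show "conn E {i. i < n \<and> blk i = a}" if a: "a < k + 3" for a
    proof (rule conn_vimage[OF _ BV(2)[OF a]])
      have "{i. i < n \<and> blk i = a} = {i \<in> {..<n}. f i \<in> B a}" using blk_iff[OF a] by auto
      moreover have "f ` {i \<in> {..<n}. f i \<in> B a} = B a"
        using f BV(1)[OF a] unfolding bij_betw_def by auto
      ultimately show "bij_betw f {i. i < n \<and> blk i = a} (B a)"
        using f unfolding bij_betw_def by (auto intro: inj_on_subset)
    qed (auto simp: E_def index_arcs_def)
    show "\<exists>i<n. \<exists>j<n. blk i = a \<and> blk j = b \<and> (i, j) \<in> E"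
      if ab: "a < k + 3" "b < k + 3" "a \<noteq> b" "a < k \<or> b < k" for a b
    proof -
      have "(a, b) \<in> K_join_3K1 k" using ab(4) by (simp add: K_join_3K1_def)
      then obtain u v where uv: "u \<in> B a" "v \<in> B b" "(u, v) \<in> parcs G"
        using B ab unfolding branch_sets_def by blast
      then have "u \<in> f ` {..<n}" "v \<in> f ` {..<n}" using BV(1)[OF ab(1)] BV(1)[OF ab(2)] f by (auto simp: bij_betw_def)
      then obtain i j where "i < n" "u = f i" "j < n" "v = f j" by auto
      then show ?thesis using uv blk_iff[OF ab(1)] blk_iff[OF ab(2)] by (auto simp: E_def index_arcs_def)
    qed
  qed
  obtain M where M: "M \<in> carrier_mat n n" "M\<^sup>T = M"
    and edge: "\<forall>i<n. \<forall>j<n. (i, j) \<in> E \<longrightarrow> entries M i j < 0"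
    and non_edge: "\<forall>i<n. \<forall>j<n. i \<noteq> j \<and> (i, j) \<notin> E \<longrightarrow> entries M i j = 0"
    and one: "one_negative_eigenvalue M" and dim: "k < kernel_dim M"
    and sap: "\<forall>X. (\<forall>i<n. \<forall>j<n. X i j = X j i) \<and> (\<forall>i<n. \<forall>j<n. app n (entries M) (\<lambda>l. X l j) i = 0) \<and>
      (\<forall>i<n. \<forall>j<n. i = j \<or> (i, j) \<in> E \<longrightarrow> X i j = 0) \<longrightarrow> (\<forall>i<n. \<forall>j<n. X i j = 0)"
    using large_corank_matrix_exists by (elim exE conjE) (rule that)
  have "strong_arnold_property G n f M"
    unfolding strong_arnold_property_def
  proof
    assume "\<exists>X. X \<in> carrier_mat n n \<and> X\<^sup>T = X \<and> X \<noteq> 0\<^sub>m n n \<and> M * X = 0\<^sub>m n n \<and>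
      (\<forall>i<n. \<forall>j<n. i = j \<or> (f i, f j) \<in> parcs G \<longrightarrow> X $$ (i, j) = 0)"
    then obtain X where X: "X \<in> carrier_mat n n" "X\<^sup>T = X" "X \<noteq> 0\<^sub>m n n" "M * X = 0\<^sub>m n n"
      "\<forall>i<n. \<forall>j<n. i = j \<or> (f i, f j) \<in> parcs G \<longrightarrow> X $$ (i, j) = 0" by blast
    have "\<forall>i<n. \<forall>j<n. entries X i j = 0"
    proof (rule sap[THEN spec, THEN mp], intro conjI)
      show "\<forall>i<n. \<forall>j<n. entries X i j = entries X j i" using symf_entries[OF X(1,2)] by (simp add: symf_def)
      show "\<forall>i<n. \<forall>j<n. app n (entries M) (\<lambda>l. entries X l j) i = 0"
      proof (intro allI impI)
        fix i j assume ij: "i < n" "j < n"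
        have "app n (entries M) (\<lambda>l. entries X l j) i = (M * X) $$ (i, j)"
          using ij M X(1) by (simp add: scalar_prod_def app_def entries_def lessThan_atLeast0)
        then show "app n (entries M) (\<lambda>l. entries X l j) i = 0" using X(4) ij by simp
      qed
      show "\<forall>i<n. \<forall>j<n. i = j \<or> (i, j) \<in> E \<longrightarrow> entries X i j = 0"
        using X(5) by (auto simp: entries_def E_def index_arcs_def)
    qed
    then have "X = 0\<^sub>m n n" using X(1) by (intro eq_matI) (auto simp: entries_def)
    then show False using X(3) by simp
  qed
  then have "colin_de_verdiere_matrix G n f M"
    using M edge non_edge one unfolding colin_de_verdiere_matrix_def one_negative_eigenvalue_def
    by (auto simp: E_def index_arcs_def entries_def)
  then have "kernel_dim M \<in> colin_de_verdiere_coranks G"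
    using f unfolding colin_de_verdiere_coranks_def n_def by blast
  then have "kernel_dim M \<le> colin_de_verdiere G"
    unfolding colin_de_verdiere_def
    by (intro cSup_upper) (auto intro: bdd_above_finite finite_colin_de_verdiere_coranks)
  then show ?thesis using dim by simp
qed

section \<open>The asymptotics of the defect\<close>

definition log_ceil :: "nat \<Rightarrow> nat"
  where "log_ceil m = (LEAST l. m \<le> 2 ^ l)"

text \<open>The smallest degree that \<open>choosable_of_no_minor\<close> admits with exponent M = 2
  \<open>log_ceil (k + 3)\<close> + 10. One \<open>log_ceil (k + 3)\<close> in \<open>M\<close>
  absorbs the factor k + 3 of the degree, the rest its logarithmic factor.\<close>

definition minor_degree :: "nat \<Rightarrow> nat"
  where "minor_degree k = 18 * (k + 3) * (2 * log_ceil (k + 3) + 11)"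

lemma le_two_power_log_ceil: "m \<le> 2 ^ log_ceil m"
  unfolding log_ceil_def by (rule LeastI[of "\<lambda>l. m \<le> 2 ^ l" m]) simp

lemma log_ceil_le:
  assumes "m \<ge> 1"
  shows "real (log_ceil m) \<le> log 2 (real m) + 1"
proof (cases "log_ceil m")
  case 0
  then show ?thesis using assms by simp
next
  case (Suc l)
  have "\<not> m \<le> 2 ^ l" using not_less_Least[of l "\<lambda>l. m \<le> 2 ^ l"] Suc by (simp add: log_ceil_def)
  then have "real (2 ^ l) \<le> real m" by (simp only: of_nat_le_iff)
  then have "2 powr real l \<le> real m" by (simp add: powr_realpow)
  then have "real l \<le> log 2 (real m)" using assms by (simp add: le_log_iff)
  then show ?thesis using Suc by simp
qed

lemma minor_degree_pos: "1 \<le> minor_degree k"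
proof -
  have "0 < minor_degree k" unfolding minor_degree_def by (simp only: nat_0_less_mult_iff) simp
  then show ?thesis by simp
qed

lemma minor_degree_le_power: "2 * minor_degree k \<le> 2 ^ (2 * log_ceil (k + 3) + 10)"
proof -
  have aux: "36 * (2 * l + 11) \<le> (2 :: nat) ^ (l + 10)" for l
  proof (induction l)
    case (Suc l)
    have "1024 \<le> (2 :: nat) ^ (l + 10)" by (simp add: power_add)
    moreover have "(2 :: nat) ^ (Suc l + 10) = 2 * 2 ^ (l + 10)" by (simp only: add_Suc power_Suc)
    moreover have "36 * (2 * Suc l + 11) = 36 * (2 * l + 11) + 72" by simp
    ultimately show ?case using Suc by linarith
  qed simp
  define l where "l = log_ceil (k + 3)"
  have "2 * minor_degree k = (k + 3) * (36 * (2 * l + 11))" by (simp add: minor_degree_def l_def algebra_simps)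
  also have "\<dots> \<le> 2 ^ l * 2 ^ (l + 10)"
    by (rule mult_mono[OF le_two_power_log_ceil[of "k + 3", folded l_def] aux[of l]]) simp_all
  also have "\<dots> = 2 ^ (2 * l + 10)" by (simp only: power_add[symmetric] mult_2 add.assoc)
  finally show ?thesis by (simp add: l_def)
qed

text \<open>Since ln 2 is at least 1/2 and ln k at least 1, the logarithmic factor is at most 4 ln k
  + 15, hence at most 19 ln k. With k + 3 at most 2k this gives 1368 = 72 * 19.\<close>

lemma minor_degree_upper:
  assumes k: "k \<ge> 3"
  shows "real (2 * minor_degree k) \<le> 1368 * (real k * ln (real k))"
proof -
  have ln1: "1 \<le> ln (real k)"
  proof -
    have "exp 1 \<le> real k" using exp_le k by linarith
    then show ?thesis using k by (simp add: ln_ge_iff)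
  qed
  have "ln 2 \<ge> (1 / 2 :: real)"
  proof -
    have "exp (1 / 2 :: real) ^ 2 \<le> 2 ^ 2" using exp_le by (simp add: power2_eq_square exp_add[symmetric])
    then have "exp (1 / 2 :: real) \<le> 2" by (rule power2_le_imp_le) simp
    then show ?thesis by (subst ln_ge_iff) auto
  qed
  have "real (log_ceil (k + 3)) \<le> log 2 (real (k + 3)) + 1" by (rule log_ceil_le) simp
  also have "log 2 (real (k + 3)) \<le> log 2 (2 * real k)" using k by simp
  also have "\<dots> = 1 + ln (real k) / ln 2" 
    using k ln_mult[of 2 "real k"] by (simp add: log_def add_divide_distrib)
  also have "ln (real k) / ln 2 \<le> ln (real k) / (1 / 2)"
    using \<open>ln 2 \<ge> 1 / 2\<close> ln1 by (intro divide_left_mono) auto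
  finally have 1: "2 * real (log_ceil (k + 3)) + 11 \<le> 19 * ln (real k)" using ln1 by simp
  have 2: "36 * (real k + 3) \<le> 72 * real k" using k by simp
  have "(36 * (real k + 3)) * (2 * real (log_ceil (k + 3)) + 11) \<le> (72 * real k) * (19 * ln (real k))"
    by (rule mult_mono[OF 2 1]) auto
  also have "(36 * (real k + 3)) * (2 * real (log_ceil (k + 3)) + 11) = real (2 * minor_degree k)"
    unfolding minor_degree_def by (simp add: algebra_simps)
  finally show ?thesis by simp
qed

text \<open>The term of index \<open>m\<close> in the exponential series of \<open>m\<close> is at
  most its sum.\<close>

lemma power_le_exp_mult_fact: "real m ^ m \<le> exp 1 ^ m * fact m"
proof -
  have s: "(\<lambda>i. inverse (fact i) * real m ^ i) sums exp (real m)"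
    using exp_converges[of "real m"] by (simp add: scaleR_conv_of_real)
  have "(\<Sum>i\<in>{m}. inverse (fact i) * real m ^ i) \<le> (\<Sum>i. inverse (fact i) * real m ^ i)"
    by (rule sum_le_suminf) (use s in \<open>auto simp: sums_iff\<close>)
  then have "inverse (fact m) * real m ^ m \<le> exp (real m)" using s by (simp add: sums_iff)
  then have "real m ^ m \<le> exp (real m) * fact m" by (simp add: field_simps)
  also have "exp (real m) = exp 1 ^ m" by (simp add: exp_of_nat_mult[symmetric])
  finally show ?thesis .
qed

text \<open>The factor m! saved against D^m is at least (m/3)^m. For D = O(k log k) and m = k - 1
  only a power of log k remains, which is the source of the double logarithm.\<close>

lemma binomial_le_power:
  assumes "m \<ge> 1"
  shows "real (D choose m) \<le> (3 * real D / real m) ^ m"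
proof -
  have "real (D choose m) * real m ^ m \<le> real (D choose m) * (exp 1 ^ m * fact m)"
    by (rule mult_left_mono[OF power_le_exp_mult_fact]) simp
  also have "\<dots> \<le> real (D choose m) * (3 ^ m * fact m)"
    using exp_le by (intro mult_left_mono mult_right_mono power_mono) auto
  also have "\<dots> = 3 ^ m * real ((D choose m) * fact m)" by simp
  also have "\<dots> \<le> 3 ^ m * real (D ^ m)" by (intro mult_left_mono of_nat_mono binomial_fact_pow) simp
  finally show ?thesis using assms by (simp add: power_divide power_mult_distrib field_simps)
qed

lemma defect_bound_pos: "1 \<le> D \<Longrightarrow> 1 \<le> defect_bound D k"
  by (simp add: defect_bound_def)

text \<open>8208 = 3 * 1368 * 2, the last factor because k is at most 2(k - 1). With
  \<open>U\<close> and \<open>c\<close> at least 1, the bracket 1 + 2D + 2 (D choose (k - 1)) is at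
  most (1 + 2 + 2) U c, whence 10 = 2 * 5.\<close>

lemma defect_bound_upper:
  assumes k: "k \<ge> 3"
  shows "real (defect_bound (2 * minor_degree k) k) \<le>
    10 * (1368 * (real k * ln (real k))) ^ 2 * (8208 * ln (real k)) ^ k"
proof -
  define D where "D = 2 * minor_degree k"
  define U where "U = 1368 * (real k * ln (real k))"
  define c where "c = (8208 * ln (real k)) ^ k"
  have ln1: "1 \<le> ln (real k)"
  proof -
    have "exp 1 \<le> real k" using exp_le k by linarith
    then show ?thesis using k by (simp add: ln_ge_iff)
  qed
  have D1: "1 \<le> real D" using minor_degree_pos[of k] by (simp add: D_def)
  have DU: "real D \<le> U" unfolding D_def U_def by (rule minor_degree_upper[OF k])
  have "real (D choose (k - 1)) \<le> (3 * real D / real (k - 1)) ^ (k - 1)" using k by (intro binomial_le_power) simp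
  also have "3 * real D / real (k - 1) \<le> 8208 * ln (real k)"
  proof -
    have "3 * real D \<le> 4104 * real k * ln (real k)" using DU by (simp add: U_def)
    also have "\<dots> \<le> 8208 * ln (real k) * real (k - 1)"
    proof -
      have "real k \<le> 2 * real (k - 1)" using k by simp
      then have "4104 * ln (real k) * real k \<le> 4104 * ln (real k) * (2 * real (k - 1))"
        using ln1 by (intro mult_left_mono) auto
      then show ?thesis by (simp add: mult_ac)
    qed
    finally show ?thesis using k by (simp add: field_simps)
  qed
  then have "(3 * real D / real (k - 1)) ^ (k - 1) \<le> (8208 * ln (real k)) ^ (k - 1)"
    by (intro power_mono) auto
  also have "\<dots> \<le> c" unfolding c_def using ln1 by (intro power_increasing) auto
  finally have C: "real (D choose (k - 1)) \<le> c" .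
  have c1: "1 \<le> c" unfolding c_def using ln1 by (intro one_le_power) simp
  have U1: "1 \<le> U" using D1 DU by linarith
  have Uc: "U \<le> U * c" "c \<le> U * c" using mult_left_mono[OF c1, of U] mult_right_mono[OF U1, of c] U1 c1 by auto
  have "real (defect_bound D k) = 2 * real D * (1 + 2 * real D + 2 * real (D choose (k - 1)))"
    unfolding defect_bound_def by (simp only: of_nat_mult of_nat_add of_nat_numeral of_nat_1)
  also have "\<dots> \<le> 2 * U * (5 * (U * c))"
  proof (rule mult_mono)
    show "1 + 2 * real D + 2 * real (D choose (k - 1)) \<le> 5 * (U * c)" using DU C U1 Uc by linarith
  qed (use DU U1 in auto)
  also have "\<dots> = 10 * U ^ 2 * c" by (simp add: power2_eq_square)
  finally show ?thesis by (simp add: D_def U_def c_def)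
qed

lemma ln_products:
  fixes a b c K L :: real
  assumes "0 < a" "0 < b" "0 < c" "0 < K" "0 < L"
  shows "ln (a * (b * (K * L)) ^ 2 * (c * L) ^ n) = ln a + 2 * (ln b + ln K + ln L) + real n * (ln c + ln L)"
  using assms by (simp add: ln_mult ln_realpow algebra_simps)

lemma log_defect_bound_bigo:
  "(\<lambda>k. log 2 (real (defect_bound (2 * minor_degree k) k))) \<in> O(\<lambda>k. real k * ln (ln (real k)))"
proof -
  define F where "F x = (ln 10 + 2 * (ln 1368 + ln x + ln (ln x)) + x * (ln 8208 + ln (ln x))) / ln 2" for x :: real
  have "(\<lambda>k. log 2 (real (defect_bound (2 * minor_degree k) k))) \<in> O(\<lambda>k. F (real k))"
  proof (rule bigoI[of _ 1], rule eventually_sequentiallyI[of 3])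
    fix k :: nat
    assume k: "3 \<le> k"
    have ln1: "1 \<le> ln (real k)"
    proof -
      have "exp 1 \<le> real k" using exp_le k by linarith
      then show ?thesis using k by (simp add: ln_ge_iff)
    qed
    define d where "d = real (defect_bound (2 * minor_degree k) k)"
    have "1 \<le> defect_bound (2 * minor_degree k) k"
      by (rule defect_bound_pos) (use minor_degree_pos[of k] in simp)
    then have d1: "1 \<le> d" unfolding d_def by linarith
    have "d \<le> 10 * (1368 * (real k * ln (real k))) ^ 2 * (8208 * ln (real k)) ^ k"
      unfolding d_def by (rule defect_bound_upper[OF k])
    then have "ln d \<le> ln (10 * (1368 * (real k * ln (real k))) ^ 2 * (8208 * ln (real k)) ^ k)"
      using d1 by (intro ln_mono) auto
    also have "\<dots> = ln 10 + 2 * (ln 1368 + ln (real k) + ln (ln (real k))) + real k * (ln 8208 + ln (ln (real k)))"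
      using k ln1 by (intro ln_products) auto
    finally have "log 2 d \<le> F (real k)" by (simp add: F_def log_def divide_right_mono)
    moreover have "0 \<le> log 2 d" using d1 by simp
    ultimately show "norm (log 2 (real (defect_bound (2 * minor_degree k) k))) \<le> 1 * norm (F (real k))"
      by (simp add: d_def)
  qed
  also have "(\<lambda>k. F (real k)) \<in> O(\<lambda>k. real k * ln (ln (real k)))"
    unfolding F_def by real_asymp
  finally show ?thesis .
qed

section \<open>Both bounds for the class of graphs of bounded parameter\<close>

lemma defective_choosable_class:
  assumes k: "k \<ge> 1" and G: "G \<in> colin_de_verdiere_class k"
  shows "defective_choosable G k (defect_bound (2 * minor_degree k) k)"
  unfolding defective_choosable_def
proof (intro allI impI)
  fix L :: "nat \<Rightarrow> nat set"
  assume L: "\<forall>v\<in>pverts G. finite (L v) \<and> card (L v) = k"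
  have pg: "pair_graph G" and mu: "colin_de_verdiere G \<le> k" using G by (auto simp: colin_de_verdiere_class_def)
  note GE = pair_graph_arcs[OF pg]
  have no_minor: "\<not> has_minor (pverts G) (parcs G) {..<k + 3} (K_join_3K1 k)"
    using colin_de_verdiere_of_join_minor[OF pg k] mu by auto
  have "\<exists>c. \<forall>v\<in>pverts G. c v \<in> L v \<and>
    card {w \<in> nbrs (pverts G) (parcs G) v. c w = c v} \<le> defect_bound (2 * minor_degree k) k"
  proof (rule choosable_of_no_minor[where M = "2 * log_ceil (k + 3) + 10"])
    show "18 * (k + 3) * (2 * log_ceil (k + 3) + 10 + 1) \<le> minor_degree k" by (simp add: minor_degree_def)
    show "2 * minor_degree k \<le> 2 ^ (2 * log_ceil (k + 3) + 10)" by (rule minor_degree_le_power)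
    show "finite (L v) \<and> card (L v) = k" if "v \<in> pverts G" for v using L that by simp
  qed (fact GE k no_minor)+
  then obtain c where c: "\<forall>v\<in>pverts G. c v \<in> L v \<and>
    card {w \<in> nbrs (pverts G) (parcs G) v. c w = c v} \<le> defect_bound (2 * minor_degree k) k" ..
  have "{w. (v, w) \<in> parcs G \<and> c w = c v} = {w \<in> nbrs (pverts G) (parcs G) v. c w = c v}" for v
    using GE(4) by (auto simp: nbrs_def)
  then show "\<exists>c. (\<forall>v\<in>pverts G. c v \<in> L v) \<and> has_defect G c (defect_bound (2 * minor_degree k) k)"
    using c unfolding has_defect_def by (intro exI[of _ c]) simp
qed

lemma defective_choosable_imp_colourable: "defective_choosable G k d \<Longrightarrow> defective_colourable G k d"
  unfolding defective_choosable_def defective_colourable_def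
  by (erule allE[of _ "\<lambda>_. {..<k}"]) simp

lemma defective_colourable_mono:
  assumes "defective_colourable G k d" "k \<le> k'"
  shows "defective_colourable G k' d"
proof -
  obtain c where c: "\<And>v. v \<in> pverts G \<Longrightarrow> c v < k" "has_defect G c d"
    using assms(1) by (auto simp: defective_colourable_def)
  then have "c v < k'" if "v \<in> pverts G" for v using c(1)[OF that] assms(2) by simp
  then show ?thesis using c(2) by (auto simp: defective_colourable_def)
qed

lemma le_of_colourable_class:
  assumes k: "k \<ge> 1" and col: "\<And>G. G \<in> colin_de_verdiere_class k \<Longrightarrow> defective_colourable G l d"
  shows "k \<le> l"
proof (rule ccontr)
  assume "\<not> k \<le> l"
  obtain m where m: "k = Suc m" using k by (cases k) auto
  have "tree_closure k d \<in> colin_de_verdiere_class k"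
    using pair_graph_tree_closure colin_de_verdiere_tree_closure[OF k] by (simp add: colin_de_verdiere_class_def)
  moreover have "l \<le> m" using \<open>\<not> k \<le> l\<close> m by simp
  ultimately have "defective_colourable (tree_closure k d) m d" by (rule defective_colourable_mono[OF col])
  then show False using tree_closure_not_defective_colourable[of m d] m by simp
qed

lemma Inf_enat_image_eq:
  assumes "k \<in> K" "\<And>l. l \<in> K \<Longrightarrow> k \<le> l"
  shows "Inf (enat ` K) = enat k"
proof (rule antisym)
  show "Inf (enat ` K) \<le> enat k" using assms(1) by (intro Inf_lower) auto
  show "enat k \<le> Inf (enat ` K)" using assms(2) by (intro Inf_greatest) auto
qed

theorem theorem31:
  shows "(\<forall>k::nat. k \<ge> 1 \<longrightarrow>
            defective_chromatic_number (colin_de_verdiere_class k) = enat k \<and>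
            defective_choice_number (colin_de_verdiere_class k) = enat k) \<and>
         (\<exists>(d :: nat \<Rightarrow> nat) (g :: nat \<Rightarrow> real).
            g \<in> O(\<lambda>k. real k * ln (ln (real k))) \<and>
            (\<forall>k\<ge>1. real (d k) = 2 powr g k \<and>
                   (\<forall>G\<in>colin_de_verdiere_class k. defective_choosable G k (d k))))"
proof (intro conjI allI impI)
  fix k :: nat
  assume k: "k \<ge> 1"
  note choosable = defective_choosable_class[OF k]
  show "defective_chromatic_number (colin_de_verdiere_class k) = enat k"
    unfolding defective_chromatic_number_def
  proof (rule Inf_enat_image_eq)
    show "k \<in> {k'. \<exists>d. \<forall>G\<in>colin_de_verdiere_class k. defective_colourable G k' d}"
      using choosable defective_choosable_imp_colourable by blast
    show "k \<le> l" if "l \<in> {k'. \<exists>d. \<forall>G\<in>colin_de_verdiere_class k. defective_colourable G k' d}" for l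
      using that le_of_colourable_class[OF k] by blast
  qed
  show "defective_choice_number (colin_de_verdiere_class k) = enat k"
    unfolding defective_choice_number_def
  proof (rule Inf_enat_image_eq)
    show "k \<in> {k'. \<exists>d. \<forall>G\<in>colin_de_verdiere_class k. defective_choosable G k' d}"
      using choosable by blast
    show "k \<le> l" if "l \<in> {k'. \<exists>d. \<forall>G\<in>colin_de_verdiere_class k. defective_choosable G k' d}" for l
      using that le_of_colourable_class[OF k] defective_choosable_imp_colourable by blast
  qed
next
  define d where "d k = defect_bound (2 * minor_degree k) k" for k
  have "0 < d k" for k
    using defect_bound_pos[of "2 * minor_degree k" k] minor_degree_pos[of k] by (simp add: d_def)
  then have "\<forall>k\<ge>1. real (d k) = 2 powr log 2 (real (d k)) \<and>
      (\<forall>G\<in>colin_de_verdiere_class k. defective_choosable G k (d k))"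
    using defective_choosable_class by (simp add: d_def)
  moreover have "(\<lambda>k. log 2 (real (d k))) \<in> O(\<lambda>k. real k * ln (ln (real k)))"
    unfolding d_def by (rule log_defect_bound_bigo)
  ultimately show "\<exists>(d :: nat \<Rightarrow> nat) (g :: nat \<Rightarrow> real).
            g \<in> O(\<lambda>k. real k * ln (ln (real k))) \<and>
            (\<forall>k\<ge>1. real (d k) = 2 powr g k \<and>
                   (\<forall>G\<in>colin_de_verdiere_class k. defective_choosable G k (d k)))" by blast
qed

end
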